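(* Let $\mathscr G$ be an ample groupoid, $\mathcal O$ a $\mathscr G$-sheaf of rings and $x\in\mathscr G^{(0)}$. If $M$ is a simple left $B_x$-module, then $\mathrm{Ind}_x(M)$ is a simple left $\Gamma_c(\mathscr G,\mathcal O)$-module.
   Context: "Compact" includes Hausdorff. A groupoid $\mathscr G$ (identified with its set of arrows) has unit space $\mathscr G^{(0)}$, $\boldsymbol d(\gamma)=\gamma^{-1}\gamma$, $\boldsymbol r(\gamma)=\gamma\gamma^{-1}$. It is ample if it is a topological groupoid such that $\mathscr G^{(0)}$ is locally compact Hausdorff with a basis of compact open sets and $\boldsymbol r$ is a local homeomorphism. A bisection is a subset on which $\boldsymbol d$ and $\boldsymbol r$ are injective. $\mathscr G_x^x=\{g:\boldsymbol d(g)=\boldsymbol r(g)=x\}$. A $\mathscr G$-sheaf $(E,p,\alpha)$ is a space $E$, a local homeomorphism $p:E\to\mathscr G^{(0)}$ and a continuous map $\alpha:\mathscr G\times_{\boldsymbol d,p}E\to E$, $(\gamma,e)\mapsto\alpha_\gamma(e)$, with $\alpha_{p(e)}(e)=e$, $p(\alpha_\gamma(e))=\boldsymbol r(\gamma)$, and $\alpha_\beta(\alpha_\gamma(e))=\alpha_{\beta\gamma}(e)$ whenever defined. The stalk at $x$ is $p^{-1}(x)$. A $\mathscr G$-sheaf of rings $\mathcal O=(E,p,\alpha)$ is a $\mathscr G$-sheaf with a unital ring structure on each stalk $\mathcal O_x$ such that fiberwise addition and multiplication $E\times_{p,p}E\to E$ and the unit section $x\mapsto 1_x$ are continuous, and each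 $\alpha_\gamma:\mathcal O_{\boldsymbol d(\gamma)}\to\mathcal O_{\boldsymbol r(\gamma)}$ is a (unital) ring homomorphism. $\Gamma_c(\mathscr G,\mathcal O)$ is the additive group generated by all maps $f:\mathscr G\to E$ with $p\circ f=\boldsymbol r$ for which there is a compact open bisection $U$ with $f|_U$ continuous and $f=0$ off $U$. It is a ring (with local units, not necessarily unital) under pointwise addition and convolution $(f*g)(\gamma)=\sum_{\beta\rho=\gamma}f(\beta)\alpha_\beta(g(\rho))$. $B_x=\mathcal O_x\rtimes\mathscr G_x^x$ is the skew group ring, with product $(b\delta)(c\eta)=b\alpha_\delta(c)\,\delta\eta$ for $b,c\in\mathcal O_x$, $\delta,\eta\in\mathscr G_x^x$. Let $\mathcal L_x=\bigoplus_{\boldsymbol d(\gamma)=x}\mathcal O_{\boldsymbol r(\gamma)}$, writing $a1_\gamma$ for the element with entry $a$ at coordinate $\gamma$ and $0$ elsewhere. It is a $\Gamma_c(\mathscr G,\mathcal O)$-$B_x$-bimodule via $a1_\gamma\cdot b\delta=a\alpha_\gamma(b)1_{\gamma\delta}$ and $f\cdot a1_\gamma=\sum_{\boldsymbol d(\beta)=\boldsymbol r(\gamma)}f(\beta)\alpha_\beta(a)1_{\beta\gamma}$. For a left $B_x$-module $M$, $\mathrm{Ind}_x(M)=\mathcal L_x\otimes_{B_x}M$, a left $\Gamma_c(\mathscr G,\mathcal O)$-module. A simple left $R$-module is a module $N$ with $RN\neq 0$ whose only submodules are $0$ and $N$. *)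

theory Defs
  imports
    "HOL-Algebra.Module"
    "HOL-Algebra.Product_Groups"
    "HOL-Algebra.Free_Abelian_Groups"
    "HOL-Analysis.Abstract_Topological_Spaces"
begin

section \<open>Topological preliminaries\<close>

text \<open>Compact sets are Hausdorff by convention. This matters because the arrow space of an
  ample groupoid need not be Hausdorff.\<close>

definition compact_Hausdorff_in :: "'a topology \<Rightarrow> 'a set \<Rightarrow> bool" where
  "compact_Hausdorff_in X K \<longleftrightarrow> compactin X K \<and> Hausdorff_space (subtopology X K)"

definition local_homeomorphism :: "'a topology \<Rightarrow> 'b topology \<Rightarrow> ('a \<Rightarrow> 'b) \<Rightarrow> bool" where
  "local_homeomorphism X Y f \<longleftrightarrow>
    (\<forall>a \<in> topspace X. \<exists>U. openin X U \<and> a \<in> U \<and> openin Y (f ` U) \<and>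
       homeomorphic_map (subtopology X U) (subtopology Y (f ` U)) f)"

section \<open>Ample groupoids\<close>

text \<open>A groupoid is identified with its set of arrows, the underlying set of its topology.
  Multiplication is a total HOL function, which is only meaningful on composable pairs
  \<open>(\<beta>, \<gamma>)\<close>, i.e. those with \<open>dmap G \<beta> = rmap G \<gamma>\<close>.\<close>

record 'g groupoid =
  arrow_top :: "'g topology"
  gcomp :: "'g \<Rightarrow> 'g \<Rightarrow> 'g" (infixl \<open>\<star>\<index>\<close> 70)
  ginv :: "'g \<Rightarrow> 'g"

abbreviation arrows :: "('g, 'z) groupoid_scheme \<Rightarrow> 'g set" where
  "arrows G \<equiv> topspace (arrow_top G)"

definition dmap :: "('g, 'z) groupoid_scheme \<Rightarrow> 'g \<Rightarrow> 'g" where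
  "dmap G \<gamma> = ginv G \<gamma> \<star>\<^bsub>G\<^esub> \<gamma>"

definition rmap :: "('g, 'z) groupoid_scheme \<Rightarrow> 'g \<Rightarrow> 'g" where
  "rmap G \<gamma> = \<gamma> \<star>\<^bsub>G\<^esub> ginv G \<gamma>"

definition units :: "('g, 'z) groupoid_scheme \<Rightarrow> 'g set" where
  "units G = dmap G ` arrows G"

definition unit_top :: "('g, 'z) groupoid_scheme \<Rightarrow> 'g topology" where
  "unit_top G = subtopology (arrow_top G) (units G)"

definition composable :: "('g, 'z) groupoid_scheme \<Rightarrow> ('g \<times> 'g) set" where
  "composable G = {(\<beta>, \<gamma>) \<in> arrows G \<times> arrows G. dmap G \<beta> = rmap G \<gamma>}"

locale groupoid =
  fixes G :: "('g, 'z) groupoid_scheme" (structure)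
  assumes inv_closed: "\<gamma> \<in> arrows G \<Longrightarrow> ginv G \<gamma> \<in> arrows G"
    and comp_closed: "(\<beta>, \<gamma>) \<in> composable G \<Longrightarrow> \<beta> \<star> \<gamma> \<in> arrows G"
    and d_inv: "\<gamma> \<in> arrows G \<Longrightarrow> dmap G (ginv G \<gamma>) = rmap G \<gamma>"
    and r_inv: "\<gamma> \<in> arrows G \<Longrightarrow> rmap G (ginv G \<gamma>) = dmap G \<gamma>"
    and d_comp: "(\<beta>, \<gamma>) \<in> composable G \<Longrightarrow> dmap G (\<beta> \<star> \<gamma>) = dmap G \<gamma>"
    and r_comp: "(\<beta>, \<gamma>) \<in> composable G \<Longrightarrow> rmap G (\<beta> \<star> \<gamma>) = rmap G \<beta>"
    and comp_assoc: "\<lbrakk>(\<alpha>, \<beta>) \<in> composable G; (\<beta>, \<gamma>) \<in> composable G\<rbrakk> \<Longrightarrow>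
      (\<alpha> \<star> \<beta>) \<star> \<gamma> = \<alpha> \<star> (\<beta> \<star> \<gamma>)"
    and r_unit: "\<gamma> \<in> arrows G \<Longrightarrow> rmap G \<gamma> \<star> \<gamma> = \<gamma>"
    and d_unit: "\<gamma> \<in> arrows G \<Longrightarrow> \<gamma> \<star> dmap G \<gamma> = \<gamma>"

locale topological_groupoid = groupoid +
  assumes comp_continuous:
      "continuous_map (subtopology (prod_topology (arrow_top G) (arrow_top G)) (composable G))
         (arrow_top G) (\<lambda>(\<beta>, \<gamma>). \<beta> \<star> \<gamma>)"
    and inv_continuous: "continuous_map (arrow_top G) (arrow_top G) (ginv G)"

locale ample_groupoid = topological_groupoid +
  assumes units_locally_compact: "locally_compact_space (unit_top G)"
    and units_Hausdorff: "Hausdorff_space (unit_top G)"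
    and units_compact_open_basis:
      "openin (unit_top G) =
         arbitrary union_of (\<lambda>K. openin (unit_top G) K \<and> compact_Hausdorff_in (unit_top G) K)"
    and r_local_homeomorphism: "local_homeomorphism (arrow_top G) (unit_top G) (rmap G)"

definition compact_open_bisection :: "('g, 'z) groupoid_scheme \<Rightarrow> 'g set \<Rightarrow> bool" where
  "compact_open_bisection G U \<longleftrightarrow>
     openin (arrow_top G) U \<and> compact_Hausdorff_in (arrow_top G) U \<and>
     inj_on (dmap G) U \<and> inj_on (rmap G) U"

definition isotropy :: "('g, 'z) groupoid_scheme \<Rightarrow> 'g \<Rightarrow> 'g set" where
  "isotropy G x = {\<gamma> \<in> arrows G. dmap G \<gamma> = x \<and> rmap G \<gamma> = x}"

definition source_fibre :: "('g, 'z) groupoid_scheme \<Rightarrow> 'g \<Rightarrow> 'g set" where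
  "source_fibre G x = {\<gamma> \<in> arrows G. dmap G \<gamma> = x}"

section \<open>Sheaves of rings over a groupoid\<close>

record ('g, 'e) groupoid_sheaf =
  etale_top :: "'e topology"
  proj :: "'e \<Rightarrow> 'g"
  act :: "'g \<Rightarrow> 'e \<Rightarrow> 'e"

locale groupoid_sheaf =
  fixes G :: "('g, 'z) groupoid_scheme" and E :: "('g, 'e, 'y) groupoid_sheaf_scheme"
  assumes proj_local_homeomorphism: "local_homeomorphism (etale_top E) (unit_top G) (proj E)"
    and act_continuous:
      "continuous_map
         (subtopology (prod_topology (arrow_top G) (etale_top E)) {(\<gamma>, e). dmap G \<gamma> = proj E e})
         (etale_top E) (\<lambda>(\<gamma>, e). act E \<gamma> e)"
    and act_unit: "e \<in> topspace (etale_top E) \<Longrightarrow> act E (proj E e) e = e"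
    and proj_act: "\<lbrakk>\<gamma> \<in> arrows G; e \<in> topspace (etale_top E); dmap G \<gamma> = proj E e\<rbrakk> \<Longrightarrow>
      proj E (act E \<gamma> e) = rmap G \<gamma>"
    and act_act:
      "\<lbrakk>(\<beta>, \<gamma>) \<in> composable G; e \<in> topspace (etale_top E); dmap G \<gamma> = proj E e\<rbrakk> \<Longrightarrow>
      act E \<beta> (act E \<gamma> e) = act E (\<beta> \<star>\<^bsub>G\<^esub> \<gamma>) e"

record ('g, 'e) ring_sheaf = "('g, 'e) groupoid_sheaf" +
  stalk :: "'g \<Rightarrow> 'e ring"

locale sheaf_of_rings = groupoid_sheaf G E
  for G :: "('g, 'z) groupoid_scheme" and E :: "('g, 'e, 'y) ring_sheaf_scheme" +
  assumes stalk_ring: "y \<in> units G \<Longrightarrow> ring (stalk E y)"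
    and stalk_carrier:
      "y \<in> units G \<Longrightarrow> carrier (stalk E y) = {e \<in> topspace (etale_top E). proj E e = y}"
    and add_continuous:
      "continuous_map
         (subtopology (prod_topology (etale_top E) (etale_top E)) {(a, b). proj E a = proj E b})
         (etale_top E) (\<lambda>(a, b). a \<oplus>\<^bsub>stalk E (proj E a)\<^esub> b)"
    and mult_continuous:
      "continuous_map
         (subtopology (prod_topology (etale_top E) (etale_top E)) {(a, b). proj E a = proj E b})
         (etale_top E) (\<lambda>(a, b). a \<otimes>\<^bsub>stalk E (proj E a)\<^esub> b)"
    and one_continuous: "continuous_map (unit_top G) (etale_top E) (\<lambda>y. \<one>\<^bsub>stalk E y\<^esub>)"
    and act_ring_hom: "\<gamma> \<in> arrows G \<Longrightarrow>
      act E \<gamma> \<in> ring_hom (stalk E (dmap G \<gamma>)) (stalk E (rmap G \<gamma>))"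

section \<open>Convolution\<close>

text \<open>The products of \<open>\<Gamma>\<^sub>c(G, E)\<close> and of the skew group ring, and both actions on \<open>L\<^sub>x\<close>, are given by
  the same formula \<open>\<gamma> \<mapsto> \<Sum>\<^bsub>\<beta>\<rho>=\<gamma>\<^esub> f(\<beta>) \<alpha>\<^sub>\<beta>(g(\<rho>))\<close>. They differ only in the sets \<open>A\<close>, \<open>B\<close>, \<open>C\<close> of
  arrows on which \<open>f\<close>, \<open>g\<close> and the result are defined. The constant \<^const>\<open>gfinprod\<close> forms
  the sum over the support of the summand, which is finite in all uses below. All functions
  are extensional: they take the value \<^const>\<open>undefined\<close> off their domain.\<close>

definition convolution ::
  "('g, 'z) groupoid_scheme \<Rightarrow> ('g, 'e, 'y) ring_sheaf_scheme \<Rightarrow> 'g set \<Rightarrow> 'g set \<Rightarrow> 'g set \<Rightarrow>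
    ('g \<Rightarrow> 'e) \<Rightarrow> ('g \<Rightarrow> 'e) \<Rightarrow> 'g \<Rightarrow> 'e" where
  "convolution G E A B C f g =
     (\<lambda>\<gamma>\<in>C. gfinprod (add_monoid (stalk E (rmap G \<gamma>)))
        (\<lambda>(\<beta>, \<rho>). f \<beta> \<otimes>\<^bsub>stalk E (rmap G \<gamma>)\<^esub> act E \<beta> (g \<rho>))
        {(\<beta>, \<rho>) \<in> composable G. \<beta> \<in> A \<and> \<rho> \<in> B \<and> \<beta> \<star>\<^bsub>G\<^esub> \<rho> = \<gamma>})"

text \<open>On monomials, convolution is the rule \<open>a\<beta> \<cdot> b\<rho> = a \<alpha>\<^sub>\<beta>(b) \<beta>\<rho>\<close>; see the lemma below.\<close>

definition monomial ::
  "('g, 'z) groupoid_scheme \<Rightarrow> ('g, 'e, 'y) ring_sheaf_scheme \<Rightarrow> 'g set \<Rightarrow> 'g \<Rightarrow> 'e \<Rightarrow> 'g \<Rightarrow> 'e" where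
  "monomial G E A \<beta> a = (\<lambda>\<gamma>\<in>A. if \<gamma> = \<beta> then a else \<zero>\<^bsub>stalk E (rmap G \<gamma>)\<^esub>)"

context sheaf_of_rings
begin

lemma convolution_monomial:
  assumes G: "groupoid G" and comp: "(\<beta>, \<rho>) \<in> composable G"
    and A: "\<beta> \<in> A" and B: "\<rho> \<in> B" and C: "C \<subseteq> arrows G"
    and a: "a \<in> carrier (stalk E (rmap G \<beta>))" and b: "b \<in> carrier (stalk E (rmap G \<rho>))"
  shows "convolution G E A B C (monomial G E A \<beta> a) (monomial G E B \<rho> b) =
    monomial G E C (\<beta> \<star>\<^bsub>G\<^esub> \<rho>) (a \<otimes>\<^bsub>stalk E (rmap G \<beta>)\<^esub> act E \<beta> b)"
proof -
  interpret G: groupoid G by (rule G)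
  have r_in: "rmap G \<gamma> \<in> units G" if "\<gamma> \<in> arrows G" for \<gamma>
    using G.d_inv[OF that] G.inv_closed[OF that] unfolding units_def by force
  have "gfinprod (add_monoid (stalk E (rmap G \<gamma>)))
        (\<lambda>(\<beta>', \<rho>'). monomial G E A \<beta> a \<beta>' \<otimes>\<^bsub>stalk E (rmap G \<gamma>)\<^esub> act E \<beta>' (monomial G E B \<rho> b \<rho>'))
        {(\<beta>', \<rho>') \<in> composable G. \<beta>' \<in> A \<and> \<rho>' \<in> B \<and> \<beta>' \<star>\<^bsub>G\<^esub> \<rho>' = \<gamma>} =
      (if \<gamma> = \<beta> \<star>\<^bsub>G\<^esub> \<rho> then a \<otimes>\<^bsub>stalk E (rmap G \<beta>)\<^esub> act E \<beta> b else \<zero>\<^bsub>stalk E (rmap G \<gamma>)\<^esub>)"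
    (is "gfinprod ?S ?h ?I = _") if "\<gamma> \<in> C" for \<gamma>
  proof -
    have \<gamma>: "\<gamma> \<in> arrows G" using that C by blast
    interpret S: ring "stalk E (rmap G \<gamma>)" by (rule stalk_ring[OF r_in[OF \<gamma>]])
    have zero: "?h q = \<zero>\<^bsub>stalk E (rmap G \<gamma>)\<^esub>" if q: "q \<in> ?I" "q \<noteq> (\<beta>, \<rho>)" for q
    proof -
      obtain \<beta>' \<rho>' where q': "q = (\<beta>', \<rho>')" "(\<beta>', \<rho>') \<in> composable G" "\<beta>' \<in> A" "\<rho>' \<in> B"
        "\<beta>' \<star>\<^bsub>G\<^esub> \<rho>' = \<gamma>" using q by auto
      have arr: "\<beta>' \<in> arrows G" "\<rho>' \<in> arrows G" "dmap G \<beta>' = rmap G \<rho>'" 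
        using q'(2) by (auto simp: composable_def)
      have r: "rmap G \<beta>' = rmap G \<gamma>" using G.r_comp[OF q'(2)] q'(5) by simp
      interpret T: ring "stalk E (rmap G \<rho>')" by (rule stalk_ring[OF r_in[OF arr(2)]])
      have hom: "act E \<beta>' \<in> ring_hom (stalk E (rmap G \<rho>')) (stalk E (rmap G \<gamma>))"
        using act_ring_hom[OF arr(1)] arr(3) r by simp
      have h0: "act E \<beta>' \<zero>\<^bsub>stalk E (rmap G \<rho>')\<^esub> = \<zero>\<^bsub>stalk E (rmap G \<gamma>)\<^esub>"
        by (rule ring_hom_zero[OF hom T.ring_axioms S.ring_axioms])
      show ?thesis
      proof (cases "\<rho>' = \<rho>")
        case True
        then have "\<beta>' \<noteq> \<beta>" using q(2) q'(1) by simp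
        moreover have "act E \<beta>' b \<in> carrier (stalk E (rmap G \<gamma>))"
          using ring_hom_closed[OF hom] b True by simp
        ultimately show ?thesis using q' True r by (simp add: monomial_def)
      next
        case False
        have "monomial G E A \<beta> a \<beta>' \<in> carrier (stalk E (rmap G \<gamma>))"
          using q'(3) a r by (auto simp: monomial_def)
        then show ?thesis using q' False h0 by (simp add: monomial_def)
      qed
    qed
    show ?thesis
    proof (cases "\<gamma> = \<beta> \<star>\<^bsub>G\<^esub> \<rho>")
      case True
      have r: "rmap G \<gamma> = rmap G \<beta>" using G.r_comp[OF comp] True by simp
      have arr: "\<beta> \<in> arrows G" "dmap G \<beta> = rmap G \<rho>" using comp by (auto simp: composable_def)
      have hb: "act E \<beta> b \<in> carrier (stalk E (rmap G \<gamma>))"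
        using ring_hom_closed[OF act_ring_hom[OF arr(1)]] b arr(2) r by simp
      have v: "?h (\<beta>, \<rho>) = a \<otimes>\<^bsub>stalk E (rmap G \<beta>)\<^esub> act E \<beta> b"
        using A B r by (simp add: monomial_def)
      have c: "?h (\<beta>, \<rho>) \<in> carrier (stalk E (rmap G \<gamma>))"
        unfolding v using a hb r S.m_closed by simp
      have I: "(\<beta>, \<rho>) \<in> ?I" using comp A B True by simp
      have hc: "?h \<in> ?I \<rightarrow> carrier (stalk E (rmap G \<gamma>))"
      proof
        fix q assume "q \<in> ?I"
        then show "?h q \<in> carrier (stalk E (rmap G \<gamma>))" using zero[of q] c by (cases "q = (\<beta>, \<rho>)") auto
      qed
      have "gfinprod ?S ?h {(\<beta>, \<rho>)} = gfinprod ?S ?h ?I"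
        by (rule S.add.gfinprod_mono_neutral_cong_left[OF _ _ _ hc]) (use zero I in auto)
      moreover have "gfinprod ?S ?h {(\<beta>, \<rho>)} = ?h (\<beta>, \<rho>)"
        using S.add.gfinprod_eq_finprod[of "{(\<beta>, \<rho>)}" ?h] S.add.finprod_insert[of "{}" "(\<beta>, \<rho>)" ?h] c by simp
      ultimately show ?thesis using v True by simp
    next
      case False
      then have empty: "{q \<in> ?I. ?h q \<noteq> \<one>\<^bsub>?S\<^esub>} = {}" using zero by fastforce
      have "gfinprod ?S ?h ?I = \<one>\<^bsub>?S\<^esub>"
        unfolding gfinprod_def empty using S.finsum_empty by (simp add: finsum_def)
      then show ?thesis using False by simp
    qed
  qed
  then show ?thesis
    unfolding convolution_def by (subst (3) monomial_def) (rule restrict_ext, simp)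
qed

end

section \<open>Modules\<close>

text \<open>HOL-Algebra only has modules over commutative unital rings. The rings here are neither
  commutative nor unital in general, so the field \<^const>\<open>one\<close> of the coefficient ring is ignored;
  modules use the library's record and its notion of submodule. A simple module over a unital
  ring, in the sense below, is automatically unital: the elements \<open>m - 1m\<close> are annihilated by
  the ring and hence vanish.\<close>

locale nonunital_ring = abelian_group R for R (structure) +
  assumes mult_closed: "\<lbrakk>a \<in> carrier R; b \<in> carrier R\<rbrakk> \<Longrightarrow> a \<otimes> b \<in> carrier R"
    and mult_assoc: "\<lbrakk>a \<in> carrier R; b \<in> carrier R; c \<in> carrier R\<rbrakk> \<Longrightarrow>
      (a \<otimes> b) \<otimes> c = a \<otimes> (b \<otimes> c)"
    and distr_left: "\<lbrakk>a \<in> carrier R; b \<in> carrier R; c \<in> carrier R\<rbrakk> \<Longrightarrow>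
      (a \<oplus> b) \<otimes> c = a \<otimes> c \<oplus> b \<otimes> c"
    and distr_right: "\<lbrakk>a \<in> carrier R; b \<in> carrier R; c \<in> carrier R\<rbrakk> \<Longrightarrow>
      c \<otimes> (a \<oplus> b) = c \<otimes> a \<oplus> c \<otimes> b"

locale left_module = R?: nonunital_ring R + M?: abelian_group M
  for R :: "('r, 'z) ring_scheme" and M :: "('r, 'm, 'y) module_scheme" (structure) +
  assumes smult_closed: "\<lbrakk>a \<in> carrier R; m \<in> carrier M\<rbrakk> \<Longrightarrow> a \<odot> m \<in> carrier M"
    and smult_add_left: "\<lbrakk>a \<in> carrier R; b \<in> carrier R; m \<in> carrier M\<rbrakk> \<Longrightarrow>
      (a \<oplus>\<^bsub>R\<^esub> b) \<odot> m = a \<odot> m \<oplus> b \<odot> m"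
    and smult_add_right: "\<lbrakk>a \<in> carrier R; m \<in> carrier M; n \<in> carrier M\<rbrakk> \<Longrightarrow>
      a \<odot> (m \<oplus> n) = a \<odot> m \<oplus> a \<odot> n"
    and smult_smult: "\<lbrakk>a \<in> carrier R; b \<in> carrier R; m \<in> carrier M\<rbrakk> \<Longrightarrow>
      (a \<otimes>\<^bsub>R\<^esub> b) \<odot> m = a \<odot> (b \<odot> m)"

locale simple_left_module = left_module +
  assumes smult_nonzero: "\<exists>a \<in> carrier R. \<exists>m \<in> carrier M. a \<odot> m \<noteq> \<zero>"
    and submodule_trivial: "submodule N R M \<Longrightarrow> N = {\<zero>} \<or> N = carrier M"

subsection \<open>Tensor products\<close>

text \<open>For a right \<open>B\<close>-module \<open>L\<close> with action \<open>ract\<close> and a left \<open>B\<close>-module \<open>M\<close>, the tensor product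
  over \<open>B\<close> is the free abelian group on \<open>L \<times> M\<close> modulo the biadditivity and balancing relations.\<close>

definition tensor_relations ::
  "('b, 'z) ring_scheme \<Rightarrow> ('l, 'y) ring_scheme \<Rightarrow> ('l \<Rightarrow> 'b \<Rightarrow> 'l) \<Rightarrow> ('b, 'm, 'x) module_scheme \<Rightarrow>
    (('l \<times> 'm) \<Rightarrow>\<^sub>0 int) set" where
  "tensor_relations B L ract M =
     {frag_of (l \<oplus>\<^bsub>L\<^esub> l', m) - frag_of (l, m) - frag_of (l', m) | l l' m.
        l \<in> carrier L \<and> l' \<in> carrier L \<and> m \<in> carrier M} \<union>
     {frag_of (l, m \<oplus>\<^bsub>M\<^esub> m') - frag_of (l, m) - frag_of (l, m') | l m m'.
        l \<in> carrier L \<and> m \<in> carrier M \<and> m' \<in> carrier M} \<union>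
     {frag_of (ract l b, m) - frag_of (l, b \<odot>\<^bsub>M\<^esub> m) | l b m.
        l \<in> carrier L \<and> b \<in> carrier B \<and> m \<in> carrier M}"

definition tensor_kernel ::
  "('b, 'z) ring_scheme \<Rightarrow> ('l, 'y) ring_scheme \<Rightarrow> ('l \<Rightarrow> 'b \<Rightarrow> 'l) \<Rightarrow> ('b, 'm, 'x) module_scheme \<Rightarrow>
    (('l \<times> 'm) \<Rightarrow>\<^sub>0 int) set" where
  "tensor_kernel B L ract M =
     generate (free_Abelian_group (carrier L \<times> carrier M)) (tensor_relations B L ract M)"

definition tensor_group ::
  "('b, 'z) ring_scheme \<Rightarrow> ('l, 'y) ring_scheme \<Rightarrow> ('l \<Rightarrow> 'b \<Rightarrow> 'l) \<Rightarrow> ('b, 'm, 'x) module_scheme \<Rightarrow>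
    (('l \<times> 'm) \<Rightarrow>\<^sub>0 int) set monoid" where
  "tensor_group B L ract M =
     free_Abelian_group (carrier L \<times> carrier M) Mod tensor_kernel B L ract M"

text \<open>When \<open>L\<close> is also a left module over a ring, that ring acts on the tensor product by
  \<open>f \<cdot> (l \<otimes> m) = fl \<otimes> m\<close>. The tensor product's elements are cosets, and the action is additively
  extended to the free abelian group and then applied to all representatives; when \<open>L\<close> is a
  bimodule the union is a single coset. The ring-multiplication fields of the record are unused.\<close>

definition tensor_module ::
  "('b, 'z) ring_scheme \<Rightarrow> ('r, 'l, 'y) module_scheme \<Rightarrow> ('l \<Rightarrow> 'b \<Rightarrow> 'l) \<Rightarrow>
    ('b, 'm, 'x) module_scheme \<Rightarrow> ('r, (('l \<times> 'm) \<Rightarrow>\<^sub>0 int) set) module" where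
  "tensor_module B L ract M =
     \<lparr>carrier = carrier (tensor_group B L ract M),
      monoid.mult = undefined,
      one = undefined,
      ring.zero = \<one>\<^bsub>tensor_group B L ract M\<^esub>,
      ring.add = (\<otimes>\<^bsub>tensor_group B L ract M\<^esub>),
      smult = (\<lambda>f X. \<Union>u\<in>X. tensor_kernel B L ract M
         #>\<^bsub>free_Abelian_group (carrier L \<times> carrier M)\<^esub>
           frag_extend (\<lambda>(l, m). frag_of (f \<odot>\<^bsub>L\<^esub> l, m)) u)\<rparr>"

section \<open>The convolution ring and induced modules\<close>

definition elementary_sections ::
  "('g, 'z) groupoid_scheme \<Rightarrow> ('g, 'e, 'y) ring_sheaf_scheme \<Rightarrow> ('g \<Rightarrow> 'e) set" where
  "elementary_sections G E =
     {f \<in> (\<Pi>\<^sub>E \<gamma>\<in>arrows G. {e \<in> topspace (etale_top E). proj E e = rmap G \<gamma>}).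
        \<exists>U. compact_open_bisection G U \<and>
            continuous_map (subtopology (arrow_top G) U) (etale_top E) f \<and>
            (\<forall>\<gamma> \<in> arrows G - U. f \<gamma> = \<zero>\<^bsub>stalk E (rmap G \<gamma>)\<^esub>)}"

definition section_group ::
  "('g, 'z) groupoid_scheme \<Rightarrow> ('g, 'e, 'y) ring_sheaf_scheme \<Rightarrow> ('g \<Rightarrow> 'e) monoid" where
  "section_group G E =
     subgroup_generated (product_group (arrows G) (\<lambda>\<gamma>. add_monoid (stalk E (rmap G \<gamma>))))
       (elementary_sections G E)"

text \<open>This ring has no unit in general, so the field \<^const>\<open>one\<close> is a dummy.\<close>

definition section_ring ::
  "('g, 'z) groupoid_scheme \<Rightarrow> ('g, 'e, 'y) ring_sheaf_scheme \<Rightarrow> ('g \<Rightarrow> 'e) ring" where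
  "section_ring G E =
     \<lparr>carrier = carrier (section_group G E),
      monoid.mult = convolution G E (arrows G) (arrows G) (arrows G),
      one = undefined,
      ring.zero = \<one>\<^bsub>section_group G E\<^esub>,
      ring.add = (\<otimes>\<^bsub>section_group G E\<^esub>)\<rparr>"

definition skew_group ::
  "('g, 'z) groupoid_scheme \<Rightarrow> ('g, 'e, 'y) ring_sheaf_scheme \<Rightarrow> 'g \<Rightarrow> ('g \<Rightarrow> 'e) monoid" where
  "skew_group G E x = sum_group (isotropy G x) (\<lambda>_. add_monoid (stalk E x))"

definition skew_group_ring ::
  "('g, 'z) groupoid_scheme \<Rightarrow> ('g, 'e, 'y) ring_sheaf_scheme \<Rightarrow> 'g \<Rightarrow> ('g \<Rightarrow> 'e) ring" where
  "skew_group_ring G E x =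
     \<lparr>carrier = carrier (skew_group G E x),
      monoid.mult = convolution G E (isotropy G x) (isotropy G x) (isotropy G x),
      one = monomial G E (isotropy G x) x \<one>\<^bsub>stalk E x\<^esub>,
      ring.zero = \<one>\<^bsub>skew_group G E x\<^esub>,
      ring.add = (\<otimes>\<^bsub>skew_group G E x\<^esub>)\<rparr>"

definition induction_group ::
  "('g, 'z) groupoid_scheme \<Rightarrow> ('g, 'e, 'y) ring_sheaf_scheme \<Rightarrow> 'g \<Rightarrow> ('g \<Rightarrow> 'e) monoid" where
  "induction_group G E x =
     sum_group (source_fibre G x) (\<lambda>\<gamma>. add_monoid (stalk E (rmap G \<gamma>)))"

text \<open>The bimodule \<open>L\<^sub>x\<close>: its left module structure over the section ring, followed by
  its right action of the skew group ring.\<close>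

definition induction_module ::
  "('g, 'z) groupoid_scheme \<Rightarrow> ('g, 'e, 'y) ring_sheaf_scheme \<Rightarrow> 'g \<Rightarrow> ('g \<Rightarrow> 'e, 'g \<Rightarrow> 'e) module"
  where
  "induction_module G E x =
     \<lparr>carrier = carrier (induction_group G E x),
      monoid.mult = undefined,
      one = undefined,
      ring.zero = \<one>\<^bsub>induction_group G E x\<^esub>,
      ring.add = (\<otimes>\<^bsub>induction_group G E x\<^esub>),
      smult = convolution G E (arrows G) (source_fibre G x) (source_fibre G x)\<rparr>"

definition induction_right_action ::
  "('g, 'z) groupoid_scheme \<Rightarrow> ('g, 'e, 'y) ring_sheaf_scheme \<Rightarrow> 'g \<Rightarrow>
    ('g \<Rightarrow> 'e) \<Rightarrow> ('g \<Rightarrow> 'e) \<Rightarrow> 'g \<Rightarrow> 'e" where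
  "induction_right_action G E x =
     convolution G E (source_fibre G x) (isotropy G x) (source_fibre G x)"

definition Ind ::
  "('g, 'z) groupoid_scheme \<Rightarrow> ('g, 'e, 'y) ring_sheaf_scheme \<Rightarrow> 'g \<Rightarrow>
    ('g \<Rightarrow> 'e, 'm, 'x) module_scheme \<Rightarrow>
    ('g \<Rightarrow> 'e, ((('g \<Rightarrow> 'e) \<times> 'm) \<Rightarrow>\<^sub>0 int) set) module" where
  "Ind G E x M =
     tensor_module (skew_group_ring G E x) (induction_module G E x)
       (induction_right_action G E x) M"

end

theory Submission
  imports Defs
begin

text \<open>Choose for each unit \<open>y\<close> in the orbit of \<open>x\<close> an arrow \<open>\<sigma>(y)\<close> from \<open>x\<close> to \<open>y\<close>, and write \<open>a1(\<gamma>)\<close> for the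
  monomials in \<open>L\<^sub>x\<close>. Since the \<open>1(\<sigma>(y))\<close> generate \<open>L\<^sub>x\<close> as a right module over \<open>B\<^sub>x\<close>, every element of the
  induced module is a finite sum of tensors \<open>1(\<sigma>(y)) \<otimes> m\<^sub>y\<close> with distinct \<open>y\<close>. If such a sum is nonzero,
  then so is one of its summands, with index \<open>y\<close>, say. As the unit space is Hausdorff, there is a
  section supported on a compact open bisection that has a prescribed value at a prescribed arrow
  starting in \<open>y\<close> and vanishes on all arrows starting in the other units that occur. Acting with
  these sections on the sum produces all \<open>a1(\<gamma>) \<otimes> m\<^sub>y\<close>. For a submodule \<open>N\<close>, the elements \<open>m\<close> of \<open>M\<close>
  such that \<open>N\<close> contains all \<open>a1(\<gamma>) \<otimes> m\<close> form a submodule of \<open>M\<close>; if \<open>N\<close> is nonzero, this is all of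
  \<open>M\<close>, so \<open>N\<close> is the whole induced module. Uniqueness of the above representation is not needed:
  the induced module is nonzero because restricting \<open>l\<close> to the isotropy group of \<open>x\<close> and acting on
  \<open>m\<close> is a nonzero balanced map to \<open>M\<close>.\<close>


section \<open>Tensor products\<close>

text \<open>Summands are grouped by the range \<open>y\<close> and not by the arrow because left
  multiplication cannot separate two arrows of the source fibre with the same range: both compose
  with exactly the same arrows. Isotropy absorbs the difference. Such an arrow is \<sigma>(y)
  followed on the right by an isotropy arrow, and that factor moves across the tensor sign. Distinct
  ranges can be separated, but only through units, since the arrow space itself may fail to be
  Hausdorff: a section is made to vanish by keeping the sources of its support away from finitely
  many units. Injectivity of \<open>rmap\<close> and \<open>dmap\<close> on a bisection has two
  separate effects on sections. The first bounds their rows and makes convolution a finite sum; the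
  second bounds their columns and keeps the product with a finitely supported element of
  \<open>L\<close> finitely supported. Simplicity of \<open>M\<close> enters twice. Nonvanishing of
  the action of \<open>B\<close> on \<open>M\<close> supplies a nonzero tensor, and triviality of
  submodules turns one good vector of \<open>M\<close> into all of them. That the convolution ring
  acts nontrivially on the induced module comes out of the same section argument that treats
  submodules.\<close>

lemma abelian_group_of_comm_group:
  assumes "comm_group Q" "carrier A = carrier Q" "ring.add A = monoid.mult Q"
    "ring.zero A = monoid.one Q"
  shows "abelian_group A"
proof -
  interpret Q: comm_group Q by (rule assms)
  show ?thesis
    by (rule abelian_groupI) (use assms Q.l_inv_ex in \<open>auto simp: Q.m_ac\<close>)
qed

locale tensor_product = L: abelian_group L + M: abelian_group M
  for B :: "('b, 'z) ring_scheme" and L :: "('r, 'l, 'y) module_scheme"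
    and ract :: "'l \<Rightarrow> 'b \<Rightarrow> 'l" and M :: "('b, 'm, 'x) module_scheme" +
  assumes ract_closed: "\<lbrakk>l \<in> carrier L; b \<in> carrier B\<rbrakk> \<Longrightarrow> ract l b \<in> carrier L"
    and smult_M_closed: "\<lbrakk>b \<in> carrier B; m \<in> carrier M\<rbrakk> \<Longrightarrow> b \<odot>\<^bsub>M\<^esub> m \<in> carrier M"
begin

abbreviation "F \<equiv> free_Abelian_group (carrier L \<times> carrier M)"
abbreviation "K \<equiv> tensor_kernel B L ract M"
abbreviation "T \<equiv> tensor_module B L ract M"

definition tens :: "'l \<Rightarrow> 'm \<Rightarrow> (('l \<times> 'm) \<Rightarrow>\<^sub>0 int) set" where
  "tens l m = K #>\<^bsub>F\<^esub> frag_of (l, m)"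

lemma relations_subset: "tensor_relations B L ract M \<subseteq> carrier F"
proof -
  have "Poly_Mapping.keys (frag_of p - frag_of q - frag_of r) \<subseteq> S"
    if "p \<in> S" "q \<in> S" "r \<in> S" for p q r :: "'l \<times> 'm" and S
    using that by (intro order.trans[OF keys_diff] Un_least) (simp_all add: keys_frag_of)
  moreover have "Poly_Mapping.keys (frag_of p - frag_of q) \<subseteq> S" if "p \<in> S" "q \<in> S" for p q :: "'l \<times> 'm" and S
    using that by (intro order.trans[OF keys_diff] Un_least) (simp_all add: keys_frag_of)
  ultimately show ?thesis
    unfolding tensor_relations_def by (auto simp: ract_closed smult_M_closed simp del: Un_iff)
qed

sublocale F: comm_group F
  by (rule abelian_free_Abelian_group)

lemma kernel_subgroup: "subgroup K F"
  unfolding tensor_kernel_def by (rule F.generate_is_subgroup[OF relations_subset])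

sublocale K: normal K F
  by (rule F.subgroup_imp_normal[OF kernel_subgroup])

lemma diff_in_F: "\<lbrakk>u \<in> carrier F; v \<in> carrier F\<rbrakk> \<Longrightarrow> u - v \<in> carrier F"
  using order.trans[OF keys_diff] by (simp, blast)

lemma add_in_F: "\<lbrakk>u \<in> carrier F; v \<in> carrier F\<rbrakk> \<Longrightarrow> u + v \<in> carrier F"
  using F.m_closed[of u v] by (simp del: carrier_free_Abelian_group_iff)

lemma F_minus: "u \<in> carrier F \<Longrightarrow> inv\<^bsub>F\<^esub> u = - u"
  by simp

lemma coset_eq_iff:
  assumes "u \<in> carrier F" "v \<in> carrier F"
  shows "K #>\<^bsub>F\<^esub> u = K #>\<^bsub>F\<^esub> v \<longleftrightarrow> u - v \<in> K"
proof -
  have "K #>\<^bsub>F\<^esub> u = K #>\<^bsub>F\<^esub> v \<longleftrightarrow> u \<in> K #>\<^bsub>F\<^esub> v"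
    using F.repr_independence[OF _ assms(2) kernel_subgroup] F.rcos_self[OF assms(1) kernel_subgroup]
    by blast
  also have "\<dots> \<longleftrightarrow> u - v \<in> K"
    using K.rcos_module[OF F.group_axioms assms(2,1)] F_minus[OF assms(2)] by simp
  finally show ?thesis .
qed

lemma carrier_T: "carrier T = (\<lambda>u. K #>\<^bsub>F\<^esub> u) ` carrier F"
  unfolding tensor_module_def tensor_group_def by (simp add: carrier_FactGroup)

lemma coset_in_T: "u \<in> carrier F \<Longrightarrow> K #>\<^bsub>F\<^esub> u \<in> carrier T"
  by (simp add: carrier_T del: carrier_free_Abelian_group_iff)

lemma zero_T: "\<zero>\<^bsub>T\<^esub> = K"
  unfolding tensor_module_def tensor_group_def by simp

lemma add_T:
  assumes "u \<in> carrier F" "v \<in> carrier F"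
  shows "(K #>\<^bsub>F\<^esub> u) \<oplus>\<^bsub>T\<^esub> (K #>\<^bsub>F\<^esub> v) = K #>\<^bsub>F\<^esub> (u + v)"
  using K.rcos_sum[OF assms] by (simp add: tensor_module_def tensor_group_def)

sublocale T: abelian_group T
  by (rule abelian_group_of_comm_group[OF F.abelian_FactGroup[OF kernel_subgroup]])
    (simp_all add: tensor_module_def tensor_group_def)

lemma minus_T:
  assumes "u \<in> carrier F" "v \<in> carrier F"
  shows "(K #>\<^bsub>F\<^esub> u) \<ominus>\<^bsub>T\<^esub> (K #>\<^bsub>F\<^esub> v) = K #>\<^bsub>F\<^esub> (u - v)"
proof -
  have "(K #>\<^bsub>F\<^esub> (u - v)) \<oplus>\<^bsub>T\<^esub> (K #>\<^bsub>F\<^esub> v) = K #>\<^bsub>F\<^esub> u"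
    using add_T[OF diff_in_F[OF assms] assms(2)] by simp
  then show ?thesis
    using coset_in_T assms diff_in_F[OF assms]
    by (metis T.add.inv_solve_right a_minus_def)
qed

lemma tens_closed: "\<lbrakk>l \<in> carrier L; m \<in> carrier M\<rbrakk> \<Longrightarrow> tens l m \<in> carrier T"
  unfolding tens_def by (rule coset_in_T) simp

lemma frag_of_in_F: "\<lbrakk>l \<in> carrier L; m \<in> carrier M\<rbrakk> \<Longrightarrow> frag_of (l, m) \<in> carrier F"
  by simp

lemma relation_coset:
  assumes "u \<in> carrier F" "v \<in> carrier F" "u - v \<in> tensor_relations B L ract M"
  shows "K #>\<^bsub>F\<^esub> u = K #>\<^bsub>F\<^esub> v"
  using coset_eq_iff[OF assms(1,2)] assms(3) unfolding tensor_kernel_def by (blast intro: generate.incl)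

lemma tens_add_left:
  assumes "l \<in> carrier L" "l' \<in> carrier L" "m \<in> carrier M"
  shows "tens (l \<oplus>\<^bsub>L\<^esub> l') m = tens l m \<oplus>\<^bsub>T\<^esub> tens l' m"
proof -
  have "frag_of (l \<oplus>\<^bsub>L\<^esub> l', m) - frag_of (l, m) - frag_of (l', m) \<in> tensor_relations B L ract M"
    using assms unfolding tensor_relations_def by blast
  then show ?thesis
    unfolding tens_def using assms
    by (subst add_T; (intro frag_of_in_F relation_coset add_in_F)?) (simp_all add: algebra_simps)
qed

lemma tens_add_right:
  assumes "l \<in> carrier L" "m \<in> carrier M" "m' \<in> carrier M"
  shows "tens l (m \<oplus>\<^bsub>M\<^esub> m') = tens l m \<oplus>\<^bsub>T\<^esub> tens l m'"
proof -
  have "frag_of (l, m \<oplus>\<^bsub>M\<^esub> m') - frag_of (l, m) - frag_of (l, m') \<in> tensor_relations B L ract M"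
    using assms unfolding tensor_relations_def by blast
  then show ?thesis
    unfolding tens_def using assms
    by (subst add_T; (intro frag_of_in_F relation_coset add_in_F)?) (simp_all add: algebra_simps)
qed

lemma tens_balanced:
  assumes "l \<in> carrier L" "b \<in> carrier B" "m \<in> carrier M"
  shows "tens (ract l b) m = tens l (b \<odot>\<^bsub>M\<^esub> m)"
proof -
  have "frag_of (ract l b, m) - frag_of (l, b \<odot>\<^bsub>M\<^esub> m) \<in> tensor_relations B L ract M"
    using assms unfolding tensor_relations_def by blast
  then show ?thesis
    unfolding tens_def using assms
    by (intro relation_coset frag_of_in_F ract_closed smult_M_closed)
qed

lemma tens_zero_left: "m \<in> carrier M \<Longrightarrow> tens \<zero>\<^bsub>L\<^esub> m = \<zero>\<^bsub>T\<^esub>"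
  by (metis L.r_zero L.zero_closed T.add.l_cancel_one' tens_add_left tens_closed)

lemma tens_zero_right: "l \<in> carrier L \<Longrightarrow> tens l \<zero>\<^bsub>M\<^esub> = \<zero>\<^bsub>T\<^esub>"
  by (metis M.r_zero M.zero_closed T.add.l_cancel_one' tens_add_right tens_closed)

lemma tens_minus_left:
  assumes "l \<in> carrier L" "m \<in> carrier M"
  shows "tens (\<ominus>\<^bsub>L\<^esub> l) m = \<ominus>\<^bsub>T\<^esub> tens l m"
  by (metis L.a_inv_closed L.l_neg T.minus_equality assms tens_add_left tens_closed tens_zero_left)

lemma tens_minus_right:
  assumes "l \<in> carrier L" "m \<in> carrier M"
  shows "tens l (\<ominus>\<^bsub>M\<^esub> m) = \<ominus>\<^bsub>T\<^esub> tens l m"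
  by (metis M.a_inv_closed M.l_neg T.minus_equality assms tens_add_right tens_closed tens_zero_right)

text \<open>No rule for negatives is needed, because the negative of a pure tensor is again a pure
  tensor, with the left factor negated.\<close>

lemma T_induct [consumes 1, case_names zero tens add]:
  assumes X: "X \<in> carrier T"
    and zero_P: "P \<zero>\<^bsub>T\<^esub>"
    and tens_P: "\<And>l m. \<lbrakk>l \<in> carrier L; m \<in> carrier M\<rbrakk> \<Longrightarrow> P (tens l m)"
    and add_P: "\<And>X Y. \<lbrakk>X \<in> carrier T; Y \<in> carrier T; P X; P Y\<rbrakk> \<Longrightarrow> P (X \<oplus>\<^bsub>T\<^esub> Y)"
  shows "P X"
proof -
  obtain u where u: "u \<in> carrier F" "X = K #>\<^bsub>F\<^esub> u"
    using X carrier_T by auto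
  \<comment> \<open>The induction on the free abelian group has a case for differences, so the claim
    carries the negative along.\<close>
  have "P (K #>\<^bsub>F\<^esub> u) \<and> P (\<ominus>\<^bsub>T\<^esub> (K #>\<^bsub>F\<^esub> u))"
    using u(1) unfolding carrier_free_Abelian_group_iff
  proof (induction u rule: free_Abelian_group_induct[consumes 1, case_names zero diff of])
    case zero
    have "K #>\<^bsub>F\<^esub> 0 = \<zero>\<^bsub>T\<^esub>"
      using K.rcos_const[OF F.group_axioms K.one_closed] by (simp add: zero_T)
    moreover have "\<ominus>\<^bsub>T\<^esub> \<zero>\<^bsub>T\<^esub> = \<zero>\<^bsub>T\<^esub>"
      by (simp add: T.r_neg[symmetric] T.minus_equality)
    ultimately show ?case using zero_P by metis
  next
    case (diff u v)
    have uv: "u \<in> carrier F" "v \<in> carrier F" using diff by simp_all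
    let ?u = "K #>\<^bsub>F\<^esub> u" and ?v = "K #>\<^bsub>F\<^esub> v"
    have c: "?u \<in> carrier T" "?v \<in> carrier T" using uv coset_in_T by blast+
    have "K #>\<^bsub>F\<^esub> (u - v) = ?u \<oplus>\<^bsub>T\<^esub> (\<ominus>\<^bsub>T\<^esub> ?v)"
      using minus_T[OF uv] by (simp add: a_minus_def)
    moreover have "\<ominus>\<^bsub>T\<^esub> (?u \<oplus>\<^bsub>T\<^esub> (\<ominus>\<^bsub>T\<^esub> ?v)) = (\<ominus>\<^bsub>T\<^esub> ?u) \<oplus>\<^bsub>T\<^esub> ?v"
      using c T.minus_add by simp
    ultimately show ?case using diff add_P c by (metis T.a_inv_closed)
  next
    case (of a)
    then obtain l m where lm: "a = (l, m)" "l \<in> carrier L" "m \<in> carrier M" by blast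
    then show ?case
      using tens_P[OF lm(2,3)] tens_P[OF L.a_inv_closed[OF lm(2)] lm(3)] tens_minus_left[OF lm(2,3)]
      by (simp add: tens_def)
  qed
  then show ?thesis using u by simp
qed

text \<open>The universal property, used to detect nonzero tensors: a biadditive balanced map
  extends to a homomorphism on the free abelian group that kills all relations, hence all of
  \<open>K\<close>. If the pure tensor vanished, its generator would lie in
  \<open>K\<close>.\<close>

lemma tens_nonzero:
  assumes \<phi>: "\<And>l m. \<lbrakk>l \<in> carrier L; m \<in> carrier M\<rbrakk> \<Longrightarrow> \<phi> l m \<in> carrier A" and A: "abelian_group A"
    and addl: "\<And>l l' m. \<lbrakk>l \<in> carrier L; l' \<in> carrier L; m \<in> carrier M\<rbrakk> \<Longrightarrow>
      \<phi> (l \<oplus>\<^bsub>L\<^esub> l') m = \<phi> l m \<oplus>\<^bsub>A\<^esub> \<phi> l' m"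
    and addr: "\<And>l m m'. \<lbrakk>l \<in> carrier L; m \<in> carrier M; m' \<in> carrier M\<rbrakk> \<Longrightarrow>
      \<phi> l (m \<oplus>\<^bsub>M\<^esub> m') = \<phi> l m \<oplus>\<^bsub>A\<^esub> \<phi> l m'"
    and bal: "\<And>l b m. \<lbrakk>l \<in> carrier L; b \<in> carrier B; m \<in> carrier M\<rbrakk> \<Longrightarrow>
      \<phi> (ract l b) m = \<phi> l (b \<odot>\<^bsub>M\<^esub> m)"
    and lm: "l \<in> carrier L" "m \<in> carrier M" and nz: "\<phi> l m \<noteq> \<zero>\<^bsub>A\<^esub>"
  shows "tens l m \<noteq> \<zero>\<^bsub>T\<^esub>"
proof
  interpret A: abelian_group A by (rule A)
  have "(\<lambda>(l, m). \<phi> l m) ` (carrier L \<times> carrier M) \<subseteq> carrier (add_monoid A)"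
    using \<phi> by auto
  then obtain h where h: "h \<in> hom F (add_monoid A)"
    and hf: "\<And>q. q \<in> carrier L \<times> carrier M \<Longrightarrow> h (frag_of q) = (\<lambda>(l, m). \<phi> l m) q"
    using A.a_comm_group comm_group.free_Abelian_group_universal by blast
  interpret h: group_hom F "add_monoid A" h
    by (intro group_hom.intro group_hom_axioms.intro F.group_axioms A.add.group_axioms h)
  have h_diff: "h (u - v) = h u \<ominus>\<^bsub>A\<^esub> h v" if "u \<in> carrier F" "v \<in> carrier F" for u v
  proof -
    have "h (u - v) \<oplus>\<^bsub>A\<^esub> h v = h u"
      using h.hom_mult[OF diff_in_F[OF that] that(2)] by simp
    then show ?thesis
      using h.hom_closed[OF that(1)] h.hom_closed[OF that(2)] h.hom_closed[OF diff_in_F[OF that]]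
      by (metis A.add.inv_solve_right a_minus_def partial_object.select_convs(1))
  qed
  have "h u = \<zero>\<^bsub>A\<^esub>" if "u \<in> tensor_relations B L ract M" for u
  proof -
    have fF: "frag_of (l, m) \<in> carrier F" if "l \<in> carrier L" "m \<in> carrier M" for l m
      using that by (rule frag_of_in_F)
    have hf': "h (frag_of (l, m)) = \<phi> l m" if "l \<in> carrier L" "m \<in> carrier M" for l m
      using that by (simp add: hf)
    \<comment> \<open>The shapes that the relations take under \<open>h\<close>: the first for the
      two biadditivity relations, the second for balancing.\<close>
    have z: "a \<oplus>\<^bsub>A\<^esub> b \<ominus>\<^bsub>A\<^esub> a \<ominus>\<^bsub>A\<^esub> b = \<zero>\<^bsub>A\<^esub>" "b \<ominus>\<^bsub>A\<^esub> b = \<zero>\<^bsub>A\<^esub>" if "a \<in> carrier A" "b \<in> carrier A" for a b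
    proof -
      show "b \<ominus>\<^bsub>A\<^esub> b = \<zero>\<^bsub>A\<^esub>" using that by (simp add: a_minus_def A.r_neg)
      have "a \<oplus>\<^bsub>A\<^esub> b \<ominus>\<^bsub>A\<^esub> a = b" using that A.r_neg1[of a b] by (simp add: a_minus_def A.a_ac)
      then show "a \<oplus>\<^bsub>A\<^esub> b \<ominus>\<^bsub>A\<^esub> a \<ominus>\<^bsub>A\<^esub> b = \<zero>\<^bsub>A\<^esub>" using that by (simp add: a_minus_def A.r_neg)
    qed
    show ?thesis
      using that unfolding tensor_relations_def
      by (elim UnE CollectE exE conjE)
        (simp_all add: h_diff diff_in_F fF hf' addl addr bal z z(2)[OF \<phi> \<phi>] \<phi> ract_closed smult_M_closed
          del: carrier_free_Abelian_group_iff frag_of_in_free_Abelian_group)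
  qed
  then have "tensor_relations B L ract M \<subseteq> kernel F (add_monoid A) h"
    using relations_subset by (auto simp: kernel_def simp del: carrier_free_Abelian_group_iff)
  then have "K \<subseteq> kernel F (add_monoid A) h"
    unfolding tensor_kernel_def by (rule F.generate_subgroup_incl[OF _ h.subgroup_kernel])
  moreover assume "tens l m = \<zero>\<^bsub>T\<^esub>"
  then have "frag_of (l, m) \<in> K"
    using F.rcos_self[OF frag_of_in_F[OF lm] kernel_subgroup] by (simp add: tens_def zero_T)
  ultimately show False
    using hf[of "(l, m)"] lm nz by (auto simp: kernel_def)
qed

end

section \<open>Left action on the tensor product of a bimodule with a module\<close>

locale bimodule_tensor_product =
  tensor_product B L ract M + L: left_module R L
  for R :: "('r, 'w) ring_scheme" and B :: "('b, 'z) ring_scheme"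
    and L :: "('r, 'l, 'y) module_scheme" and ract :: "'l \<Rightarrow> 'b \<Rightarrow> 'l"
    and M :: "('b, 'm, 'x) module_scheme" +
  assumes ract_smult: "\<lbrakk>f \<in> carrier R; l \<in> carrier L; b \<in> carrier B\<rbrakk> \<Longrightarrow>
      f \<odot>\<^bsub>L\<^esub> ract l b = ract (f \<odot>\<^bsub>L\<^esub> l) b"
begin

abbreviation lift_act :: "'r \<Rightarrow> (('l \<times> 'm) \<Rightarrow>\<^sub>0 int) \<Rightarrow> (('l \<times> 'm) \<Rightarrow>\<^sub>0 int)" where
  "lift_act f \<equiv> frag_extend (\<lambda>(l, m). frag_of (f \<odot>\<^bsub>L\<^esub> l, m))"

lemma lift_act_closed:
  assumes f: "f \<in> carrier R" and u: "u \<in> carrier F"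
  shows "lift_act f u \<in> carrier F"
  using u unfolding carrier_free_Abelian_group_iff
proof (induction u rule: free_Abelian_group_induct[consumes 1, case_names zero diff of])
  case (diff u v)
  then show ?case using diff_in_F by (simp add: frag_extend_diff)
next
  case (of a)
  then show ?case using L.smult_closed[OF f] by (auto simp: keys_frag_of)
qed simp

text \<open>Each kind of relation goes to one of the same kind: left biadditivity by additivity of
  the left action, right biadditivity because the right factor is untouched, and balancing because
  the two actions on \<open>L\<close> commute.\<close>

lemma lift_act_relation:
  assumes f: "f \<in> carrier R" and u: "u \<in> tensor_relations B L ract M"
  shows "lift_act f u \<in> tensor_relations B L ract M"
proof -
  consider (left) l l' m where "u = frag_of (l \<oplus>\<^bsub>L\<^esub> l', m) - frag_of (l, m) - frag_of (l', m)"
      "l \<in> carrier L" "l' \<in> carrier L" "m \<in> carrier M"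
    | (right) l m m' where "u = frag_of (l, m \<oplus>\<^bsub>M\<^esub> m') - frag_of (l, m) - frag_of (l, m')"
      "l \<in> carrier L" "m \<in> carrier M" "m' \<in> carrier M"
    | (balanced) l b m where "u = frag_of (ract l b, m) - frag_of (l, b \<odot>\<^bsub>M\<^esub> m)"
      "l \<in> carrier L" "b \<in> carrier B" "m \<in> carrier M"
    using u unfolding tensor_relations_def by blast
  then show ?thesis
  proof cases
    case (left l l' m)
    from left have "lift_act f u = frag_of (f \<odot>\<^bsub>L\<^esub> l \<oplus>\<^bsub>L\<^esub> f \<odot>\<^bsub>L\<^esub> l', m) - frag_of (f \<odot>\<^bsub>L\<^esub> l, m) - frag_of (f \<odot>\<^bsub>L\<^esub> l', m)"
      by (simp add: frag_extend_diff L.smult_add_right[OF f])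
    then show ?thesis
      using left L.smult_closed[OF f] unfolding tensor_relations_def by blast
  next
    case (right l m m')
    from right have "lift_act f u = frag_of (f \<odot>\<^bsub>L\<^esub> l, m \<oplus>\<^bsub>M\<^esub> m') - frag_of (f \<odot>\<^bsub>L\<^esub> l, m) - frag_of (f \<odot>\<^bsub>L\<^esub> l, m')"
      by (simp add: frag_extend_diff)
    then show ?thesis
      using right L.smult_closed[OF f] unfolding tensor_relations_def by blast
  next
    case (balanced l b m)
    from balanced have "lift_act f u = frag_of (ract (f \<odot>\<^bsub>L\<^esub> l) b, m) - frag_of (f \<odot>\<^bsub>L\<^esub> l, b \<odot>\<^bsub>M\<^esub> m)"
      by (simp add: frag_extend_diff ract_smult[OF f])
    then show ?thesis
      using balanced L.smult_closed[OF f] unfolding tensor_relations_def by blast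
  qed
qed

lemma lift_act_kernel:
  assumes f: "f \<in> carrier R" and u: "u \<in> K"
  shows "lift_act f u \<in> K"
  using u unfolding tensor_kernel_def
proof (induction u rule: generate.induct)
  case one
  then show ?case using generate.one by (metis frag_extend_0 one_free_Abelian_group)
next
  case (incl h)
  then show ?case using lift_act_relation[OF f] by (blast intro: generate.incl)
next
  case (inv h)
  have h: "h \<in> carrier F" "lift_act f h \<in> carrier F"
    using inv relations_subset lift_act_closed[OF f] by blast+
  have "lift_act f (inv\<^bsub>F\<^esub> h) = inv\<^bsub>F\<^esub> (lift_act f h)"
    using F_minus[OF h(1)] F_minus[OF h(2)] by (simp add: frag_extend_minus)
  then show ?case using lift_act_relation[OF f inv] by (metis generate.inv)
next
  case (eng h1 h2)
  then show ?case using generate.eng by (metis frag_extend_add mult_free_Abelian_group)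
qed

text \<open>Representatives of a coset differ by an element of \<open>K\<close>, which
  \<open>lift_act f\<close> maps into \<open>K\<close>. So the union in the definition of the action
  consists of equal cosets, and it is not empty because \<open>u\<close> is itself a
  representative.\<close>

lemma smult_coset:
  assumes f: "f \<in> carrier R" and u: "u \<in> carrier F"
  shows "f \<odot>\<^bsub>T\<^esub> (K #>\<^bsub>F\<^esub> u) = K #>\<^bsub>F\<^esub> lift_act f u"
proof -
  have "K #>\<^bsub>F\<^esub> lift_act f v = K #>\<^bsub>F\<^esub> lift_act f u" if v: "v \<in> K #>\<^bsub>F\<^esub> u" for v
  proof -
    have vF: "v \<in> carrier F" using K.elemrcos_carrier[OF F.group_axioms u v] .
    have "v - u \<in> K"
      using K.rcos_module_imp[OF F.group_axioms u v] F_minus[OF u] by simp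
    then have "lift_act f v - lift_act f u \<in> K"
      using lift_act_kernel[OF f] by (simp flip: frag_extend_diff)
    then show ?thesis
      using coset_eq_iff lift_act_closed[OF f] vF u by blast
  qed
  moreover have "u \<in> K #>\<^bsub>F\<^esub> u" by (rule F.rcos_self[OF u kernel_subgroup])
  ultimately have "(\<Union>v\<in>K #>\<^bsub>F\<^esub> u. K #>\<^bsub>F\<^esub> lift_act f v) = K #>\<^bsub>F\<^esub> lift_act f u"
    by blast
  then show ?thesis by (simp only: tensor_module_def module.select_convs)
qed

lemma smult_T_closed: "\<lbrakk>f \<in> carrier R; X \<in> carrier T\<rbrakk> \<Longrightarrow> f \<odot>\<^bsub>T\<^esub> X \<in> carrier T"
  using smult_coset lift_act_closed coset_in_T carrier_T by force

lemma smult_tens: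
  "\<lbrakk>f \<in> carrier R; l \<in> carrier L; m \<in> carrier M\<rbrakk> \<Longrightarrow> f \<odot>\<^bsub>T\<^esub> tens l m = tens (f \<odot>\<^bsub>L\<^esub> l) m"
  unfolding tens_def by (subst smult_coset) simp_all

lemma smult_T_add:
  assumes "f \<in> carrier R" "X \<in> carrier T" "Y \<in> carrier T"
  shows "f \<odot>\<^bsub>T\<^esub> (X \<oplus>\<^bsub>T\<^esub> Y) = f \<odot>\<^bsub>T\<^esub> X \<oplus>\<^bsub>T\<^esub> f \<odot>\<^bsub>T\<^esub> Y"
proof -
  obtain u v where uv: "u \<in> carrier F" "v \<in> carrier F" "X = K #>\<^bsub>F\<^esub> u" "Y = K #>\<^bsub>F\<^esub> v"
    using assms carrier_T by auto
  then show ?thesis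
    using assms(1) add_in_F[OF uv(1,2)]
    by (simp add: add_T smult_coset lift_act_closed frag_extend_add
        del: carrier_free_Abelian_group_iff)
qed

lemma smult_T_zero: "f \<in> carrier R \<Longrightarrow> f \<odot>\<^bsub>T\<^esub> \<zero>\<^bsub>T\<^esub> = \<zero>\<^bsub>T\<^esub>"
  by (metis T.add.l_cancel_one' T.l_zero T.zero_closed smult_T_add smult_T_closed)

text \<open>Both sides of the two laws proved by induction are additive in \<open>X\<close>, so only
  pure tensors remain, where each law is inherited from \<open>L\<close>.\<close>

sublocale T: left_module R T
proof (intro left_module.intro left_module_axioms.intro L.R.nonunital_ring_axioms T.abelian_group_axioms)
  fix f g X assume *: "f \<in> carrier R" "g \<in> carrier R" "X \<in> carrier T"
  show "(f \<oplus>\<^bsub>R\<^esub> g) \<odot>\<^bsub>T\<^esub> X = f \<odot>\<^bsub>T\<^esub> X \<oplus>\<^bsub>T\<^esub> g \<odot>\<^bsub>T\<^esub> X"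
    using *(3)
  proof (induction X rule: T_induct)
    case (add X Y)
    then show ?case
      using *(1,2) by (simp add: smult_T_add smult_T_closed T.a_ac)
  qed (use * in \<open>simp_all add: smult_T_zero smult_tens L.smult_add_left tens_add_left L.smult_closed\<close>)
  show "(f \<otimes>\<^bsub>R\<^esub> g) \<odot>\<^bsub>T\<^esub> X = f \<odot>\<^bsub>T\<^esub> (g \<odot>\<^bsub>T\<^esub> X)"
    using *(3)
  proof (induction X rule: T_induct)
    case (add X Y)
    then show ?case
      using *(1,2) by (simp add: smult_T_add smult_T_closed L.R.mult_closed)
  qed (use * in \<open>simp_all add: smult_T_zero smult_tens L.smult_smult L.smult_closed L.R.mult_closed\<close>)
qed (rule smult_T_closed smult_T_add; assumption)+

end

lemma (in abelian_monoid) finsum_swap: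
  assumes "finite A" "finite B" "\<And>i j. \<lbrakk>i \<in> A; j \<in> B\<rbrakk> \<Longrightarrow> f i j \<in> carrier G"
  shows "(\<Oplus>i\<in>A. \<Oplus>j\<in>B. f i j) = (\<Oplus>j\<in>B. \<Oplus>i\<in>A. f i j)"
  using assms(1,3)
proof (induction A rule: finite_induct)
  case empty
  then show ?case by (simp add: finsum_zero)
next
  case (insert a A)
  have "(\<Oplus>j\<in>B. \<Oplus>i\<in>insert a A. f i j) = (\<Oplus>j\<in>B. f a j \<oplus> (\<Oplus>i\<in>A. f i j))"
    using insert by (intro finsum_cong refl) (auto intro!: finsum_insert finsum_closed)
  also have "\<dots> = (\<Oplus>j\<in>B. f a j) \<oplus> (\<Oplus>j\<in>B. \<Oplus>i\<in>A. f i j)"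
    using insert by (intro finsum_addf) (auto intro!: finsum_closed)
  finally show ?case
    using insert assms(2) by (simp add: finsum_insert Pi_def)
qed

lemma ring_hom_finsum:
  assumes h: "h \<in> ring_hom R S" and R: "ring R" and S: "ring S"
    and f: "f \<in> A \<rightarrow> carrier R"
  shows "h (finsum R f A) = finsum S (\<lambda>i. h (f i)) A"
proof -
  interpret R: ring R by (rule R)
  interpret S: ring S by (rule S)
  show ?thesis
    using f
  proof (induction A rule: infinite_finite_induct)
    case (insert a A)
    then show ?case
      using ring_hom_closed[OF h]
      by (simp add: ring_hom_add[OF h] Pi_def)
  qed (simp_all add: R.finsum_infinite S.finsum_infinite ring_hom_zero[OF h R S])
qed

section \<open>Groupoids\<close>

context groupoid
begin

lemma composable_iff: "(\<beta>, \<gamma>) \<in> composable G \<longleftrightarrow>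
    \<beta> \<in> arrows G \<and> \<gamma> \<in> arrows G \<and> dmap G \<beta> = rmap G \<gamma>"
  by (simp add: composable_def)

lemma comp_in_arrows [simp]:
  "\<lbrakk>\<beta> \<in> arrows G; \<gamma> \<in> arrows G; dmap G \<beta> = rmap G \<gamma>\<rbrakk> \<Longrightarrow> \<beta> \<star> \<gamma> \<in> arrows G"
  using comp_closed by (simp add: composable_iff)

lemma dmap_comp [simp]:
  "\<lbrakk>\<beta> \<in> arrows G; \<gamma> \<in> arrows G; dmap G \<beta> = rmap G \<gamma>\<rbrakk> \<Longrightarrow> dmap G (\<beta> \<star> \<gamma>) = dmap G \<gamma>"
  using d_comp by (simp add: composable_iff)

lemma rmap_comp [simp]:
  "\<lbrakk>\<beta> \<in> arrows G; \<gamma> \<in> arrows G; dmap G \<beta> = rmap G \<gamma>\<rbrakk> \<Longrightarrow> rmap G (\<beta> \<star> \<gamma>) = rmap G \<beta>"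
  using r_comp by (simp add: composable_iff)

lemma comp_comp:
  "\<lbrakk>\<alpha> \<in> arrows G; \<beta> \<in> arrows G; \<gamma> \<in> arrows G; dmap G \<alpha> = rmap G \<beta>; dmap G \<beta> = rmap G \<gamma>\<rbrakk> \<Longrightarrow>
    (\<alpha> \<star> \<beta>) \<star> \<gamma> = \<alpha> \<star> (\<beta> \<star> \<gamma>)"
  using comp_assoc by (simp add: composable_iff)

lemmas inv_in_arrows [simp] = inv_closed
  and dmap_inv [simp] = d_inv
  and rmap_inv [simp] = r_inv

lemma inv_comp: "ginv G \<gamma> \<star> \<gamma> = dmap G \<gamma>"
  by (simp add: dmap_def)

lemma comp_inv: "\<gamma> \<star> ginv G \<gamma> = rmap G \<gamma>"
  by (simp add: rmap_def)

lemma dmap_in_units [simp]: "\<gamma> \<in> arrows G \<Longrightarrow> dmap G \<gamma> \<in> units G"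
  by (simp add: units_def)

lemma rmap_in_units [simp]: "\<gamma> \<in> arrows G \<Longrightarrow> rmap G \<gamma> \<in> units G"
  using dmap_in_units[of "ginv G \<gamma>"] by simp

lemma dmap_in_arrows [simp]: "\<gamma> \<in> arrows G \<Longrightarrow> dmap G \<gamma> \<in> arrows G"
  using comp_in_arrows[of "ginv G \<gamma>" \<gamma>] by (simp add: inv_comp)

lemma unit_in_arrows: "u \<in> units G \<Longrightarrow> u \<in> arrows G"
  by (auto simp: units_def)

lemma dmap_dmap: "\<gamma> \<in> arrows G \<Longrightarrow> dmap G (dmap G \<gamma>) = dmap G \<gamma>"
  using dmap_comp[of "ginv G \<gamma>" \<gamma>] by (simp add: inv_comp)

lemma rmap_dmap: "\<gamma> \<in> arrows G \<Longrightarrow> rmap G (dmap G \<gamma>) = dmap G \<gamma>"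
  using rmap_comp[of "ginv G \<gamma>" \<gamma>] by (simp add: inv_comp)

lemma dmap_unit [simp]: "u \<in> units G \<Longrightarrow> dmap G u = u"
  unfolding units_def using dmap_dmap by blast

lemma rmap_unit [simp]: "u \<in> units G \<Longrightarrow> rmap G u = u"
  unfolding units_def using rmap_dmap by blast

lemma unit_comp [simp]: "\<gamma> \<in> arrows G \<Longrightarrow> rmap G \<gamma> = u \<Longrightarrow> u \<star> \<gamma> = \<gamma>"
  using r_unit by blast

lemma comp_unit [simp]: "\<gamma> \<in> arrows G \<Longrightarrow> dmap G \<gamma> = u \<Longrightarrow> \<gamma> \<star> u = \<gamma>"
  using d_unit by blast

lemma inv_comp_comp [simp]:
  assumes "\<beta> \<in> arrows G" "\<gamma> \<in> arrows G" "dmap G \<beta> = rmap G \<gamma>"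
  shows "ginv G \<beta> \<star> (\<beta> \<star> \<gamma>) = \<gamma>"
  using comp_comp[of "ginv G \<beta>" \<beta> \<gamma>] assms by (simp add: inv_comp)

lemma comp_inv_comp [simp]:
  assumes "\<beta> \<in> arrows G" "\<gamma> \<in> arrows G" "rmap G \<beta> = rmap G \<gamma>"
  shows "\<beta> \<star> (ginv G \<beta> \<star> \<gamma>) = \<gamma>"
  using comp_comp[of \<beta> "ginv G \<beta>" \<gamma>] assms by (simp add: comp_inv)

lemma comp_comp_inv [simp]:
  assumes "\<beta> \<in> arrows G" "\<gamma> \<in> arrows G" "dmap G \<beta> = rmap G \<gamma>"
  shows "(\<beta> \<star> \<gamma>) \<star> ginv G \<gamma> = \<beta>"
  using comp_comp[of \<beta> \<gamma> "ginv G \<gamma>"] assms by (simp add: comp_inv)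

lemma comp_inv_comp_right [simp]:
  assumes "\<beta> \<in> arrows G" "\<gamma> \<in> arrows G" "dmap G \<beta> = dmap G \<gamma>"
  shows "(\<beta> \<star> ginv G \<gamma>) \<star> \<gamma> = \<beta>"
  using comp_comp[of \<beta> "ginv G \<gamma>" \<gamma>] assms by (simp add: inv_comp)

lemma inv_inv [simp]:
  assumes "\<gamma> \<in> arrows G"
  shows "ginv G (ginv G \<gamma>) = \<gamma>"
proof -
  have "ginv G (ginv G \<gamma>) = ginv G (ginv G \<gamma>) \<star> (ginv G \<gamma> \<star> \<gamma>)"
    using assms by (simp add: inv_comp)
  also have "\<dots> = \<gamma>" using assms by (intro inv_comp_comp) simp_all
  finally show ?thesis .
qed

text \<open>The cancellation behind the substitution \<rho> = \<beta>^(-1) \<mu> in the proof of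
  associativity of convolution.\<close>

lemma inv_comp_inv_comp:
  assumes "\<beta> \<in> arrows G" "\<mu> \<in> arrows G" "\<gamma> \<in> arrows G" "rmap G \<beta> = rmap G \<gamma>" "rmap G \<mu> = rmap G \<gamma>"
  shows "ginv G (ginv G \<beta> \<star> \<mu>) \<star> (ginv G \<beta> \<star> \<gamma>) = ginv G \<mu> \<star> \<gamma>"
proof -
  let ?\<rho> = "ginv G \<beta> \<star> \<mu>"
  have "ginv G \<beta> \<star> \<gamma> = ginv G \<beta> \<star> (\<mu> \<star> (ginv G \<mu> \<star> \<gamma>))"
    using assms by simp
  also have "\<dots> = ?\<rho> \<star> (ginv G \<mu> \<star> \<gamma>)" using assms by (simp add: comp_comp)
  finally show ?thesis using assms by simp
qed

end

section \<open>The ring of row-finite sections\<close>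

locale sheaf_of_rings_over_groupoid = groupoid G + sheaf_of_rings G E
  for G :: "('g, 'z) groupoid_scheme" (structure) and E :: "('g, 'e, 'y) ring_sheaf_scheme"
begin

abbreviation fibre :: "'g \<Rightarrow> 'e ring" where
  "fibre \<gamma> \<equiv> stalk E (rmap G \<gamma>)"

definition sections_on :: "'g set \<Rightarrow> ('g \<Rightarrow> 'e) set" where
  "sections_on A = (\<Pi>\<^sub>E \<gamma>\<in>A. carrier (fibre \<gamma>))"

text \<open>Together with \<open>section_zero\<close> this is the group structure of the product of
  the additive groups of the stalks, written out pointwise; \<open>section_product_simps\<close>
  makes the identification.\<close>

definition section_add :: "'g set \<Rightarrow> ('g \<Rightarrow> 'e) \<Rightarrow> ('g \<Rightarrow> 'e) \<Rightarrow> 'g \<Rightarrow> 'e" where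
  "section_add A f g = (\<lambda>\<gamma>\<in>A. f \<gamma> \<oplus>\<^bsub>fibre \<gamma>\<^esub> g \<gamma>)"

definition section_zero :: "'g set \<Rightarrow> 'g \<Rightarrow> 'e" where
  "section_zero A = (\<lambda>\<gamma>\<in>A. \<zero>\<^bsub>fibre \<gamma>\<^esub>)"

definition supp :: "'g set \<Rightarrow> ('g \<Rightarrow> 'e) \<Rightarrow> 'g set" where
  "supp A f = {\<gamma> \<in> A. f \<gamma> \<noteq> \<zero>\<^bsub>fibre \<gamma>\<^esub>}"

text \<open>Sections of the convolution ring, elements of \<open>L\<^sub>x\<close> and of the skew group ring, extended by
  zero, all have finite support on each set of arrows with a fixed range. On such sections
  convolution is an associative product, so every associativity law between these objects is an
  instance of \<open>conv_assoc\<close>.\<close>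

definition row_finite :: "('g \<Rightarrow> 'e) set" where
  "row_finite = {f \<in> sections_on (arrows G). \<forall>y. finite {\<gamma> \<in> supp (arrows G) f. rmap G \<gamma> = y}}"

definition zero_extend :: "'g set \<Rightarrow> ('g \<Rightarrow> 'e) \<Rightarrow> 'g \<Rightarrow> 'e" where
  "zero_extend A f = (\<lambda>\<gamma>\<in>arrows G. if \<gamma> \<in> A then f \<gamma> else \<zero>\<^bsub>fibre \<gamma>\<^esub>)"

abbreviation conv :: "('g \<Rightarrow> 'e) \<Rightarrow> ('g \<Rightarrow> 'e) \<Rightarrow> 'g \<Rightarrow> 'e" where
  "conv \<equiv> convolution G E (arrows G) (arrows G) (arrows G)"

lemma fibre_ring: "\<gamma> \<in> arrows G \<Longrightarrow> ring (fibre \<gamma>)"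
  by (simp add: stalk_ring)

lemma act_closed:
  "\<lbrakk>\<beta> \<in> arrows G; b \<in> carrier (stalk E (dmap G \<beta>))\<rbrakk> \<Longrightarrow> act E \<beta> b \<in> carrier (fibre \<beta>)"
  using act_ring_hom ring_hom_closed by metis

lemma act_zero: "\<beta> \<in> arrows G \<Longrightarrow> act E \<beta> \<zero>\<^bsub>stalk E (dmap G \<beta>)\<^esub> = \<zero>\<^bsub>fibre \<beta>\<^esub>"
  by (rule ring_hom_zero[OF act_ring_hom]) (simp_all add: stalk_ring)

lemma act_comp:
  assumes "\<beta> \<in> arrows G" "\<gamma> \<in> arrows G" "dmap G \<beta> = rmap G \<gamma>" "b \<in> carrier (stalk E (dmap G \<gamma>))"
  shows "act E \<beta> (act E \<gamma> b) = act E (\<beta> \<star> \<gamma>) b"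
  using act_act[of \<beta> \<gamma> b] assms stalk_carrier[of "dmap G \<gamma>"] by (auto simp: composable_iff)

lemma section_on_mem: "\<lbrakk>f \<in> sections_on A; \<gamma> \<in> A\<rbrakk> \<Longrightarrow> f \<gamma> \<in> carrier (fibre \<gamma>)"
  by (auto simp: sections_on_def)

lemma section_eqI:
  "\<lbrakk>f \<in> sections_on A; g \<in> sections_on A; \<And>\<gamma>. \<gamma> \<in> A \<Longrightarrow> f \<gamma> = g \<gamma>\<rbrakk> \<Longrightarrow> f = g"
  unfolding sections_on_def by (rule PiE_ext)

lemma row_finite_section: "f \<in> row_finite \<Longrightarrow> f \<in> sections_on (arrows G)"
  by (simp add: row_finite_def)

lemma section_add_closed:
  assumes "A \<subseteq> arrows G" "f \<in> sections_on A" "g \<in> sections_on A"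
  shows "section_add A f g \<in> sections_on A"
proof -
  have "f \<gamma> \<oplus>\<^bsub>fibre \<gamma>\<^esub> g \<gamma> \<in> carrier (fibre \<gamma>)" if "\<gamma> \<in> A" for \<gamma>
  proof -
    interpret R: ring "fibre \<gamma>" using fibre_ring that assms(1) by blast
    show ?thesis using section_on_mem[OF assms(2) that] section_on_mem[OF assms(3) that] by simp
  qed
  then show ?thesis by (simp add: section_add_def sections_on_def)
qed

lemma supp_section_add:
  assumes "A \<subseteq> arrows G" "f \<in> sections_on A" "g \<in> sections_on A"
  shows "supp A (section_add A f g) \<subseteq> supp A f \<union> supp A g"
proof
  fix \<gamma> assume \<gamma>: "\<gamma> \<in> supp A (section_add A f g)"
  then have A: "\<gamma> \<in> A" by (simp add: supp_def)
  interpret R: ring "fibre \<gamma>" using fibre_ring A assms(1) by blast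
  show "\<gamma> \<in> supp A f \<union> supp A g"
    using \<gamma> A by (auto simp: supp_def section_add_def)
qed

lemma section_zero_closed: "A \<subseteq> arrows G \<Longrightarrow> section_zero A \<in> sections_on A"
  using fibre_ring by (auto simp: section_zero_def sections_on_def intro!: ring.ring_simprules(2))

lemma zero_extend_closed:
  assumes "f \<in> sections_on A"
  shows "zero_extend A f \<in> sections_on (arrows G)"
  using section_on_mem[OF assms] fibre_ring
  by (auto simp: zero_extend_def sections_on_def intro!: ring.ring_simprules(2))

lemma supp_zero_extend: "A \<subseteq> arrows G \<Longrightarrow> supp (arrows G) (zero_extend A f) = supp A f"
  by (auto simp: supp_def zero_extend_def)

lemma zero_extend_row_finite:
  assumes "A \<subseteq> arrows G" "f \<in> sections_on A" "finite (supp A f)"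
  shows "zero_extend A f \<in> row_finite"
  using assms zero_extend_closed by (simp add: row_finite_def supp_zero_extend)

lemma zero_extend_arrows: "f \<in> sections_on (arrows G) \<Longrightarrow> zero_extend (arrows G) f = f"
  by (rule section_eqI[of _ "arrows G"]) (simp_all add: zero_extend_closed, simp add: zero_extend_def)

lemma zero_extend_add:
  assumes "A \<subseteq> arrows G" "f \<in> sections_on A" "g \<in> sections_on A"
  shows "zero_extend A (section_add A f g) = section_add (arrows G) (zero_extend A f) (zero_extend A g)"
proof
  fix \<gamma>
  show "zero_extend A (section_add A f g) \<gamma> = section_add (arrows G) (zero_extend A f) (zero_extend A g) \<gamma>"
  proof (cases "\<gamma> \<in> arrows G")
    case True
    then interpret R: ring "fibre \<gamma>" by (rule fibre_ring)
    show ?thesis using True by (simp add: zero_extend_def section_add_def)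
  qed (simp add: zero_extend_def section_add_def)
qed

section \<open>Convolution of sections\<close>

lemma conv_summand_closed:
  assumes "\<beta> \<in> arrows G" "\<rho> \<in> arrows G" "dmap G \<beta> = rmap G \<rho>"
    "a \<in> carrier (fibre \<beta>)" "b \<in> carrier (fibre \<rho>)"
  shows "a \<otimes>\<^bsub>fibre \<beta>\<^esub> act E \<beta> b \<in> carrier (fibre \<beta>)"
proof -
  interpret R: ring "fibre \<beta>" using assms fibre_ring by blast
  show ?thesis using act_closed[of \<beta> b] assms by simp
qed

lemma convolution_closed:
  assumes "A \<subseteq> arrows G" "B \<subseteq> arrows G" "C \<subseteq> arrows G" "f \<in> sections_on A" "g \<in> sections_on B"
  shows "convolution G E A B C f g \<in> sections_on C"
proof -
  have "gfinprod (add_monoid (fibre \<gamma>)) (\<lambda>(\<beta>, \<rho>). f \<beta> \<otimes>\<^bsub>fibre \<gamma>\<^esub> act E \<beta> (g \<rho>))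
      {(\<beta>, \<rho>) \<in> composable G. \<beta> \<in> A \<and> \<rho> \<in> B \<and> \<beta> \<star> \<rho> = \<gamma>} \<in> carrier (fibre \<gamma>)"
    if "\<gamma> \<in> C" for \<gamma>
  proof -
    interpret R: ring "fibre \<gamma>" using that assms fibre_ring by blast
    have "(\<lambda>(\<beta>, \<rho>). f \<beta> \<otimes>\<^bsub>fibre \<gamma>\<^esub> act E \<beta> (g \<rho>)) \<in>
        {(\<beta>, \<rho>) \<in> composable G. \<beta> \<in> A \<and> \<rho> \<in> B \<and> \<beta> \<star> \<rho> = \<gamma>} \<rightarrow> carrier (fibre \<gamma>)"
      using section_on_mem[OF assms(4)] section_on_mem[OF assms(5)] conv_summand_closed
      by (fastforce simp: composable_iff)
    \<comment> \<open>Over an infinite support \<open>gfinprod\<close> is the neutral element by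
      convention, so the value always lies in the stalk.\<close>
    then show ?thesis using R.add.gfinprod_closed by simp
  qed
  then show ?thesis by (simp add: convolution_def sections_on_def)
qed

lemma conv_closed:
  "\<lbrakk>f \<in> sections_on (arrows G); g \<in> sections_on (arrows G)\<rbrakk> \<Longrightarrow> conv f g \<in> sections_on (arrows G)"
  by (rule convolution_closed) auto

text \<open>A factorization \<gamma> = \<beta> \<rho> is determined by \<beta>, as \<rho> =
  \<beta>^(-1) \<gamma>, and only \<beta> in the support of \<open>f\<close> contributes. Any finite
  \<open>F\<close> between that part of the support and the whole row is allowed, so that several
  convolutions can be expanded over a common index set.\<close>

lemma conv_eq_finsum:
  assumes f: "f \<in> sections_on (arrows G)" and g: "g \<in> sections_on (arrows G)" and \<gamma>: "\<gamma> \<in> arrows G"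
    and F: "finite F" "F \<subseteq> {\<beta> \<in> arrows G. rmap G \<beta> = rmap G \<gamma>}"
      "{\<beta> \<in> supp (arrows G) f. rmap G \<beta> = rmap G \<gamma>} \<subseteq> F"
  shows "conv f g \<gamma> = (\<Oplus>\<^bsub>fibre \<gamma>\<^esub>\<beta>\<in>F. f \<beta> \<otimes>\<^bsub>fibre \<gamma>\<^esub> act E \<beta> (g (ginv G \<beta> \<star> \<gamma>)))"
proof -
  interpret R: ring "fibre \<gamma>" using \<gamma> by (rule fibre_ring)
  let ?h = "\<lambda>(\<beta>, \<rho>). f \<beta> \<otimes>\<^bsub>fibre \<gamma>\<^esub> act E \<beta> (g \<rho>)"
  let ?I = "{(\<beta>, \<rho>) \<in> composable G. \<beta> \<in> arrows G \<and> \<rho> \<in> arrows G \<and> \<beta> \<star> \<rho> = \<gamma>}"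
  let ?j = "\<lambda>\<beta>. (\<beta>, ginv G \<beta> \<star> \<gamma>)"
  have hI: "?h \<in> ?I \<rightarrow> carrier (fibre \<gamma>)"
    using section_on_mem[OF f] section_on_mem[OF g] conv_summand_closed
    by (fastforce simp: composable_iff)
  have jI: "?j ` F \<subseteq> ?I" using F(2) \<gamma> by (auto simp: composable_iff)
  have hJ: "?h \<in> ?j ` F \<rightarrow> carrier (fibre \<gamma>)"
    using jI hI by blast
  have inj: "inj_on ?j F" by (simp add: inj_on_def)
  have z: "?h q = \<zero>\<^bsub>fibre \<gamma>\<^esub>" if q: "q \<in> ?I - ?j ` F" for q
  proof -
    obtain \<beta> \<rho> where q': "q = (\<beta>, \<rho>)" "\<beta> \<in> arrows G" "\<rho> \<in> arrows G" "dmap G \<beta> = rmap G \<rho>" "\<beta> \<star> \<rho> = \<gamma>"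
      using q by (auto simp: composable_iff)
    then have "\<rho> = ginv G \<beta> \<star> \<gamma>" "rmap G \<beta> = rmap G \<gamma>" by auto
    then have "f \<beta> = \<zero>\<^bsub>fibre \<gamma>\<^esub>" using q q' F(3) by (auto simp: supp_def)
    moreover have "act E \<beta> (g \<rho>) \<in> carrier (fibre \<gamma>)"
      using act_closed[of \<beta> "g \<rho>"] section_on_mem[OF g q'(3)] q' \<open>rmap G \<beta> = rmap G \<gamma>\<close> by simp
    ultimately show ?thesis using q' by simp
  qed
  have "conv f g \<gamma> = gfinprod (add_monoid (fibre \<gamma>)) ?h ?I"
    using \<gamma> by (simp add: convolution_def)
  also have "\<dots> = gfinprod (add_monoid (fibre \<gamma>)) ?h (?j ` F)"
    by (rule R.add.gfinprod_mono_neutral_cong_right[OF jI]) (use z hI in auto)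
  also have "\<dots> = (\<Oplus>\<^bsub>fibre \<gamma>\<^esub>q\<in>?j ` F. ?h q)"
    using hJ F(1) by (subst R.add.gfinprod_eq_finprod) (simp_all add: finsum_def)
  also have "\<dots> = (\<Oplus>\<^bsub>fibre \<gamma>\<^esub>\<beta>\<in>F. ?h (?j \<beta>))"
    by (rule R.finsum_reindex[OF hJ inj])
  finally show ?thesis by simp
qed

text \<open>A nonzero value requires a nonzero summand, and there both factors are nonzero because
  \<open>act E \<beta>\<close> preserves zero. All later statements on supports of products rest on
  this inclusion.\<close>

lemma conv_supp:
  assumes f: "f \<in> sections_on (arrows G)" and g: "g \<in> sections_on (arrows G)"
    and \<gamma>: "\<gamma> \<in> supp (arrows G) (conv f g)"
  obtains \<beta> \<rho> where "\<beta> \<in> supp (arrows G) f" "\<rho> \<in> supp (arrows G) g" "dmap G \<beta> = rmap G \<rho>" "\<beta> \<star> \<rho> = \<gamma>"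
proof -
  have \<gamma>': "\<gamma> \<in> arrows G" using \<gamma> by (simp add: supp_def)
  interpret R: ring "fibre \<gamma>" using \<gamma>' by (rule fibre_ring)
  let ?h = "\<lambda>(\<beta>, \<rho>). f \<beta> \<otimes>\<^bsub>fibre \<gamma>\<^esub> act E \<beta> (g \<rho>)"
  let ?I = "{(\<beta>, \<rho>) \<in> composable G. \<beta> \<in> arrows G \<and> \<rho> \<in> arrows G \<and> \<beta> \<star> \<rho> = \<gamma>}"
  have "\<exists>q\<in>?I. ?h q \<noteq> \<zero>\<^bsub>fibre \<gamma>\<^esub>"
  proof (rule ccontr)
    assume "\<not> ?thesis"
    then have e: "{q \<in> ?I. ?h q \<noteq> \<one>\<^bsub>add_monoid (fibre \<gamma>)\<^esub>} = {}" by auto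
    have "conv f g \<gamma> = gfinprod (add_monoid (fibre \<gamma>)) ?h ?I"
      using \<gamma>' by (simp add: convolution_def)
    also have "\<dots> = \<zero>\<^bsub>fibre \<gamma>\<^esub>"
      unfolding gfinprod_def e using R.finsum_empty by (simp add: finsum_def)
    finally show False using \<gamma> by (simp add: supp_def)
  qed
  then obtain \<beta> \<rho> where q: "\<beta> \<in> arrows G" "\<rho> \<in> arrows G" "dmap G \<beta> = rmap G \<rho>" "\<beta> \<star> \<rho> = \<gamma>"
    "f \<beta> \<otimes>\<^bsub>fibre \<gamma>\<^esub> act E \<beta> (g \<rho>) \<noteq> \<zero>\<^bsub>fibre \<gamma>\<^esub>"
    by (auto simp: composable_iff)
  have r: "rmap G \<gamma> = rmap G \<beta>" using q by auto
  have "act E \<beta> (g \<rho>) \<in> carrier (fibre \<gamma>)"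
    using act_closed[of \<beta> "g \<rho>"] section_on_mem[OF g q(2)] q r by simp
  then have "f \<beta> \<noteq> \<zero>\<^bsub>fibre \<gamma>\<^esub>" using q(5) R.l_null by metis
  then have "f \<beta> \<noteq> \<zero>\<^bsub>fibre \<beta>\<^esub>" using r by simp
  moreover have "f \<beta> \<in> carrier (fibre \<gamma>)" using section_on_mem[OF f q(1)] r by simp
  then have "act E \<beta> (g \<rho>) \<noteq> \<zero>\<^bsub>fibre \<gamma>\<^esub>" using q(5) R.r_null by metis
  then have "g \<rho> \<noteq> \<zero>\<^bsub>fibre \<rho>\<^esub>" using act_zero[OF q(1)] q(3) r by auto
  ultimately show ?thesis using that q by (simp add: supp_def)
qed

lemma conv_add_left:
  assumes f: "f \<in> row_finite" and g: "g \<in> row_finite" and h: "h \<in> sections_on (arrows G)"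
  shows "conv (section_add (arrows G) f g) h = section_add (arrows G) (conv f h) (conv g h)"
proof (rule section_eqI)
  have fg: "f \<in> sections_on (arrows G)" "g \<in> sections_on (arrows G)"
    using f g row_finite_section by auto
  have s: "section_add (arrows G) f g \<in> sections_on (arrows G)" using section_add_closed[OF _ fg] by simp
  show "conv (section_add (arrows G) f g) h \<in> sections_on (arrows G)" by (rule conv_closed[OF s h])
  show "section_add (arrows G) (conv f h) (conv g h) \<in> sections_on (arrows G)"
    using section_add_closed conv_closed fg h by simp
  fix \<gamma> assume \<gamma>: "\<gamma> \<in> arrows G"
  then interpret R: ring "fibre \<gamma>" by (rule fibre_ring)
  let ?S = "\<lambda>f. {\<beta> \<in> supp (arrows G) f. rmap G \<beta> = rmap G \<gamma>}"
  \<comment> \<open>The union of the two rows contains the row of the sum, so all three convolutions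
    are expanded over it.\<close>
  let ?F = "?S f \<union> ?S g"
  let ?h = "\<lambda>\<beta>. act E \<beta> (h (ginv G \<beta> \<star> \<gamma>))"
  have F: "finite ?F" "?F \<subseteq> {\<beta> \<in> arrows G. rmap G \<beta> = rmap G \<gamma>}"
    using f g by (auto simp: row_finite_def supp_def)
  have c: "f \<beta> \<in> carrier (fibre \<gamma>)" "g \<beta> \<in> carrier (fibre \<gamma>)" "?h \<beta> \<in> carrier (fibre \<gamma>)"
    "section_add (arrows G) f g \<beta> = f \<beta> \<oplus>\<^bsub>fibre \<gamma>\<^esub> g \<beta>" if "\<beta> \<in> ?F" for \<beta>
  proof -
    have \<beta>: "\<beta> \<in> arrows G" "rmap G \<beta> = rmap G \<gamma>" using that F(2) by auto
    show "f \<beta> \<in> carrier (fibre \<gamma>)" "g \<beta> \<in> carrier (fibre \<gamma>)"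
      "section_add (arrows G) f g \<beta> = f \<beta> \<oplus>\<^bsub>fibre \<gamma>\<^esub> g \<beta>"
      using section_on_mem[OF fg(1) \<beta>(1)] section_on_mem[OF fg(2) \<beta>(1)] \<beta> by (simp_all add: section_add_def)
    show "?h \<beta> \<in> carrier (fibre \<gamma>)"
      using act_closed[OF \<beta>(1)] section_on_mem[OF h, of "ginv G \<beta> \<star> \<gamma>"] \<beta> \<gamma> by simp
  qed
  have "conv (section_add (arrows G) f g) h \<gamma> =
      (\<Oplus>\<^bsub>fibre \<gamma>\<^esub>\<beta>\<in>?F. section_add (arrows G) f g \<beta> \<otimes>\<^bsub>fibre \<gamma>\<^esub> ?h \<beta>)"
    using supp_section_add[OF _ fg] by (intro conv_eq_finsum[OF s h \<gamma> F]) blast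
  also have "\<dots> = (\<Oplus>\<^bsub>fibre \<gamma>\<^esub>\<beta>\<in>?F. f \<beta> \<otimes>\<^bsub>fibre \<gamma>\<^esub> ?h \<beta> \<oplus>\<^bsub>fibre \<gamma>\<^esub> g \<beta> \<otimes>\<^bsub>fibre \<gamma>\<^esub> ?h \<beta>)"
    using c by (intro R.finsum_cong refl) (auto simp: R.l_distr)
  also have "\<dots> = (\<Oplus>\<^bsub>fibre \<gamma>\<^esub>\<beta>\<in>?F. f \<beta> \<otimes>\<^bsub>fibre \<gamma>\<^esub> ?h \<beta>) \<oplus>\<^bsub>fibre \<gamma>\<^esub> (\<Oplus>\<^bsub>fibre \<gamma>\<^esub>\<beta>\<in>?F. g \<beta> \<otimes>\<^bsub>fibre \<gamma>\<^esub> ?h \<beta>)"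
    using c by (intro R.finsum_addf) auto
  also have "\<dots> = conv f h \<gamma> \<oplus>\<^bsub>fibre \<gamma>\<^esub> conv g h \<gamma>"
    by (simp add: conv_eq_finsum[OF fg(1) h \<gamma> F] conv_eq_finsum[OF fg(2) h \<gamma> F])
  finally show "conv (section_add (arrows G) f g) h \<gamma> = section_add (arrows G) (conv f h) (conv g h) \<gamma>"
    using \<gamma> by (simp add: section_add_def)
qed

text \<open>The index set of \<open>conv_eq_finsum\<close> depends on the left factor alone, so the
  row of \<open>f\<close> serves all three convolutions, and additivity of
  \<open>act E \<beta>\<close> is applied termwise.\<close>

lemma conv_add_right:
  assumes f: "f \<in> row_finite" and g: "g \<in> sections_on (arrows G)" and h: "h \<in> sections_on (arrows G)"
  shows "conv f (section_add (arrows G) g h) = section_add (arrows G) (conv f g) (conv f h)"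
proof (rule section_eqI)
  have fs: "f \<in> sections_on (arrows G)" using f row_finite_section by auto
  have s: "section_add (arrows G) g h \<in> sections_on (arrows G)" using section_add_closed[OF _ g h] by simp
  show "conv f (section_add (arrows G) g h) \<in> sections_on (arrows G)" by (rule conv_closed[OF fs s])
  show "section_add (arrows G) (conv f g) (conv f h) \<in> sections_on (arrows G)"
    using section_add_closed conv_closed fs g h by simp
  fix \<gamma> assume \<gamma>: "\<gamma> \<in> arrows G"
  then interpret R: ring "fibre \<gamma>" by (rule fibre_ring)
  let ?F = "{\<beta> \<in> supp (arrows G) f. rmap G \<beta> = rmap G \<gamma>}"
  let ?h = "\<lambda>h \<beta>. act E \<beta> (h (ginv G \<beta> \<star> \<gamma>))"
  have F: "finite ?F" "?F \<subseteq> {\<beta> \<in> arrows G. rmap G \<beta> = rmap G \<gamma>}"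
    using f by (auto simp: row_finite_def supp_def)
  have c: "f \<beta> \<in> carrier (fibre \<gamma>)" "?h g \<beta> \<in> carrier (fibre \<gamma>)" "?h h \<beta> \<in> carrier (fibre \<gamma>)"
    "?h (section_add (arrows G) g h) \<beta> = ?h g \<beta> \<oplus>\<^bsub>fibre \<gamma>\<^esub> ?h h \<beta>" if "\<beta> \<in> ?F" for \<beta>
  proof -
    have \<beta>: "\<beta> \<in> arrows G" "rmap G \<beta> = rmap G \<gamma>" using that F(2) by auto
    show "f \<beta> \<in> carrier (fibre \<gamma>)" using section_on_mem[OF fs \<beta>(1)] \<beta> by simp
    let ?\<rho> = "ginv G \<beta> \<star> \<gamma>"
    have \<rho>: "?\<rho> \<in> arrows G" "rmap G ?\<rho> = dmap G \<beta>" using \<beta> \<gamma> by simp_all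
    have gh: "g ?\<rho> \<in> carrier (stalk E (dmap G \<beta>))" "h ?\<rho> \<in> carrier (stalk E (dmap G \<beta>))"
      using section_on_mem[OF g \<rho>(1)] section_on_mem[OF h \<rho>(1)] \<rho> by simp_all
    show "?h g \<beta> \<in> carrier (fibre \<gamma>)" "?h h \<beta> \<in> carrier (fibre \<gamma>)"
      using act_closed[OF \<beta>(1)] gh \<beta> by simp_all
    show "?h (section_add (arrows G) g h) \<beta> = ?h g \<beta> \<oplus>\<^bsub>fibre \<gamma>\<^esub> ?h h \<beta>"
      using ring_hom_add[OF act_ring_hom[OF \<beta>(1)] gh] \<rho> \<beta> by (simp add: section_add_def)
  qed
  have "conv f (section_add (arrows G) g h) \<gamma> =
      (\<Oplus>\<^bsub>fibre \<gamma>\<^esub>\<beta>\<in>?F. f \<beta> \<otimes>\<^bsub>fibre \<gamma>\<^esub> ?h (section_add (arrows G) g h) \<beta>)"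
    by (intro conv_eq_finsum[OF fs s \<gamma> F]) blast
  also have "\<dots> = (\<Oplus>\<^bsub>fibre \<gamma>\<^esub>\<beta>\<in>?F. f \<beta> \<otimes>\<^bsub>fibre \<gamma>\<^esub> ?h g \<beta> \<oplus>\<^bsub>fibre \<gamma>\<^esub> f \<beta> \<otimes>\<^bsub>fibre \<gamma>\<^esub> ?h h \<beta>)"
    using c by (intro R.finsum_cong refl) (auto simp: R.r_distr)
  also have "\<dots> = (\<Oplus>\<^bsub>fibre \<gamma>\<^esub>\<beta>\<in>?F. f \<beta> \<otimes>\<^bsub>fibre \<gamma>\<^esub> ?h g \<beta>) \<oplus>\<^bsub>fibre \<gamma>\<^esub> (\<Oplus>\<^bsub>fibre \<gamma>\<^esub>\<beta>\<in>?F. f \<beta> \<otimes>\<^bsub>fibre \<gamma>\<^esub> ?h h \<beta>)"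
    using c by (intro R.finsum_addf) auto
  also have "\<dots> = conv f g \<gamma> \<oplus>\<^bsub>fibre \<gamma>\<^esub> conv f h \<gamma>"
    by (simp add: conv_eq_finsum[OF fs g \<gamma> F] conv_eq_finsum[OF fs h \<gamma> F])
  finally show "conv f (section_add (arrows G) g h) \<gamma> = section_add (arrows G) (conv f g) (conv f h) \<gamma>"
    using \<gamma> by (simp add: section_add_def)
qed

text \<open>Both sides equal the double sum of \<open>?t \<beta> \<mu>\<close>, where \<beta> is the
  first arrow and \<mu> the product of the first two arrows in a factorization of \<gamma>. On the
  left, \<mu> is the outer index and \<open>conv f g \<mu>\<close> is expanded over \<beta>. On the
  right, \<beta> is the outer index and the middle arrow is substituted as \<beta>^(-1) \<mu>;
  multiplicativity of \<open>act E \<beta>\<close> and the composition law of the action then give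
  the same term.\<close>

lemma conv_assoc:
  assumes f: "f \<in> row_finite" and g: "g \<in> row_finite" and h: "h \<in> sections_on (arrows G)"
  shows "conv (conv f g) h = conv f (conv g h)"
proof (rule section_eqI)
  have fg: "f \<in> sections_on (arrows G)" "g \<in> sections_on (arrows G)"
    using f g row_finite_section by auto
  have s: "conv f g \<in> sections_on (arrows G)" "conv g h \<in> sections_on (arrows G)"
    using conv_closed fg h by auto
  show "conv (conv f g) h \<in> sections_on (arrows G)" "conv f (conv g h) \<in> sections_on (arrows G)"
    using conv_closed fg h s by auto
  fix \<gamma> assume \<gamma>: "\<gamma> \<in> arrows G"
  then interpret R: ring "fibre \<gamma>" by (rule fibre_ring)
  let ?row = "{\<beta> \<in> arrows G. rmap G \<beta> = rmap G \<gamma>}"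
  define F where "F = {\<beta> \<in> supp (arrows G) f. rmap G \<beta> = rmap G \<gamma>}"
  \<comment> \<open>The possible values of \<mu>: products of an arrow in the row of
    \<open>f\<close> with one in the support of \<open>g\<close>. The set is finite because
    \<open>F\<close> and each row of \<open>g\<close> are, and it does not depend on \<beta>, which
    is what permits interchanging the sums.\<close>
  define H where "H = (\<lambda>(\<beta>, \<rho>). \<beta> \<star> \<rho>) ` (SIGMA \<beta>:F. {\<rho> \<in> supp (arrows G) g. rmap G \<rho> = dmap G \<beta>})"
  have F: "finite F" "F \<subseteq> ?row" using f by (auto simp: F_def row_finite_def supp_def)
  have H: "finite H" "H \<subseteq> ?row"
    unfolding H_def using F g by (auto simp: row_finite_def supp_def intro!: finite_SigmaI)
  have Hsupp: "{\<mu> \<in> supp (arrows G) (conv f g). rmap G \<mu> = rmap G \<gamma>} \<subseteq> H"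
  proof clarify
    fix \<mu> assume \<mu>: "\<mu> \<in> supp (arrows G) (conv f g)" "rmap G \<mu> = rmap G \<gamma>"
    obtain \<beta> \<rho> where *: "\<beta> \<in> supp (arrows G) f" "\<rho> \<in> supp (arrows G) g" "dmap G \<beta> = rmap G \<rho>" "\<beta> \<star> \<rho> = \<mu>"
      by (rule conv_supp[OF fg \<mu>(1)])
    then have "rmap G \<beta> = rmap G \<mu>" by (auto simp: supp_def)
    then show "\<mu> \<in> H"
      unfolding H_def F_def using * \<mu>(2) by (intro image_eqI[of _ _ "(\<beta>, \<rho>)"]) auto
  qed
  let ?t = "\<lambda>\<beta> \<mu>. f \<beta> \<otimes>\<^bsub>fibre \<gamma>\<^esub> (act E \<beta> (g (ginv G \<beta> \<star> \<mu>)) \<otimes>\<^bsub>fibre \<gamma>\<^esub> act E \<mu> (h (ginv G \<mu> \<star> \<gamma>)))"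
  have c: "f \<beta> \<in> carrier (fibre \<gamma>)" "act E \<beta> (g (ginv G \<beta> \<star> \<mu>)) \<in> carrier (fibre \<gamma>)"
    "act E \<mu> (h (ginv G \<mu> \<star> \<gamma>)) \<in> carrier (fibre \<gamma>)"
    "act E \<beta> (g (ginv G \<beta> \<star> \<mu>) \<otimes>\<^bsub>stalk E (dmap G \<beta>)\<^esub>
        act E (ginv G \<beta> \<star> \<mu>) (h (ginv G (ginv G \<beta> \<star> \<mu>) \<star> (ginv G \<beta> \<star> \<gamma>)))) =
      act E \<beta> (g (ginv G \<beta> \<star> \<mu>)) \<otimes>\<^bsub>fibre \<gamma>\<^esub> act E \<mu> (h (ginv G \<mu> \<star> \<gamma>))"
    "g (ginv G \<beta> \<star> \<mu>) \<otimes>\<^bsub>stalk E (dmap G \<beta>)\<^esub>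
        act E (ginv G \<beta> \<star> \<mu>) (h (ginv G (ginv G \<beta> \<star> \<mu>) \<star> (ginv G \<beta> \<star> \<gamma>))) \<in> carrier (stalk E (dmap G \<beta>))"
    if "\<beta> \<in> F" "\<mu> \<in> H" for \<beta> \<mu>
  proof -
    have \<beta>: "\<beta> \<in> arrows G" "rmap G \<beta> = rmap G \<gamma>" and \<mu>: "\<mu> \<in> arrows G" "rmap G \<mu> = rmap G \<gamma>"
      using that F(2) H(2) by auto
    interpret Q: ring "stalk E (dmap G \<beta>)" using \<beta> by (simp add: stalk_ring)
    show "f \<beta> \<in> carrier (fibre \<gamma>)" using section_on_mem[OF fg(1) \<beta>(1)] \<beta> by simp
    have b: "g (ginv G \<beta> \<star> \<mu>) \<in> carrier (stalk E (dmap G \<beta>))"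
      using section_on_mem[OF fg(2), of "ginv G \<beta> \<star> \<mu>"] \<beta> \<mu> by simp
    show "act E \<beta> (g (ginv G \<beta> \<star> \<mu>)) \<in> carrier (fibre \<gamma>)" using act_closed[OF \<beta>(1) b] \<beta> by simp
    have k: "h (ginv G \<mu> \<star> \<gamma>) \<in> carrier (stalk E (dmap G \<mu>))"
      using section_on_mem[OF h, of "ginv G \<mu> \<star> \<gamma>"] \<gamma> \<mu> by simp
    show "act E \<mu> (h (ginv G \<mu> \<star> \<gamma>)) \<in> carrier (fibre \<gamma>)" using act_closed[OF \<mu>(1) k] \<mu> by simp
    have k': "act E (ginv G \<beta> \<star> \<mu>) (h (ginv G \<mu> \<star> \<gamma>)) \<in> carrier (stalk E (dmap G \<beta>))"
      using act_closed[of "ginv G \<beta> \<star> \<mu>" "h (ginv G \<mu> \<star> \<gamma>)"] k \<beta> \<mu> by simp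
    have e: "h (ginv G (ginv G \<beta> \<star> \<mu>) \<star> (ginv G \<beta> \<star> \<gamma>)) = h (ginv G \<mu> \<star> \<gamma>)"
      using \<beta> \<mu> \<gamma> by (simp add: inv_comp_inv_comp)
    show "g (ginv G \<beta> \<star> \<mu>) \<otimes>\<^bsub>stalk E (dmap G \<beta>)\<^esub>
        act E (ginv G \<beta> \<star> \<mu>) (h (ginv G (ginv G \<beta> \<star> \<mu>) \<star> (ginv G \<beta> \<star> \<gamma>))) \<in> carrier (stalk E (dmap G \<beta>))"
      unfolding e using b k' by simp
    have "act E \<beta> (act E (ginv G \<beta> \<star> \<mu>) (h (ginv G \<mu> \<star> \<gamma>))) = act E \<mu> (h (ginv G \<mu> \<star> \<gamma>))"
      using act_comp[of \<beta> "ginv G \<beta> \<star> \<mu>" "h (ginv G \<mu> \<star> \<gamma>)"] k \<beta> \<mu> by simp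
    then show "act E \<beta> (g (ginv G \<beta> \<star> \<mu>) \<otimes>\<^bsub>stalk E (dmap G \<beta>)\<^esub>
        act E (ginv G \<beta> \<star> \<mu>) (h (ginv G (ginv G \<beta> \<star> \<mu>) \<star> (ginv G \<beta> \<star> \<gamma>)))) =
      act E \<beta> (g (ginv G \<beta> \<star> \<mu>)) \<otimes>\<^bsub>fibre \<gamma>\<^esub> act E \<mu> (h (ginv G \<mu> \<star> \<gamma>))"
      unfolding e using ring_hom_mult[OF act_ring_hom[OF \<beta>(1)] b k'] \<beta> by simp
  qed
  have tc: "?t \<beta> \<mu> \<in> carrier (fibre \<gamma>)" if "\<beta> \<in> F" "\<mu> \<in> H" for \<beta> \<mu>
    using c[OF that] by simp
  have l: "conv f g \<mu> \<otimes>\<^bsub>fibre \<gamma>\<^esub> act E \<mu> (h (ginv G \<mu> \<star> \<gamma>)) = (\<Oplus>\<^bsub>fibre \<gamma>\<^esub>\<beta>\<in>F. ?t \<beta> \<mu>)" if \<mu>: "\<mu> \<in> H" for \<mu>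
  proof -
    have \<mu>': "\<mu> \<in> arrows G" "rmap G \<mu> = rmap G \<gamma>" using \<mu> H(2) by auto
    have "conv f g \<mu> = (\<Oplus>\<^bsub>fibre \<gamma>\<^esub>\<beta>\<in>F. f \<beta> \<otimes>\<^bsub>fibre \<gamma>\<^esub> act E \<beta> (g (ginv G \<beta> \<star> \<mu>)))"
      using conv_eq_finsum[OF fg \<mu>'(1) F(1)] F(2) \<mu>'(2) by (auto simp: F_def)
    moreover have "act E \<mu> (h (ginv G \<mu> \<star> \<gamma>)) \<in> carrier (fibre \<gamma>)"
      using act_closed[of \<mu> "h (ginv G \<mu> \<star> \<gamma>)"] section_on_mem[OF h, of "ginv G \<mu> \<star> \<gamma>"] \<gamma> \<mu>' by simp
    ultimately have "conv f g \<mu> \<otimes>\<^bsub>fibre \<gamma>\<^esub> act E \<mu> (h (ginv G \<mu> \<star> \<gamma>)) =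
        (\<Oplus>\<^bsub>fibre \<gamma>\<^esub>\<beta>\<in>F. f \<beta> \<otimes>\<^bsub>fibre \<gamma>\<^esub> act E \<beta> (g (ginv G \<beta> \<star> \<mu>)) \<otimes>\<^bsub>fibre \<gamma>\<^esub> act E \<mu> (h (ginv G \<mu> \<star> \<gamma>)))"
      using c[OF _ \<mu>] F(1) by (simp add: R.finsum_ldistr Pi_def)
    also have "\<dots> = (\<Oplus>\<^bsub>fibre \<gamma>\<^esub>\<beta>\<in>F. ?t \<beta> \<mu>)"
      using c[OF _ \<mu>] by (intro R.finsum_cong refl) (auto simp: R.m_assoc)
    finally show ?thesis .
  qed
  have r: "f \<beta> \<otimes>\<^bsub>fibre \<gamma>\<^esub> act E \<beta> (conv g h (ginv G \<beta> \<star> \<gamma>)) = (\<Oplus>\<^bsub>fibre \<gamma>\<^esub>\<mu>\<in>H. ?t \<beta> \<mu>)" if \<beta>: "\<beta> \<in> F" for \<beta>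
  proof -
    have \<beta>': "\<beta> \<in> arrows G" "rmap G \<beta> = rmap G \<gamma>" using \<beta> F(2) by auto
    interpret Q: ring "stalk E (dmap G \<beta>)" using \<beta>' by (simp add: stalk_ring)
    let ?j = "\<lambda>\<mu>. ginv G \<beta> \<star> \<mu>"
    let ?k = "\<lambda>\<rho>. g \<rho> \<otimes>\<^bsub>stalk E (dmap G \<beta>)\<^esub> act E \<rho> (h (ginv G \<rho> \<star> (ginv G \<beta> \<star> \<gamma>)))"
    have inj: "inj_on ?j H"
    proof (rule inj_onI)
      fix \<mu> \<nu> assume "\<mu> \<in> H" "\<nu> \<in> H" "?j \<mu> = ?j \<nu>"
      then show "\<mu> = \<nu>" using H(2) \<beta>' by (metis (mono_tags, lifting) comp_inv_comp mem_Collect_eq subsetD)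
    qed
    \<comment> \<open>The translate of \<open>H\<close> by the inverse of \<beta> contains the whole
      relevant row of \<open>g\<close>, so the inner convolution may be summed over it; the surplus
      terms vanish.\<close>
    have sub: "{\<rho> \<in> supp (arrows G) g. rmap G \<rho> = rmap G (ginv G \<beta> \<star> \<gamma>)} \<subseteq> ?j ` H"
    proof clarify
      fix \<rho> assume \<rho>: "\<rho> \<in> supp (arrows G) g" "rmap G \<rho> = rmap G (ginv G \<beta> \<star> \<gamma>)"
      then have "\<rho> \<in> arrows G" "rmap G \<rho> = dmap G \<beta>" using \<beta>' \<gamma> by (auto simp: supp_def)
      moreover from this have "\<beta> \<star> \<rho> \<in> H"
        unfolding H_def using \<beta> \<rho>(1) by (intro image_eqI[of _ _ "(\<beta>, \<rho>)"]) auto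
      ultimately show "\<rho> \<in> ?j ` H" using \<beta>' by (intro image_eqI[of _ _ "\<beta> \<star> \<rho>"]) simp_all
    qed
    have "conv g h (ginv G \<beta> \<star> \<gamma>) = (\<Oplus>\<^bsub>stalk E (dmap G \<beta>)\<^esub>\<rho>\<in>?j ` H. ?k \<rho>)"
      using conv_eq_finsum[OF fg(2) h _ _ _ sub] \<beta>' \<gamma> H by force
    also have "\<dots> = (\<Oplus>\<^bsub>stalk E (dmap G \<beta>)\<^esub>\<mu>\<in>H. ?k (?j \<mu>))"
      using c(5)[OF \<beta>] by (intro Q.finsum_reindex[OF _ inj]) auto
    finally have "act E \<beta> (conv g h (ginv G \<beta> \<star> \<gamma>)) = (\<Oplus>\<^bsub>fibre \<gamma>\<^esub>\<mu>\<in>H. act E \<beta> (?k (?j \<mu>)))"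
      using ring_hom_finsum[OF act_ring_hom[OF \<beta>'(1)], of "\<lambda>\<mu>. ?k (?j \<mu>)" H] c(5)[OF \<beta>] \<beta>'
      by (simp add: stalk_ring Pi_def R.ring_axioms)
    also have "\<dots> = (\<Oplus>\<^bsub>fibre \<gamma>\<^esub>\<mu>\<in>H. act E \<beta> (g (ginv G \<beta> \<star> \<mu>)) \<otimes>\<^bsub>fibre \<gamma>\<^esub> act E \<mu> (h (ginv G \<mu> \<star> \<gamma>)))"
      using c[OF \<beta>] by (intro R.finsum_cong refl) (auto simp: simp_implies_def)
    finally show ?thesis
      using c[OF \<beta>] H(1) \<beta>' section_on_mem[OF fg(1) \<beta>'(1)] by (simp add: R.finsum_rdistr Pi_def)
  qed
  have "conv (conv f g) h \<gamma> = (\<Oplus>\<^bsub>fibre \<gamma>\<^esub>\<mu>\<in>H. conv f g \<mu> \<otimes>\<^bsub>fibre \<gamma>\<^esub> act E \<mu> (h (ginv G \<mu> \<star> \<gamma>)))"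
    by (rule conv_eq_finsum[OF s(1) h \<gamma> H Hsupp])
  also have "\<dots> = (\<Oplus>\<^bsub>fibre \<gamma>\<^esub>\<mu>\<in>H. \<Oplus>\<^bsub>fibre \<gamma>\<^esub>\<beta>\<in>F. ?t \<beta> \<mu>)"
    using l tc by (intro R.finsum_cong refl) (auto simp: simp_implies_def intro!: R.finsum_closed)
  also have "\<dots> = (\<Oplus>\<^bsub>fibre \<gamma>\<^esub>\<beta>\<in>F. \<Oplus>\<^bsub>fibre \<gamma>\<^esub>\<mu>\<in>H. ?t \<beta> \<mu>)"
    using tc by (intro R.finsum_swap F(1) H(1)) auto
  also have "\<dots> = (\<Oplus>\<^bsub>fibre \<gamma>\<^esub>\<beta>\<in>F. f \<beta> \<otimes>\<^bsub>fibre \<gamma>\<^esub> act E \<beta> (conv g h (ginv G \<beta> \<star> \<gamma>)))"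
    using r tc by (intro R.finsum_cong refl) (auto simp: simp_implies_def intro!: R.finsum_closed)
  also have "\<dots> = conv f (conv g h) \<gamma>"
    by (rule conv_eq_finsum[OF fg(1) s(2) \<gamma> F, symmetric]) (simp add: F_def)
  finally show "conv (conv f g) h \<gamma> = conv f (conv g h) \<gamma>" .
qed

text \<open>Pairs outside \<open>A\<close> and \<open>B\<close> add only zero summands, since one of
  the two zero extensions vanishes there.\<close>

lemma convolution_eq_conv:
  assumes sub: "A \<subseteq> arrows G" "B \<subseteq> arrows G" "C \<subseteq> arrows G"
    and f: "f \<in> sections_on A" and g: "g \<in> sections_on B" and \<gamma>: "\<gamma> \<in> C"
  shows "convolution G E A B C f g \<gamma> = conv (zero_extend A f) (zero_extend B g) \<gamma>"
proof -
  have \<gamma>': "\<gamma> \<in> arrows G" using \<gamma> sub by blast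
  interpret R: ring "fibre \<gamma>" using \<gamma>' by (rule fibre_ring)
  let ?f = "zero_extend A f" and ?g = "zero_extend B g"
  let ?h = "\<lambda>(\<beta>, \<rho>). ?f \<beta> \<otimes>\<^bsub>fibre \<gamma>\<^esub> act E \<beta> (?g \<rho>)"
  let ?I = "{(\<beta>, \<rho>) \<in> composable G. \<beta> \<in> arrows G \<and> \<rho> \<in> arrows G \<and> \<beta> \<star> \<rho> = \<gamma>}"
  let ?J = "{(\<beta>, \<rho>) \<in> composable G. \<beta> \<in> A \<and> \<rho> \<in> B \<and> \<beta> \<star> \<rho> = \<gamma>}"
  have c: "?f \<beta> \<in> carrier (fibre \<gamma>)" "act E \<beta> (?g \<rho>) \<in> carrier (fibre \<gamma>)"
      "act E \<beta> \<zero>\<^bsub>fibre \<rho>\<^esub> = \<zero>\<^bsub>fibre \<gamma>\<^esub>" "rmap G \<beta> = rmap G \<gamma>" "\<beta> \<in> arrows G" "\<rho> \<in> arrows G"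
    if q: "(\<beta>, \<rho>) \<in> ?I" for \<beta> \<rho>
  proof -
    have q': "\<beta> \<in> arrows G" "\<rho> \<in> arrows G" "dmap G \<beta> = rmap G \<rho>" "rmap G \<beta> = rmap G \<gamma>"
      using q by (auto simp: composable_iff)
    show "?f \<beta> \<in> carrier (fibre \<gamma>)" "act E \<beta> (?g \<rho>) \<in> carrier (fibre \<gamma>)"
      "act E \<beta> \<zero>\<^bsub>fibre \<rho>\<^esub> = \<zero>\<^bsub>fibre \<gamma>\<^esub>" "rmap G \<beta> = rmap G \<gamma>" "\<beta> \<in> arrows G" "\<rho> \<in> arrows G"
      using q' section_on_mem[OF zero_extend_closed[OF f] q'(1)] act_zero[OF q'(1)]
        act_closed[OF q'(1), of "?g \<rho>"] section_on_mem[OF zero_extend_closed[OF g] q'(2)] by simp_all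
  qed
  have "gfinprod (add_monoid (fibre \<gamma>)) (\<lambda>(\<beta>, \<rho>). f \<beta> \<otimes>\<^bsub>fibre \<gamma>\<^esub> act E \<beta> (g \<rho>)) ?J =
      gfinprod (add_monoid (fibre \<gamma>)) ?h ?I"
  proof (rule R.add.gfinprod_mono_neutral_cong_left)
    show "?J \<subseteq> ?I" by (auto simp: composable_iff)
    show "?h q = \<zero>\<^bsub>fibre \<gamma>\<^esub>" if q: "q \<in> ?I - ?J" for q
    proof -
      obtain \<beta> \<rho> where \<beta>\<rho>: "q = (\<beta>, \<rho>)" "(\<beta>, \<rho>) \<in> ?I" "\<beta> \<notin> A \<or> \<rho> \<notin> B" using q by auto
      note c' = c[OF \<beta>\<rho>(2)]
      have "?f \<beta> = \<zero>\<^bsub>fibre \<gamma>\<^esub> \<or> ?g \<rho> = \<zero>\<^bsub>fibre \<rho>\<^esub>" using \<beta>\<rho>(3) c' by (auto simp: zero_extend_def)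
      then show ?thesis using \<beta>\<rho>(1) c' by auto
    qed
    show "(\<lambda>(\<beta>, \<rho>). f \<beta> \<otimes>\<^bsub>fibre \<gamma>\<^esub> act E \<beta> (g \<rho>)) q = ?h q" if "q \<in> ?J" for q
      using that by (auto simp: zero_extend_def composable_iff)
    show "?h \<in> ?I \<rightarrow> carrier (fibre \<gamma>)"
    proof
      fix q assume q: "q \<in> ?I"
      obtain \<beta> \<rho> where \<beta>\<rho>: "q = (\<beta>, \<rho>)" by (cases q)
      show "?h q \<in> carrier (fibre \<gamma>)"
        using c(1,2)[OF q[unfolded \<beta>\<rho>]] R.m_closed unfolding \<beta>\<rho> prod.case by blast
    qed
  qed
  then show ?thesis using \<gamma> \<gamma>' by (simp add: convolution_def)
qed

text \<open>The condition on \<open>C\<close> forces the full convolution to vanish off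
  \<open>C\<close>, so nothing is lost when the result is first cut down to \<open>C\<close>. Thus
  zero extension turns the products and actions on the various sets of arrows into the single
  product \<open>conv\<close>.\<close>

lemma zero_extend_convolution:
  assumes sub: "A \<subseteq> arrows G" "B \<subseteq> arrows G" "C \<subseteq> arrows G"
    and f: "f \<in> sections_on A" and g: "g \<in> sections_on B"
    and C: "\<And>\<beta> \<rho>. \<lbrakk>\<beta> \<in> A; \<rho> \<in> B; dmap G \<beta> = rmap G \<rho>\<rbrakk> \<Longrightarrow> \<beta> \<star> \<rho> \<in> C"
  shows "zero_extend C (convolution G E A B C f g) = conv (zero_extend A f) (zero_extend B g)"
proof (rule section_eqI)
  show "zero_extend C (convolution G E A B C f g) \<in> sections_on (arrows G)"
    by (intro zero_extend_closed convolution_closed sub f g)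
  show "conv (zero_extend A f) (zero_extend B g) \<in> sections_on (arrows G)"
    by (intro conv_closed zero_extend_closed f g)
  fix \<gamma> assume \<gamma>: "\<gamma> \<in> arrows G"
  show "zero_extend C (convolution G E A B C f g) \<gamma> = conv (zero_extend A f) (zero_extend B g) \<gamma>"
  proof (cases "\<gamma> \<in> C")
    case True
    then show ?thesis using convolution_eq_conv[OF sub f g True] \<gamma> by (simp add: zero_extend_def)
  next
    case False
    have "\<gamma> \<notin> supp (arrows G) (conv (zero_extend A f) (zero_extend B g))"
    proof
      assume "\<gamma> \<in> supp (arrows G) (conv (zero_extend A f) (zero_extend B g))"
      then obtain \<beta> \<rho> where "\<beta> \<in> supp A f" "\<rho> \<in> supp B g" "dmap G \<beta> = rmap G \<rho>" "\<beta> \<star> \<rho> = \<gamma>"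
        using conv_supp[OF zero_extend_closed[OF f] zero_extend_closed[OF g]]
        by (metis sub(1,2) supp_zero_extend)
      then show False using C False by (auto simp: supp_def)
    qed
    then show ?thesis using False \<gamma> by (simp add: zero_extend_def supp_def)
  qed
qed

text \<open>Allows identities in \<open>L\<close> to be proved after zero extension, where they
  become laws of \<open>conv\<close>.\<close>

lemma zero_extend_inject:
  assumes "A \<subseteq> arrows G" "f \<in> sections_on A" "g \<in> sections_on A" "zero_extend A f = zero_extend A g"
  shows "f = g"
proof (rule section_eqI[OF assms(2,3)])
  fix \<gamma> assume "\<gamma> \<in> A"
  then show "f \<gamma> = g \<gamma>"
    using fun_cong[OF assms(4), of \<gamma>] assms(1) by (auto simp: zero_extend_def split: if_splits)
qed

end

section \<open>Bisections and elementary sections\<close>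

lemma local_homeomorphism_continuous:
  assumes "local_homeomorphism X Y f"
  shows "continuous_map X Y f"
proof -
  have loc: "\<exists>U. openin X U \<and> a \<in> U \<and> continuous_map (subtopology X U) Y f" if "a \<in> topspace X" for a
    using assms that unfolding local_homeomorphism_def
    by (meson continuous_map_into_fulltopology homeomorphic_imp_continuous_map)
  show ?thesis
    unfolding continuous_map_def
  proof (intro conjI allI impI)
    show "f \<in> topspace X \<rightarrow> topspace Y"
    proof
      fix a assume "a \<in> topspace X"
      then obtain U where "openin X U" "a \<in> U" "continuous_map (subtopology X U) Y f"
        using loc by blast
      then show "f a \<in> topspace Y"
        using \<open>a \<in> topspace X\<close> by (auto simp: continuous_map_def Pi_def)
    qed
    fix V assume V: "openin Y V"
    show "openin X {x \<in> topspace X. f x \<in> V}"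
    proof (subst openin_subopen, intro ballI)
      fix a assume a: "a \<in> {x \<in> topspace X. f x \<in> V}"
      then obtain U where U: "openin X U" "a \<in> U" "continuous_map (subtopology X U) Y f"
        using loc by blast
      have "openin X {x \<in> topspace (subtopology X U). f x \<in> V}"
        using openin_continuous_map_preimage[OF U(3) V] U(1) openin_trans_full by blast
      then show "\<exists>T. openin X T \<and> a \<in> T \<and> T \<subseteq> {x \<in> topspace X. f x \<in> V}"
        using a U(2) by (intro exI[of _ "{x \<in> topspace (subtopology X U). f x \<in> V}"]) auto
    qed
  qed
qed

lemma local_homeomorphism_open_map:
  assumes "local_homeomorphism X Y f"
  shows "open_map X Y f"
  unfolding open_map_def
proof (intro allI impI)
  fix V assume V: "openin X V"
  show "openin Y (f ` V)"
  proof (subst openin_subopen, intro ballI)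
    fix y assume "y \<in> f ` V"
    then obtain a where a: "a \<in> V" "y = f a" by blast
    then have "a \<in> topspace X" using V openin_subset by blast
    then obtain U where U: "openin X U" "a \<in> U" "openin Y (f ` U)"
      "homeomorphic_map (subtopology X U) (subtopology Y (f ` U)) f"
      using assms unfolding local_homeomorphism_def by blast
    have "openin (subtopology X U) (U \<inter> V)" by (rule openin_subtopology_Int2[OF V])
    then have "openin (subtopology Y (f ` U)) (f ` (U \<inter> V))"
      using homeomorphic_imp_open_map[OF U(4)] unfolding open_map_def by blast
    then have "openin Y (f ` (U \<inter> V))" using U(3) openin_trans_full by blast
    then show "\<exists>T. openin Y T \<and> y \<in> T \<and> T \<subseteq> f ` V" using a U(2) by blast
  qed
qed

text \<open>The preimage of an open \<open>V\<close> under the inverse is the image of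
  \<open>U \<inter> V\<close>, which is open because local homeomorphisms are open maps. Applied to
  \<open>rmap G\<close> this lifts units into a bisection; applied to \<open>proj E\<close> it gives
  local sections of the sheaf.\<close>

lemma local_homeomorphism_inverse:
  assumes lh: "local_homeomorphism X Y f" and U: "openin X U" and inj: "inj_on f U"
  shows "continuous_map (subtopology Y (f ` U)) X (the_inv_into U f)"
proof -
  have UX: "U \<subseteq> topspace X" using U openin_subset by blast
  have fU: "openin Y (f ` U)" using local_homeomorphism_open_map[OF lh] U unfolding open_map_def by blast
  have fUY: "f ` U \<subseteq> topspace Y" using fU openin_subset by blast
  show ?thesis
    unfolding continuous_map_def
  proof (intro conjI allI impI)
    show "the_inv_into U f \<in> topspace (subtopology Y (f ` U)) \<rightarrow> topspace X"
      using UX fUY by (auto simp: the_inv_into_f_f[OF inj])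
    fix V assume V: "openin X V"
    have "{y \<in> topspace (subtopology Y (f ` U)). the_inv_into U f y \<in> V} = f ` (U \<inter> V)"
      using fUY by (auto simp: the_inv_into_f_f[OF inj])
    moreover have "openin Y (f ` (U \<inter> V))"
      using local_homeomorphism_open_map[OF lh] U V unfolding open_map_def by blast
    ultimately show "openin (subtopology Y (f ` U)) {y \<in> topspace (subtopology Y (f ` U)). the_inv_into U f y \<in> V}"
      using openin_subtopology_Int2[of Y "f ` (U \<inter> V)" "f ` U"]
      by (metis image_mono inf.absorb2 inf_le1)
  qed
qed

lemma arbitrary_union_ofE:
  assumes "(arbitrary union_of P) S" "x \<in> S"
  obtains K where "P K" "x \<in> K" "K \<subseteq> S"
  using assms unfolding union_of_def by blast

lemmas continuous_map_comp = continuous_map_compose[unfolded o_def]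

locale ample_sheaf_of_rings = ample_groupoid G + sheaf_of_rings G E
  for G :: "('g, 'z) groupoid_scheme" (structure) and E :: "('g, 'e, 'y) ring_sheaf_scheme"
begin

sublocale sheaf_of_rings_over_groupoid G E
  by unfold_locales

lemma topspace_unit_top [simp]: "topspace (unit_top G) = units G"
  unfolding unit_top_def using unit_in_arrows by auto

lemma continuous_rmap: "continuous_map (arrow_top G) (unit_top G) (rmap G)"
  by (rule local_homeomorphism_continuous[OF r_local_homeomorphism])

lemma continuous_dmap: "continuous_map (arrow_top G) (unit_top G) (dmap G)"
  by (rule continuous_map_eq[OF continuous_map_comp[OF inv_continuous continuous_rmap]]) simp

lemma openin_rmap_image: "openin (arrow_top G) U \<Longrightarrow> openin (unit_top G) (rmap G ` U)"
  using local_homeomorphism_open_map[OF r_local_homeomorphism] unfolding open_map_def by blast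

lemma fibre_mem: "\<gamma> \<in> arrows G \<Longrightarrow> a \<in> carrier (fibre \<gamma>) \<longleftrightarrow> a \<in> topspace (etale_top E) \<and> proj E a = rmap G \<gamma>"
  by (simp add: stalk_carrier)

lemma sections_on_arrows:
  "(\<Pi>\<^sub>E \<gamma>\<in>arrows G. {e \<in> topspace (etale_top E). proj E e = rmap G \<gamma>}) = sections_on (arrows G)"
  unfolding sections_on_def by (rule PiE_cong) (auto simp: stalk_carrier)

lemma elementary_iff: "f \<in> elementary_sections G E \<longleftrightarrow> f \<in> sections_on (arrows G) \<and>
    (\<exists>U. compact_open_bisection G U \<and> continuous_map (subtopology (arrow_top G) U) (etale_top E) f \<and>
      supp (arrows G) f \<subseteq> U)"
  unfolding elementary_sections_def sections_on_arrows supp_def by blast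

text \<open>On \<open>U\<close> the range map is a continuous injection into the Hausdorff unit
  space. Hence in \<open>bisectionI\<close> compactness need only be checked in the sense of open
  covers, even if the arrow space is not Hausdorff.\<close>

lemma bisection_Hausdorff:
  assumes "openin (arrow_top G) U" "inj_on (rmap G) U"
  shows "Hausdorff_space (subtopology (arrow_top G) U)"
proof (rule Hausdorff_space_injective_preimage[OF units_Hausdorff])
  show "continuous_map (subtopology (arrow_top G) U) (unit_top G) (rmap G)"
    by (rule continuous_map_from_subtopology[OF continuous_rmap])
  show "inj_on (rmap G) (topspace (subtopology (arrow_top G) U))"
    using assms(2) by (rule inj_on_subset) simp
qed

lemma bisectionD:
  assumes "compact_open_bisection G U"
  shows "openin (arrow_top G) U" "compactin (arrow_top G) U" "inj_on (dmap G) U" "inj_on (rmap G) U"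
    "U \<subseteq> arrows G"
  using assms openin_subset by (auto simp: compact_open_bisection_def compact_Hausdorff_in_def)

lemma bisectionI:
  assumes "openin (arrow_top G) U" "compactin (arrow_top G) U" "inj_on (dmap G) U" "inj_on (rmap G) U"
  shows "compact_open_bisection G U"
  using assms bisection_Hausdorff by (simp add: compact_open_bisection_def compact_Hausdorff_in_def)

section \<open>Continuity of composition, action and multiplication, and products of
  bisections\<close>

lemma continuous_comp:
  assumes f: "continuous_map X (arrow_top G) f" and g: "continuous_map X (arrow_top G) g"
    and fg: "\<And>x. x \<in> topspace X \<Longrightarrow> dmap G (f x) = rmap G (g x)"
  shows "continuous_map X (arrow_top G) (\<lambda>x. f x \<star> g x)"
proof -
  have "f x \<in> arrows G \<and> g x \<in> arrows G" if "x \<in> topspace X" for x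
    using f g that by (auto simp: continuous_map_def)
  then have "continuous_map X (subtopology (prod_topology (arrow_top G) (arrow_top G)) (composable G))
      (\<lambda>x. (f x, g x))"
    using fg by (intro continuous_map_into_subtopology continuous_map_pairedI f g) (auto simp: composable_iff)
  from continuous_map_comp[OF this comp_continuous] show ?thesis by simp
qed

lemma continuous_act:
  assumes f: "continuous_map X (arrow_top G) f" and g: "continuous_map X (etale_top E) g"
    and fg: "\<And>x. x \<in> topspace X \<Longrightarrow> dmap G (f x) = proj E (g x)"
  shows "continuous_map X (etale_top E) (\<lambda>x. act E (f x) (g x))"
proof -
  have "continuous_map X (subtopology (prod_topology (arrow_top G) (etale_top E)) {(\<gamma>, e). dmap G \<gamma> = proj E e})
      (\<lambda>x. (f x, g x))"
    using fg by (intro continuous_map_into_subtopology continuous_map_pairedI f g) auto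
  from continuous_map_comp[OF this act_continuous] show ?thesis by simp
qed

lemma continuous_mult:
  assumes f: "continuous_map X (etale_top E) f" and g: "continuous_map X (etale_top E) g"
    and fg: "\<And>x. x \<in> topspace X \<Longrightarrow> proj E (f x) = proj E (g x)"
  shows "continuous_map X (etale_top E) (\<lambda>x. f x \<otimes>\<^bsub>stalk E (proj E (f x))\<^esub> g x)"
proof -
  have "continuous_map X (subtopology (prod_topology (etale_top E) (etale_top E)) {(a, b). proj E a = proj E b})
      (\<lambda>x. (f x, g x))"
    using fg by (intro continuous_map_into_subtopology continuous_map_pairedI f g) auto
  from continuous_map_comp[OF this mult_continuous] show ?thesis by simp
qed

text \<open>The product of bisections as sets of arrows. It carries the support of a convolution of
  elementary sections.\<close>

definition bisection_product :: "'g set \<Rightarrow> 'g set \<Rightarrow> 'g set" where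
  "bisection_product U V = {\<beta> \<star> \<rho> | \<beta> \<rho>. \<beta> \<in> U \<and> \<rho> \<in> V \<and> dmap G \<beta> = rmap G \<rho>}"

text \<open>If \<gamma> factors through \<open>U\<close>, its first factor is the only arrow of
  \<open>U\<close> with the range of \<gamma>, namely \<open>s \<gamma>\<close>, and the second
  factor is then forced. So the product is the preimage of \<open>V\<close> under a continuous map
  on the open set \<open>D\<close>. The continuous factorization is also what makes convolutions of
  elementary sections continuous.\<close>

lemma bisection_product_open:
  assumes U: "openin (arrow_top G) U" "inj_on (rmap G) U" and V: "openin (arrow_top G) V"
  defines "D \<equiv> {\<gamma> \<in> arrows G. rmap G \<gamma> \<in> rmap G ` U}" and "s \<equiv> \<lambda>\<gamma>. the_inv_into U (rmap G) (rmap G \<gamma>)"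
  shows "continuous_map (subtopology (arrow_top G) D) (arrow_top G) s"
    and "continuous_map (subtopology (arrow_top G) D) (arrow_top G) (\<lambda>\<gamma>. ginv G (s \<gamma>) \<star> \<gamma>)"
    and "bisection_product U V = {\<gamma> \<in> D. ginv G (s \<gamma>) \<star> \<gamma> \<in> V}"
    and "openin (arrow_top G) (bisection_product U V)"
proof -
  have UV: "U \<subseteq> arrows G" "V \<subseteq> arrows G" using U V openin_subset by blast+
  have D: "openin (arrow_top G) D" "D \<subseteq> arrows G"
    unfolding D_def using openin_continuous_map_preimage[OF continuous_rmap openin_rmap_image[OF U(1)]] by auto
  have s: "s \<gamma> \<in> U" "rmap G (s \<gamma>) = rmap G \<gamma>" if "\<gamma> \<in> D" for \<gamma>
    using that unfolding D_def s_def
    by (auto intro!: the_inv_into_into[OF U(2)] f_the_inv_into_f[OF U(2)])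
  have "continuous_map (subtopology (arrow_top G) D) (subtopology (unit_top G) (rmap G ` U)) (rmap G)"
    by (intro continuous_map_into_subtopology continuous_map_from_subtopology[OF continuous_rmap])
      (auto simp: D_def)
  from continuous_map_comp[OF this local_homeomorphism_inverse[OF r_local_homeomorphism U]]
  show cs: "continuous_map (subtopology (arrow_top G) D) (arrow_top G) s" by (simp add: s_def)
  show ck: "continuous_map (subtopology (arrow_top G) D) (arrow_top G) (\<lambda>\<gamma>. ginv G (s \<gamma>) \<star> \<gamma>)"
    using s UV D(2) by (intro continuous_comp continuous_map_comp[OF cs inv_continuous]) (auto simp: continuous_map_from_subtopology subset_iff)
  show eq: "bisection_product U V = {\<gamma> \<in> D. ginv G (s \<gamma>) \<star> \<gamma> \<in> V}"
  proof (intro Set.set_eqI iffI)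
    fix \<gamma> assume "\<gamma> \<in> bisection_product U V"
    then obtain \<beta> \<rho> where *: "\<gamma> = \<beta> \<star> \<rho>" "\<beta> \<in> U" "\<rho> \<in> V" "dmap G \<beta> = rmap G \<rho>"
      by (auto simp: bisection_product_def)
    then have arr: "\<beta> \<in> arrows G" "\<rho> \<in> arrows G" using UV by auto
    have r: "rmap G \<gamma> = rmap G \<beta>" using * arr by simp
    then have D: "\<gamma> \<in> D" using * arr by (auto simp: D_def)
    have "s \<gamma> = \<beta>" using s[OF D] r *(2) U(2) by (metis inj_onD)
    then show "\<gamma> \<in> {\<gamma> \<in> D. ginv G (s \<gamma>) \<star> \<gamma> \<in> V}" using D * arr by simp
  next
    fix \<gamma> assume *: "\<gamma> \<in> {\<gamma> \<in> D. ginv G (s \<gamma>) \<star> \<gamma> \<in> V}"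
    then have "s \<gamma> \<in> arrows G" "\<gamma> \<in> arrows G" "rmap G (s \<gamma>) = rmap G \<gamma>" using s UV D by auto
    then have "\<gamma> = s \<gamma> \<star> (ginv G (s \<gamma>) \<star> \<gamma>)" "dmap G (s \<gamma>) = rmap G (ginv G (s \<gamma>) \<star> \<gamma>)" by simp_all
    then show "\<gamma> \<in> bisection_product U V" using * s unfolding bisection_product_def by blast
  qed
  have "openin (subtopology (arrow_top G) D) {\<gamma> \<in> topspace (subtopology (arrow_top G) D). ginv G (s \<gamma>) \<star> \<gamma> \<in> V}"
    by (rule openin_continuous_map_preimage[OF ck V])
  moreover have "{\<gamma> \<in> topspace (subtopology (arrow_top G) D). ginv G (s \<gamma>) \<star> \<gamma> \<in> V} = bisection_product U V"
    using D(2) by (auto simp: eq)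
  ultimately show "openin (arrow_top G) (bisection_product U V)" using D(1) openin_trans_full by metis
qed

text \<open>For compactness the product is written as the continuous image of those arrows of
  \<open>U\<close> that can be followed by one of \<open>V\<close>: the follower is unique because
  \<open>rmap G\<close> is injective on \<open>V\<close>. For injectivity the factors are recovered
  one at a time, from the right if the sources agree and from the left if the ranges agree.\<close>

lemma bisection_product_bisection:
  assumes U: "compact_open_bisection G U" and V: "compact_open_bisection G V"
  shows "compact_open_bisection G (bisection_product U V)"
proof (rule bisectionI)
  note U' = bisectionD[OF U] and V' = bisectionD[OF V]
  show "openin (arrow_top G) (bisection_product U V)"
    by (rule bisection_product_open(4)[OF U'(1,4) V'(1)])
  let ?W = "{\<beta> \<in> arrows G. dmap G \<beta> \<in> rmap G ` V}"
  let ?s = "the_inv_into V (rmap G)"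
  \<comment> \<open>A compact set of units is closed by the Hausdorff property, so the composable
    part of \<open>U\<close> is a closed part of a compact set.\<close>
  have "compactin (unit_top G) (rmap G ` V)" by (rule image_compactin[OF V'(2) continuous_rmap])
  then have "closedin (arrow_top G) ?W"
    using compactin_imp_closedin[OF units_Hausdorff] closedin_continuous_map_preimage[OF continuous_dmap] by blast
  then have W: "compactin (arrow_top G) (?W \<inter> U)" using U'(2) by (rule closed_Int_compactin)
  have s: "?s y \<in> V" "rmap G (?s y) = y" if "y \<in> rmap G ` V" for y
    using that by (auto intro!: the_inv_into_into[OF V'(4)] f_the_inv_into_f[OF V'(4)])
  have "continuous_map (subtopology (arrow_top G) (?W \<inter> U)) (subtopology (unit_top G) (rmap G ` V)) (dmap G)"
    by (intro continuous_map_into_subtopology continuous_map_from_subtopology[OF continuous_dmap]) auto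
  from continuous_map_comp[OF this local_homeomorphism_inverse[OF r_local_homeomorphism V'(1,4)]]
  have cs: "continuous_map (subtopology (arrow_top G) (?W \<inter> U)) (arrow_top G) (\<lambda>\<beta>. ?s (dmap G \<beta>))" .
  have "continuous_map (subtopology (arrow_top G) (?W \<inter> U)) (arrow_top G) (\<lambda>\<beta>. \<beta> \<star> ?s (dmap G \<beta>))"
    by (rule continuous_comp[OF _ cs]) (auto simp: continuous_map_from_subtopology s)
  moreover have "compactin (subtopology (arrow_top G) (?W \<inter> U)) (?W \<inter> U)"
    using W by (simp add: compactin_subtopology)
  ultimately have "compactin (arrow_top G) ((\<lambda>\<beta>. \<beta> \<star> ?s (dmap G \<beta>)) ` (?W \<inter> U))"
    by (rule image_compactin[rotated])
  moreover have "(\<lambda>\<beta>. \<beta> \<star> ?s (dmap G \<beta>)) ` (?W \<inter> U) = bisection_product U V"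
  proof (intro Set.set_eqI iffI)
    fix \<gamma> assume "\<gamma> \<in> (\<lambda>\<beta>. \<beta> \<star> ?s (dmap G \<beta>)) ` (?W \<inter> U)"
    then obtain \<beta> where \<beta>: "\<beta> \<in> U" "dmap G \<beta> \<in> rmap G ` V" "\<gamma> = \<beta> \<star> ?s (dmap G \<beta>)" by blast
    show "\<gamma> \<in> bisection_product U V"
      unfolding bisection_product_def mem_Collect_eq
      by (rule exI[of _ \<beta>], rule exI[of _ "?s (dmap G \<beta>)"]) (simp add: \<beta> s)
  next
    fix \<gamma> assume "\<gamma> \<in> bisection_product U V"
    then obtain \<beta> \<rho> where *: "\<gamma> = \<beta> \<star> \<rho>" "\<beta> \<in> U" "\<rho> \<in> V" "dmap G \<beta> = rmap G \<rho>"
      by (auto simp: bisection_product_def)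
    have "?s (dmap G \<beta>) = \<rho>" using *(3,4) by (simp add: the_inv_into_f_f[OF V'(4)])
    then show "\<gamma> \<in> (\<lambda>\<beta>. \<beta> \<star> ?s (dmap G \<beta>)) ` (?W \<inter> U)"
      using * U'(5) by (intro image_eqI[of _ _ \<beta>]) auto
  qed
  ultimately show "compactin (arrow_top G) (bisection_product U V)" by simp
  show "inj_on (dmap G) (bisection_product U V)" "inj_on (rmap G) (bisection_product U V)"
  proof (rule_tac [!] inj_onI)
    fix \<gamma> \<gamma>' assume "\<gamma> \<in> bisection_product U V" "\<gamma>' \<in> bisection_product U V"
    then obtain \<beta> \<rho> \<beta>' \<rho>' where *: "\<gamma> = \<beta> \<star> \<rho>" "\<beta> \<in> U" "\<rho> \<in> V" "dmap G \<beta> = rmap G \<rho>"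
      "\<gamma>' = \<beta>' \<star> \<rho>'" "\<beta>' \<in> U" "\<rho>' \<in> V" "dmap G \<beta>' = rmap G \<rho>'"
      by (auto simp: bisection_product_def)
    then have arr: "\<beta> \<in> arrows G" "\<rho> \<in> arrows G" "\<beta>' \<in> arrows G" "\<rho>' \<in> arrows G" using U'(5) V'(5) by auto
    show "\<gamma> = \<gamma>'" if "dmap G \<gamma> = dmap G \<gamma>'"
    proof -
      have "dmap G \<rho> = dmap G \<rho>'" using that arr *(4,8) unfolding *(1,5) by simp
      then have "\<rho> = \<rho>'" using inj_onD[OF V'(3)] *(3,7) by blast
      moreover from this have "\<beta> = \<beta>'" using inj_onD[OF U'(3)] *(2,4,6,8) by metis
      ultimately show ?thesis unfolding *(1,5) by simp
    qed
    show "\<gamma> = \<gamma>'" if "rmap G \<gamma> = rmap G \<gamma>'"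
    proof -
      have "rmap G \<beta> = rmap G \<beta>'" using that arr *(4,8) unfolding *(1,5) by simp
      then have "\<beta> = \<beta>'" using inj_onD[OF U'(4)] *(2,6) by blast
      moreover from this have "\<rho> = \<rho>'" using inj_onD[OF V'(4)] *(3,4,7,8) by metis
      ultimately show ?thesis unfolding *(1,5) by simp
    qed
  qed
qed

lemma elementary_row_finite:
  assumes "f \<in> elementary_sections G E"
  shows "f \<in> row_finite"
proof -
  obtain U where U: "compact_open_bisection G U" "supp (arrows G) f \<subseteq> U" and f: "f \<in> sections_on (arrows G)"
    using assms by (auto simp: elementary_iff)
  have "finite {\<gamma> \<in> supp (arrows G) f. rmap G \<gamma> = y}" for y
  proof (rule finite_imageD[of "rmap G"])
    show "finite (rmap G ` {\<gamma> \<in> supp (arrows G) f. rmap G \<gamma> = y})"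
      by (rule finite_subset[of _ "{y}"]) auto
    show "inj_on (rmap G) {\<gamma> \<in> supp (arrows G) f. rmap G \<gamma> = y}"
      using bisectionD(4)[OF U(1)] by (rule inj_on_subset) (use U(2) in auto)
  qed
  then show ?thesis using f by (simp add: row_finite_def)
qed

lemma elementary_column_finite:
  assumes "f \<in> elementary_sections G E"
  shows "finite {\<gamma> \<in> supp (arrows G) f. dmap G \<gamma> = y}"
proof -
  obtain U where U: "compact_open_bisection G U" "supp (arrows G) f \<subseteq> U"
    using assms by (auto simp: elementary_iff)
  show ?thesis
  proof (rule finite_imageD[of "dmap G"])
    show "finite (dmap G ` {\<gamma> \<in> supp (arrows G) f. dmap G \<gamma> = y})"
      by (rule finite_subset[of _ "{y}"]) auto
    show "inj_on (dmap G) {\<gamma> \<in> supp (arrows G) f. dmap G \<gamma> = y}"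
      using bisectionD(3)[OF U(1)] by (rule inj_on_subset) (use U(2) in auto)
  qed
qed

text \<open>Over the product of the bisections the convolution sum has the single term at \<beta> =
  \<open>s \<gamma>\<close>, so it is a composite of the continuous factorization with
  \<open>f\<close>, \<open>g\<close>, the action and the multiplication.\<close>

lemma elementary_conv:
  assumes "f \<in> elementary_sections G E" "g \<in> elementary_sections G E"
  shows "conv f g \<in> elementary_sections G E"
proof -
  obtain U V where U: "compact_open_bisection G U" "supp (arrows G) f \<subseteq> U"
      "continuous_map (subtopology (arrow_top G) U) (etale_top E) f"
    and V: "compact_open_bisection G V" "supp (arrows G) g \<subseteq> V"
      "continuous_map (subtopology (arrow_top G) V) (etale_top E) g"
    and fg: "f \<in> sections_on (arrows G)" "g \<in> sections_on (arrows G)"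
    using assms by (auto simp: elementary_iff)
  note U' = bisectionD[OF U(1)] and V' = bisectionD[OF V(1)]
  let ?W = "bisection_product U V"
  define D where "D = {\<gamma> \<in> arrows G. rmap G \<gamma> \<in> rmap G ` U}"
  define s where "s = (\<lambda>\<gamma>. the_inv_into U (rmap G) (rmap G \<gamma>))"
  have W: "continuous_map (subtopology (arrow_top G) D) (arrow_top G) s"
    "continuous_map (subtopology (arrow_top G) D) (arrow_top G) (\<lambda>\<gamma>. ginv G (s \<gamma>) \<star> \<gamma>)"
    "?W = {\<gamma> \<in> D. ginv G (s \<gamma>) \<star> \<gamma> \<in> V}"
    unfolding D_def s_def by (rule bisection_product_open[OF U'(1,4) V'(1)])+
  have s: "s \<gamma> \<in> U" "rmap G (s \<gamma>) = rmap G \<gamma>" "\<gamma> \<in> arrows G" "s \<gamma> \<in> arrows G"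
    "ginv G (s \<gamma>) \<star> \<gamma> \<in> V" if "\<gamma> \<in> ?W" for \<gamma>
    using that U'(5) unfolding W(3) unfolding D_def s_def
    by (auto intro!: the_inv_into_into[OF U'(4)] f_the_inv_into_f[OF U'(4)])
  have WD: "?W \<subseteq> D" "?W \<subseteq> arrows G" using W(3) D_def by auto
  then have top: "topspace (subtopology (arrow_top G) ?W) = ?W" by auto
  \<comment> \<open>The stalk is indexed by the projection of the first factor, which equals
    \<open>rmap G \<gamma>\<close>, to fit the shape of \<open>continuous_mult\<close>.\<close>
  have val: "conv f g \<gamma> = f (s \<gamma>) \<otimes>\<^bsub>stalk E (proj E (f (s \<gamma>)))\<^esub> act E (s \<gamma>) (g (ginv G (s \<gamma>) \<star> \<gamma>))"
    and pr: "proj E (f (s \<gamma>)) = rmap G \<gamma>" "proj E (g (ginv G (s \<gamma>) \<star> \<gamma>)) = dmap G (s \<gamma>)"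
      "proj E (act E (s \<gamma>) (g (ginv G (s \<gamma>) \<star> \<gamma>))) = rmap G \<gamma>" if \<gamma>: "\<gamma> \<in> ?W" for \<gamma>
  proof -
    note s' = s[OF \<gamma>]
    interpret R: ring "fibre \<gamma>" using fibre_ring s' by blast
    let ?\<rho> = "ginv G (s \<gamma>) \<star> \<gamma>"
    have \<rho>: "?\<rho> \<in> arrows G" "rmap G ?\<rho> = dmap G (s \<gamma>)" using s' by simp_all
    have fc: "f (s \<gamma>) \<in> carrier (fibre \<gamma>)" using section_on_mem[OF fg(1) s'(4)] s' by simp
    have gc: "g ?\<rho> \<in> carrier (stalk E (dmap G (s \<gamma>)))" using section_on_mem[OF fg(2) \<rho>(1)] \<rho> by simp
    have ac: "act E (s \<gamma>) (g ?\<rho>) \<in> carrier (fibre \<gamma>)" using act_closed[OF s'(4) gc] s' by simp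
    show pr: "proj E (f (s \<gamma>)) = rmap G \<gamma>" "proj E (act E (s \<gamma>) (g ?\<rho>)) = rmap G \<gamma>"
      using fc ac s'(3) by (simp_all add: fibre_mem)
    show "proj E (g ?\<rho>) = dmap G (s \<gamma>)" using gc s'(4) by (simp add: stalk_carrier)
    have "{\<beta> \<in> supp (arrows G) f. rmap G \<beta> = rmap G \<gamma>} \<subseteq> {s \<gamma>}"
      using U(2) inj_onD[OF U'(4) _ _ s'(1)] unfolding s'(2) by blast
    then have "conv f g \<gamma> = (\<Oplus>\<^bsub>fibre \<gamma>\<^esub>\<beta>\<in>{s \<gamma>}. f \<beta> \<otimes>\<^bsub>fibre \<gamma>\<^esub> act E \<beta> (g (ginv G \<beta> \<star> \<gamma>)))"
      using s' by (intro conv_eq_finsum[OF fg s'(3)]) auto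
    also have "\<dots> = f (s \<gamma>) \<otimes>\<^bsub>fibre \<gamma>\<^esub> act E (s \<gamma>) (g ?\<rho>)"
      using fc ac by (simp add: R.finsum_insert)
    finally show "conv f g \<gamma> = f (s \<gamma>) \<otimes>\<^bsub>stalk E (proj E (f (s \<gamma>)))\<^esub> act E (s \<gamma>) (g ?\<rho>)"
      using pr by simp
  qed
  have cs: "continuous_map (subtopology (arrow_top G) ?W) (subtopology (arrow_top G) U) s"
    using continuous_map_from_subtopology_mono[OF W(1) WD(1)] s
    by (intro continuous_map_into_subtopology) auto
  have ck: "continuous_map (subtopology (arrow_top G) ?W) (subtopology (arrow_top G) V) (\<lambda>\<gamma>. ginv G (s \<gamma>) \<star> \<gamma>)"
    using continuous_map_from_subtopology_mono[OF W(2) WD(1)] s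
    by (intro continuous_map_into_subtopology) auto
  have "continuous_map (subtopology (arrow_top G) ?W) (etale_top E)
      (\<lambda>\<gamma>. f (s \<gamma>) \<otimes>\<^bsub>stalk E (proj E (f (s \<gamma>)))\<^esub> act E (s \<gamma>) (g (ginv G (s \<gamma>) \<star> \<gamma>)))"
  proof (intro continuous_mult continuous_act)
    show "continuous_map (subtopology (arrow_top G) ?W) (etale_top E) (\<lambda>\<gamma>. f (s \<gamma>))"
      by (rule continuous_map_comp[OF cs U(3)])
    show "continuous_map (subtopology (arrow_top G) ?W) (etale_top E) (\<lambda>\<gamma>. g (ginv G (s \<gamma>) \<star> \<gamma>))"
      by (rule continuous_map_comp[OF ck V(3)])
    show "continuous_map (subtopology (arrow_top G) ?W) (arrow_top G) s"
      by (rule continuous_map_into_fulltopology[OF cs])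
  qed (use pr in \<open>simp_all only: top\<close>)
  then have "continuous_map (subtopology (arrow_top G) ?W) (etale_top E) (conv f g)"
    by (rule continuous_map_eq) (simp only: top val)
  moreover have "supp (arrows G) (conv f g) \<subseteq> ?W"
  proof
    fix \<gamma> assume "\<gamma> \<in> supp (arrows G) (conv f g)"
    then obtain \<beta> \<rho> where "\<beta> \<in> supp (arrows G) f" "\<rho> \<in> supp (arrows G) g" "dmap G \<beta> = rmap G \<rho>" "\<beta> \<star> \<rho> = \<gamma>"
      by (rule conv_supp[OF fg])
    then show "\<gamma> \<in> ?W" using U(2) V(2) unfolding bisection_product_def by blast
  qed
  ultimately show ?thesis
    using bisection_product_bisection[OF U(1) V(1)] conv_closed[OF fg] by (auto simp: elementary_iff)
qed

text \<open>A local section of the sheaf through \<open>a\<close> is pulled back along the range map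
  to a small bisection around \<gamma>. Vanishing on arrows with source in \<open>F\<close> kills
  the unwanted summands of an element of the induced module; vanishing on the other arrows with the
  source of \<gamma> makes the section act on the remaining summand like a monomial.\<close>

lemma elementary_section_exists:
  assumes \<gamma>: "\<gamma> \<in> arrows G" and a: "a \<in> carrier (fibre \<gamma>)" and F: "finite F" "F \<subseteq> units G" "dmap G \<gamma> \<notin> F"
  obtains f where "f \<in> elementary_sections G E" "f \<gamma> = a"
    "\<And>\<beta>. \<lbrakk>\<beta> \<in> arrows G; dmap G \<beta> \<in> F\<rbrakk> \<Longrightarrow> f \<beta> = \<zero>\<^bsub>fibre \<beta>\<^esub>"
    "\<And>\<beta>. \<lbrakk>\<beta> \<in> arrows G; dmap G \<beta> = dmap G \<gamma>; \<beta> \<noteq> \<gamma>\<rbrakk> \<Longrightarrow> f \<beta> = \<zero>\<^bsub>fibre \<beta>\<^esub>"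
proof -
  obtain W1 where W1: "openin (arrow_top G) W1" "\<gamma> \<in> W1" "inj_on (rmap G) W1"
  proof -
    obtain U where U: "openin (arrow_top G) U" "\<gamma> \<in> U"
      "homeomorphic_map (subtopology (arrow_top G) U) (subtopology (unit_top G) (rmap G ` U)) (rmap G)"
      using r_local_homeomorphism \<gamma> unfolding local_homeomorphism_def by blast
    then have "inj_on (rmap G) U"
      using homeomorphic_imp_injective_map[OF U(3)] openin_subset[OF U(1)] by (simp add: inf.absorb2)
    then show ?thesis using that U by blast
  qed
  \<comment> \<open>Injectivity of the source map near \<gamma> is injectivity of the range map near
    the inverse of \<gamma>, transported by inversion.\<close>
  obtain W2 where W2: "openin (arrow_top G) W2" "\<gamma> \<in> W2" "inj_on (dmap G) W2"
  proof -
    obtain U where U: "openin (arrow_top G) U" "ginv G \<gamma> \<in> U"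
      "homeomorphic_map (subtopology (arrow_top G) U) (subtopology (unit_top G) (rmap G ` U)) (rmap G)"
      using r_local_homeomorphism \<gamma> inv_in_arrows unfolding local_homeomorphism_def by blast
    then have inj: "inj_on (rmap G) U"
      using homeomorphic_imp_injective_map[OF U(3)] openin_subset[OF U(1)] by (simp add: inf.absorb2)
    let ?W = "{\<beta> \<in> arrows G. ginv G \<beta> \<in> U}"
    have "openin (arrow_top G) ?W" by (rule openin_continuous_map_preimage[OF inv_continuous U(1)])
    moreover have "inj_on (dmap G) ?W"
    proof (rule inj_onI)
      fix \<alpha> \<beta> assume *: "\<alpha> \<in> ?W" "\<beta> \<in> ?W" "dmap G \<alpha> = dmap G \<beta>"
      then have "ginv G \<alpha> = ginv G \<beta>" using inj_onD[OF inj, of "ginv G \<alpha>" "ginv G \<beta>"] by simp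
      then show "\<alpha> = \<beta>" using * inv_inv by (metis (mono_tags, lifting) mem_Collect_eq)
    qed
    ultimately show ?thesis using that U(2) \<gamma> by blast
  qed
  \<comment> \<open>Finite sets of units are closed by the Hausdorff property, so avoiding
    \<open>F\<close> is an open condition on the source.\<close>
  define W3 where "W3 = {\<beta> \<in> arrows G. dmap G \<beta> \<in> units G - F}"
  have W3: "openin (arrow_top G) W3"
    unfolding W3_def
  proof (rule openin_continuous_map_preimage[OF continuous_dmap])
    show "openin (unit_top G) (units G - F)"
      using closedin_Hausdorff_finite[OF units_Hausdorff _ F(1)] F(2) by (simp add: closedin_def)
  qed
  define W where "W = W1 \<inter> W2 \<inter> W3"
  have W: "openin (arrow_top G) W" "\<gamma> \<in> W" "inj_on (rmap G) W" "inj_on (dmap G) W" "W \<subseteq> arrows G"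
    using W1 W2 W3 \<gamma> F(3) openin_subset by (auto simp: W_def W3_def intro: inj_on_subset)
  have a': "a \<in> topspace (etale_top E)" "proj E a = rmap G \<gamma>" using a \<gamma> by (simp_all add: fibre_mem)
  obtain A where A: "openin (etale_top E) A" "a \<in> A"
    "homeomorphic_map (subtopology (etale_top E) A) (subtopology (unit_top G) (proj E ` A)) (proj E)"
    "openin (unit_top G) (proj E ` A)"
    using proj_local_homeomorphism a'(1) unfolding local_homeomorphism_def by blast
  have injA: "inj_on (proj E) A"
    using homeomorphic_imp_injective_map[OF A(3)] openin_subset[OF A(1)] by (simp add: inf.absorb2)
  let ?t = "the_inv_into A (proj E)"
  have AE: "A \<subseteq> topspace (etale_top E)" using A(1) openin_subset by blast
  \<comment> \<open>A compact open \<open>K\<close> is chosen in this intersection: inside the range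
    of \<open>W\<close>, its lift through the inverse of \<open>rmap G\<close> is compact, and
    inside the projection of \<open>A\<close>, the local section is defined on it.\<close>
  have "openin (unit_top G) (rmap G ` W \<inter> proj E ` A)"
    by (rule openin_Int[OF openin_rmap_image[OF W(1)] A(4)])
  then have "(arbitrary union_of (\<lambda>K. openin (unit_top G) K \<and> compact_Hausdorff_in (unit_top G) K))
      (rmap G ` W \<inter> proj E ` A)"
    by (rule iffD1[OF fun_cong[OF units_compact_open_basis]])
  moreover have "rmap G \<gamma> \<in> rmap G ` W \<inter> proj E ` A" using W(2) A(2) a'(2) by force
  ultimately obtain K where K': "openin (unit_top G) K \<and> compact_Hausdorff_in (unit_top G) K" "rmap G \<gamma> \<in> K"
    "K \<subseteq> rmap G ` W \<inter> proj E ` A"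
    by (rule arbitrary_union_ofE)
  then have K: "openin (unit_top G) K" "compactin (unit_top G) K" "rmap G \<gamma> \<in> K"
    "K \<subseteq> rmap G ` W" "K \<subseteq> proj E ` A"
    by (simp_all add: compact_Hausdorff_in_def)
  define U where "U = {\<beta> \<in> W. rmap G \<beta> \<in> K}"
  have U: "compact_open_bisection G U"
  proof (rule bisectionI)
    show "openin (arrow_top G) U"
      unfolding U_def by (rule openin_continuous_map_preimage_gen[OF continuous_rmap W(1) K(1)])
    have "compactin (subtopology (unit_top G) (rmap G ` W)) K" using K by (simp add: compactin_subtopology)
    then have "compactin (arrow_top G) (the_inv_into W (rmap G) ` K)"
      by (rule image_compactin[OF _ local_homeomorphism_inverse[OF r_local_homeomorphism W(1,3)]])
    moreover have "the_inv_into W (rmap G) ` K = U"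
    proof (intro Set.set_eqI iffI)
      fix \<beta> assume "\<beta> \<in> the_inv_into W (rmap G) ` K"
      then show "\<beta> \<in> U" using K(4) unfolding U_def
        by (auto intro: the_inv_into_into[OF W(3)] simp: f_the_inv_into_f[OF W(3)])
    next
      fix \<beta> assume "\<beta> \<in> U"
      then show "\<beta> \<in> the_inv_into W (rmap G) ` K"
        unfolding U_def by (intro image_eqI[of _ _ "rmap G \<beta>"]) (auto simp: the_inv_into_f_f[OF W(3)])
    qed
    ultimately show "compactin (arrow_top G) U" by simp
    show "inj_on (dmap G) U" "inj_on (rmap G) U"
      using W(3,4) by (auto simp: U_def intro: inj_on_subset)
  qed
  have t: "?t (rmap G \<beta>) \<in> topspace (etale_top E)" "proj E (?t (rmap G \<beta>)) = rmap G \<beta>" if "\<beta> \<in> U" for \<beta>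
    using that K(5) AE the_inv_into_into[OF injA _ subset_refl] f_the_inv_into_f[OF injA]
    by (auto simp: U_def)
  have UA: "U \<subseteq> arrows G" by (rule bisectionD(5)[OF U])
  \<comment> \<open>Continuity is claimed on \<open>U\<close> only. In a non-Hausdorff arrow space a
    compact open set need not be closed, and the extension by zero may be discontinuous.\<close>
  define f where "f = (\<lambda>\<beta>\<in>arrows G. if \<beta> \<in> U then ?t (rmap G \<beta>) else \<zero>\<^bsub>fibre \<beta>\<^esub>)"
  have f0: "f \<beta> = \<zero>\<^bsub>fibre \<beta>\<^esub>" if "\<beta> \<in> arrows G" "\<beta> \<notin> U" for \<beta>
    using that by (simp add: f_def)
  have "f \<beta> \<in> carrier (fibre \<beta>)" if "\<beta> \<in> arrows G" for \<beta>
  proof (cases "\<beta> \<in> U")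
    case True
    then show ?thesis using t[OF True] that by (simp add: fibre_mem f_def)
  next
    case False
    interpret R: ring "fibre \<beta>" using fibre_ring that by blast
    show ?thesis using f0[OF that False] R.zero_closed by simp
  qed
  then have "f \<in> sections_on (arrows G)"
    unfolding sections_on_def by (auto simp: f_def)
  moreover have "continuous_map (subtopology (arrow_top G) U) (etale_top E) f"
  proof (rule continuous_map_eq)
    have "continuous_map (subtopology (arrow_top G) U) (subtopology (unit_top G) (proj E ` A)) (rmap G)"
      using K(5) by (intro continuous_map_into_subtopology continuous_map_from_subtopology[OF continuous_rmap])
        (auto simp: U_def)
    from continuous_map_comp[OF this local_homeomorphism_inverse[OF proj_local_homeomorphism A(1) injA]]
    show "continuous_map (subtopology (arrow_top G) U) (etale_top E) (\<lambda>\<beta>. ?t (rmap G \<beta>))" .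
  qed (simp add: f_def)
  moreover have "supp (arrows G) f \<subseteq> U" using f0 by (auto simp: supp_def)
  ultimately have "f \<in> elementary_sections G E" using U by (auto simp: elementary_iff)
  moreover have "f \<gamma> = a"
    using W(2) K(3) \<gamma> the_inv_into_f_f[OF injA A(2)] a'(2) by (simp add: f_def U_def)
  moreover have "f \<beta> = \<zero>\<^bsub>fibre \<beta>\<^esub>" if "\<beta> \<in> arrows G" "dmap G \<beta> \<in> F" for \<beta>
    using that by (intro f0) (auto simp: U_def W_def W3_def)
  moreover have "f \<beta> = \<zero>\<^bsub>fibre \<beta>\<^esub>" if "\<beta> \<in> arrows G" "dmap G \<beta> = dmap G \<gamma>" "\<beta> \<noteq> \<gamma>" for \<beta>
    using that inj_onD[OF W(4) that(2) _ W(2)] by (intro f0) (auto simp: U_def)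
  ultimately show ?thesis using that by blast
qed

end

section \<open>The convolution ring and its bimodule\<close>

context sheaf_of_rings_over_groupoid
begin

abbreviation section_product :: "'g set \<Rightarrow> ('g \<Rightarrow> 'e) monoid" where
  "section_product A \<equiv> product_group A (\<lambda>\<gamma>. add_monoid (fibre \<gamma>))"

lemma fibre_group: "\<gamma> \<in> arrows G \<Longrightarrow> group (add_monoid (fibre \<gamma>))"
  using fibre_ring ring.is_abelian_group abelian_group.a_group by blast

lemma section_product_simps:
  "carrier (section_product A) = sections_on A"
  "monoid.mult (section_product A) = section_add A"
  "one (section_product A) = section_zero A"
  by (simp_all add: sections_on_def section_add_def[abs_def] section_zero_def)

lemma section_add_comm:
  assumes "A \<subseteq> arrows G" "f \<in> sections_on A" "g \<in> sections_on A"
  shows "section_add A f g = section_add A g f"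
  unfolding section_add_def
proof (rule restrict_ext)
  fix \<gamma> assume \<gamma>: "\<gamma> \<in> A"
  interpret R: ring "fibre \<gamma>" using fibre_ring \<gamma> assms(1) by blast
  show "f \<gamma> \<oplus>\<^bsub>fibre \<gamma>\<^esub> g \<gamma> = g \<gamma> \<oplus>\<^bsub>fibre \<gamma>\<^esub> f \<gamma>"
    using section_on_mem[OF assms(2) \<gamma>] section_on_mem[OF assms(3) \<gamma>] by (rule R.a_comm)
qed

lemma section_product_comm_group:
  assumes "A \<subseteq> arrows G"
  shows "comm_group (section_product A)"
proof (rule group.group_comm_groupI)
  show "group (section_product A)" using fibre_group assms by (intro product_group) blast
qed (simp only: section_product_simps section_add_comm[OF assms])

lemma supp_section_inv:
  assumes "A \<subseteq> arrows G" "f \<in> sections_on A"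
  shows "supp A (inv\<^bsub>section_product A\<^esub> f) = supp A f"
proof -
  have "inv\<^bsub>section_product A\<^esub> f = (\<lambda>\<gamma>\<in>A. inv\<^bsub>add_monoid (fibre \<gamma>)\<^esub> f \<gamma>)"
    using assms fibre_group by (intro inv_product_group) (auto simp: sections_on_def)
  moreover have "inv\<^bsub>add_monoid (fibre \<gamma>)\<^esub> f \<gamma> = \<zero>\<^bsub>fibre \<gamma>\<^esub> \<longleftrightarrow> f \<gamma> = \<zero>\<^bsub>fibre \<gamma>\<^esub>" if "\<gamma> \<in> A" for \<gamma>
    using group.inv_eq_1_iff[OF fibre_group, of \<gamma> "f \<gamma>"] section_on_mem[OF assms(2) that] that assms(1) by auto
  ultimately show ?thesis by (auto simp: supp_def)
qed

lemma supp_section_zero: "supp A (section_zero A) = {}"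
  by (simp add: supp_def section_zero_def)

text \<open>Stated for an arbitrary \<open>P\<close> so that it covers rows and columns alike. A
  group generated by sections with finite rows or columns then stays among such sections.\<close>

lemma finite_supp_subgroup:
  assumes A: "A \<subseteq> arrows G"
  shows "subgroup {f \<in> sections_on A. \<forall>y. finite {\<gamma> \<in> supp A f. P y \<gamma>}} (section_product A)"
proof -
  interpret S: comm_group "section_product A" by (rule section_product_comm_group[OF A])
  show ?thesis
  proof (rule S.subgroupI, simp_all only: section_product_simps)
    show "{f \<in> sections_on A. \<forall>y. finite {\<gamma> \<in> supp A f. P y \<gamma>}} \<subseteq> sections_on A" by blast
    show "{f \<in> sections_on A. \<forall>y. finite {\<gamma> \<in> supp A f. P y \<gamma>}} \<noteq> {}"
      using section_zero_closed[OF A] supp_section_zero by fastforce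
    fix f assume f: "f \<in> {f \<in> sections_on A. \<forall>y. finite {\<gamma> \<in> supp A f. P y \<gamma>}}"
    then have fs: "f \<in> sections_on A" by blast
    have "inv\<^bsub>section_product A\<^esub> f \<in> sections_on A"
      using S.inv_closed[of f] fs unfolding section_product_simps(1) by blast
    then show "inv\<^bsub>section_product A\<^esub> f \<in> {f \<in> sections_on A. \<forall>y. finite {\<gamma> \<in> supp A f. P y \<gamma>}}"
      using f unfolding mem_Collect_eq supp_section_inv[OF A fs] by blast
    fix g assume g: "g \<in> {f \<in> sections_on A. \<forall>y. finite {\<gamma> \<in> supp A f. P y \<gamma>}}"
    have fg: "f \<in> sections_on A" "g \<in> sections_on A" using f g by auto
    have "finite {\<gamma> \<in> supp A (section_add A f g). P y \<gamma>}" for y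
    proof (rule finite_subset)
      show "{\<gamma> \<in> supp A (section_add A f g). P y \<gamma>} \<subseteq> {\<gamma> \<in> supp A f. P y \<gamma>} \<union> {\<gamma> \<in> supp A g. P y \<gamma>}"
        using supp_section_add[OF A fg] by blast
      show "finite ({\<gamma> \<in> supp A f. P y \<gamma>} \<union> {\<gamma> \<in> supp A g. P y \<gamma>})" using f g by simp
    qed
    then show "section_add A f g \<in> {f \<in> sections_on A. \<forall>y. finite {\<gamma> \<in> supp A f. P y \<gamma>}}"
      using section_add_closed[OF A fg] by simp
  qed
qed

lemma conv_zero_left:
  assumes "g \<in> sections_on (arrows G)"
  shows "conv (section_zero (arrows G)) g = section_zero (arrows G)"
proof (rule section_eqI)
  show z: "section_zero (arrows G) \<in> sections_on (arrows G)" by (simp add: section_zero_closed)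
  show "conv (section_zero (arrows G)) g \<in> sections_on (arrows G)" by (rule conv_closed[OF z assms])
  fix \<gamma> assume "\<gamma> \<in> arrows G"
  moreover have "\<gamma> \<notin> supp (arrows G) (conv (section_zero (arrows G)) g)"
    using conv_supp[OF z assms] supp_section_zero by blast
  ultimately show "conv (section_zero (arrows G)) g \<gamma> = section_zero (arrows G) \<gamma>"
    by (simp add: supp_def section_zero_def)
qed

lemma conv_zero_right:
  assumes "f \<in> sections_on (arrows G)"
  shows "conv f (section_zero (arrows G)) = section_zero (arrows G)"
proof (rule section_eqI)
  show z: "section_zero (arrows G) \<in> sections_on (arrows G)" by (simp add: section_zero_closed)
  show "conv f (section_zero (arrows G)) \<in> sections_on (arrows G)" by (rule conv_closed[OF assms z])
  fix \<gamma> assume "\<gamma> \<in> arrows G"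
  moreover have "\<gamma> \<notin> supp (arrows G) (conv f (section_zero (arrows G)))"
    using conv_supp[OF assms z] supp_section_zero by blast
  ultimately show "conv f (section_zero (arrows G)) \<gamma> = section_zero (arrows G) \<gamma>"
    by (simp add: supp_def section_zero_def)
qed

lemma row_finite_subgroup: "subgroup row_finite (section_product (arrows G))"
  unfolding row_finite_def by (rule finite_supp_subgroup) simp

text \<open>The convolution ring is generated as a group, so proving it closed under products has to
  pass through additive inverses; additivity of convolution takes care of them.\<close>

lemma conv_inv_left:
  assumes f: "f \<in> row_finite" and g: "g \<in> sections_on (arrows G)"
  shows "conv (inv\<^bsub>section_product (arrows G)\<^esub> f) g = inv\<^bsub>section_product (arrows G)\<^esub> (conv f g)"
proof -
  interpret S: comm_group "section_product (arrows G)" by (rule section_product_comm_group) simp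
  note simps = section_product_simps[of "arrows G"]
  have f': "inv\<^bsub>section_product (arrows G)\<^esub> f \<in> row_finite"
    using subgroup.m_inv_closed[OF row_finite_subgroup f] .
  have fs: "f \<in> sections_on (arrows G)" "inv\<^bsub>section_product (arrows G)\<^esub> f \<in> sections_on (arrows G)"
    using f f' row_finite_section by auto
  have "section_add (arrows G) (inv\<^bsub>section_product (arrows G)\<^esub> f) f = section_zero (arrows G)"
    using S.l_inv[of f] fs(1) unfolding simps by blast
  then have "section_add (arrows G) (conv (inv\<^bsub>section_product (arrows G)\<^esub> f) g) (conv f g) = section_zero (arrows G)"
    using conv_add_left[OF f' f g] conv_zero_left[OF g] by simp
  then show ?thesis
    using S.inv_equality[of "conv (inv\<^bsub>section_product (arrows G)\<^esub> f) g" "conv f g"] conv_closed[OF fs(1) g] conv_closed[OF fs(2) g]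
    unfolding simps by simp
qed

lemma conv_inv_right:
  assumes f: "f \<in> row_finite" and g: "g \<in> sections_on (arrows G)"
  shows "conv f (inv\<^bsub>section_product (arrows G)\<^esub> g) = inv\<^bsub>section_product (arrows G)\<^esub> (conv f g)"
proof -
  interpret S: comm_group "section_product (arrows G)" by (rule section_product_comm_group) simp
  note simps = section_product_simps[of "arrows G"]
  have fs: "f \<in> sections_on (arrows G)" using f row_finite_section by auto
  have g': "inv\<^bsub>section_product (arrows G)\<^esub> g \<in> sections_on (arrows G)"
    using S.inv_closed[of g] g unfolding simps by blast
  have "section_add (arrows G) (inv\<^bsub>section_product (arrows G)\<^esub> g) g = section_zero (arrows G)"
    using S.l_inv[of g] g unfolding simps by blast
  then have "section_add (arrows G) (conv f (inv\<^bsub>section_product (arrows G)\<^esub> g)) (conv f g) = section_zero (arrows G)"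
    using conv_add_right[OF f g' g] conv_zero_right[OF fs] by simp
  then show ?thesis
    using S.inv_equality[of "conv f (inv\<^bsub>section_product (arrows G)\<^esub> g)" "conv f g"] conv_closed[OF fs g] conv_closed[OF fs g']
    unfolding simps by simp
qed

text \<open>The value of \<open>f\<close> at \<beta> is multiplied only by values of
  \<open>g\<close> at arrows with range \<open>dmap G \<beta>\<close>. Hence a section acting on a
  monomial may be replaced by another one that agrees with it on a single source fibre.\<close>

lemma convolution_cong:
  assumes sub: "A \<subseteq> arrows G" "B \<subseteq> arrows G" "C \<subseteq> arrows G"
    and f: "f \<in> sections_on A" "f' \<in> sections_on A" and g: "g \<in> sections_on B"
    and eq: "\<And>\<beta> \<rho>. \<lbrakk>\<beta> \<in> A; \<rho> \<in> supp B g; dmap G \<beta> = rmap G \<rho>\<rbrakk> \<Longrightarrow> f \<beta> = f' \<beta>"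
  shows "convolution G E A B C f g = convolution G E A B C f' g"
  unfolding convolution_def
proof (rule restrict_ext)
  fix \<gamma> assume \<gamma>: "\<gamma> \<in> C"
  interpret R: ring "fibre \<gamma>" using fibre_ring \<gamma> sub(3) by blast
  let ?I = "{(\<beta>, \<rho>) \<in> composable G. \<beta> \<in> A \<and> \<rho> \<in> B \<and> \<beta> \<star> \<rho> = \<gamma>}"
  have *: "(\<lambda>(\<beta>, \<rho>). f' \<beta> \<otimes>\<^bsub>fibre \<gamma>\<^esub> act E \<beta> (g \<rho>)) q \<in> carrier (fibre \<gamma>) \<and>
      (\<lambda>(\<beta>, \<rho>). f \<beta> \<otimes>\<^bsub>fibre \<gamma>\<^esub> act E \<beta> (g \<rho>)) q = (\<lambda>(\<beta>, \<rho>). f' \<beta> \<otimes>\<^bsub>fibre \<gamma>\<^esub> act E \<beta> (g \<rho>)) q"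
    if q: "q \<in> ?I" for q
  proof -
    obtain \<beta> \<rho> where \<beta>\<rho>: "q = (\<beta>, \<rho>)" "\<beta> \<in> A" "\<rho> \<in> B" "\<beta> \<in> arrows G" "\<rho> \<in> arrows G"
      "dmap G \<beta> = rmap G \<rho>" "\<beta> \<star> \<rho> = \<gamma>"
      using q by (auto simp: composable_iff)
    then have r: "rmap G \<beta> = rmap G \<gamma>" by auto
    have c: "f \<beta> \<in> carrier (fibre \<gamma>)" "f' \<beta> \<in> carrier (fibre \<gamma>)" "act E \<beta> (g \<rho>) \<in> carrier (fibre \<gamma>)"
      using section_on_mem[OF f(1) \<beta>\<rho>(2)] section_on_mem[OF f(2) \<beta>\<rho>(2)] r
        act_closed[OF \<beta>\<rho>(4), of "g \<rho>"] section_on_mem[OF g \<beta>\<rho>(3)] \<beta>\<rho>(6) by simp_all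
    have "f \<beta> \<otimes>\<^bsub>fibre \<gamma>\<^esub> act E \<beta> (g \<rho>) = f' \<beta> \<otimes>\<^bsub>fibre \<gamma>\<^esub> act E \<beta> (g \<rho>)"
    proof (cases "\<rho> \<in> supp B g")
      case True
      then show ?thesis using eq \<beta>\<rho> by simp
    next
      case False
      then have "act E \<beta> (g \<rho>) = \<zero>\<^bsub>fibre \<gamma>\<^esub>"
        using act_zero[OF \<beta>\<rho>(4)] \<beta>\<rho>(3,6) r by (simp add: supp_def)
      then show ?thesis using c by simp
    qed
    then show ?thesis using \<beta>\<rho>(1) R.m_closed[OF c(2,3)] by simp
  qed
  show "gfinprod (add_monoid (fibre \<gamma>)) (\<lambda>(\<beta>, \<rho>). f \<beta> \<otimes>\<^bsub>fibre \<gamma>\<^esub> act E \<beta> (g \<rho>)) ?I =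
      gfinprod (add_monoid (fibre \<gamma>)) (\<lambda>(\<beta>, \<rho>). f' \<beta> \<otimes>\<^bsub>fibre \<gamma>\<^esub> act E \<beta> (g \<rho>)) ?I"
  proof (rule R.add.gfinprod_mono_neutral_cong_left)
    show "(\<lambda>(\<beta>, \<rho>). f' \<beta> \<otimes>\<^bsub>fibre \<gamma>\<^esub> act E \<beta> (g \<rho>)) \<in> ?I \<rightarrow> carrier (fibre \<gamma>)"
      using * by (intro funcsetI) blast
  qed (use * in blast)+
qed

lemma convolution_eq_zero:
  assumes sub: "A \<subseteq> arrows G" "B \<subseteq> arrows G" "C \<subseteq> arrows G"
    and f: "f \<in> sections_on A" and g: "g \<in> sections_on B"
    and eq: "\<And>\<beta> \<rho>. \<lbrakk>\<beta> \<in> A; \<rho> \<in> supp B g; dmap G \<beta> = rmap G \<rho>\<rbrakk> \<Longrightarrow> f \<beta> = \<zero>\<^bsub>fibre \<beta>\<^esub>"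
  shows "convolution G E A B C f g = section_zero C"
proof (rule section_eqI)
  show "convolution G E A B C f g \<in> sections_on C" by (rule convolution_closed[OF sub f g])
  show "section_zero C \<in> sections_on C" by (rule section_zero_closed[OF sub(3)])
  fix \<gamma> assume \<gamma>: "\<gamma> \<in> C"
  have "\<gamma> \<notin> supp (arrows G) (conv (zero_extend A f) (zero_extend B g))"
  proof
    assume "\<gamma> \<in> supp (arrows G) (conv (zero_extend A f) (zero_extend B g))"
    then obtain \<beta> \<rho> where "\<beta> \<in> supp A f" "\<rho> \<in> supp B g" "dmap G \<beta> = rmap G \<rho>" "\<beta> \<star> \<rho> = \<gamma>"
      using conv_supp[OF zero_extend_closed[OF f] zero_extend_closed[OF g]]
      by (metis sub(1,2) supp_zero_extend)
    then show False using eq[of \<beta> \<rho>] by (simp add: supp_def)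
  qed
  then show "convolution G E A B C f g \<gamma> = section_zero C \<gamma>"
    using convolution_eq_conv[OF sub f g \<gamma>] \<gamma> sub(3) by (auto simp: supp_def section_zero_def)
qed

lemma monomial_section:
  "\<lbrakk>A \<subseteq> arrows G; a \<in> carrier (fibre \<beta>)\<rbrakk> \<Longrightarrow> monomial G E A \<beta> a \<in> sections_on A"
  by (auto simp: monomial_def sections_on_def intro!: ring.ring_simprules(2) fibre_ring)

lemma supp_monomial: "supp A (monomial G E A \<beta> a) \<subseteq> {\<beta>}"
  by (auto simp: supp_def monomial_def)

text \<open>By induction on the support: the value at one of its arrows is split off as a monomial,
  and the remainder \<open>l'\<close> has one arrow fewer in its support.\<close>

lemma finite_section_induct [consumes 3, case_names zero monomial add]:
  assumes A: "A \<subseteq> arrows G" and l: "l \<in> sections_on A" "finite (supp A l)"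
    and zero: "P (section_zero A)"
    and mono: "\<And>\<gamma> a. \<lbrakk>\<gamma> \<in> A; a \<in> carrier (fibre \<gamma>)\<rbrakk> \<Longrightarrow> P (monomial G E A \<gamma> a)"
    and add: "\<And>l l'. \<lbrakk>l \<in> sections_on A; finite (supp A l); l' \<in> sections_on A; finite (supp A l'); P l; P l'\<rbrakk> \<Longrightarrow>
      P (section_add A l l')"
  shows "P l"
  using l(2,1)
proof (induction "supp A l" arbitrary: l rule: finite_induct)
  case empty
  have "l = section_zero A"
    using empty by (intro section_eqI[OF _ section_zero_closed[OF A]]) (auto simp: supp_def section_zero_def)
  then show ?case using zero by simp
next
  case (insert \<gamma> X)
  have "\<gamma> \<in> supp A l" using insert.hyps(4) by blast
  then have \<gamma>: "\<gamma> \<in> A" "l \<gamma> \<in> carrier (fibre \<gamma>)"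
    using section_on_mem[OF insert.prems] by (simp_all add: supp_def)
  define l' where "l' = (\<lambda>\<mu>\<in>A. if \<mu> = \<gamma> then \<zero>\<^bsub>fibre \<mu>\<^esub> else l \<mu>)"
  have l': "l' \<in> sections_on A"
    unfolding l'_def sections_on_def using section_on_mem[OF insert.prems]
    by (auto intro!: ring.ring_simprules(2) fibre_ring subsetD[OF A])
  have X: "X = supp A l'" using insert.hyps(2,4) by (auto simp: supp_def l'_def)
  have m: "monomial G E A \<gamma> (l \<gamma>) \<in> sections_on A" by (rule monomial_section[OF A \<gamma>(2)])
  have "section_add A (monomial G E A \<gamma> (l \<gamma>)) l' = l"
  proof (rule section_eqI[OF section_add_closed[OF A m l'] insert.prems])
    fix \<mu> assume \<mu>: "\<mu> \<in> A"
    interpret R: ring "fibre \<mu>" using fibre_ring \<mu> A by blast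
    show "section_add A (monomial G E A \<gamma> (l \<gamma>)) l' \<mu> = l \<mu>"
      using \<mu> R.l_zero[OF section_on_mem[OF insert.prems \<mu>]] R.r_zero[OF section_on_mem[OF insert.prems \<mu>]]
      by (auto simp: section_add_def monomial_def l'_def)
  qed
  moreover have "P l'" using insert.hyps(3)[OF X l'] .
  moreover have "finite (supp A (monomial G E A \<gamma> (l \<gamma>)))"
    by (rule finite_subset[OF supp_monomial]) simp
  moreover have "finite (supp A l')" using X insert.hyps(1) by simp
  ultimately show ?case using add[OF m _ l'] mono[OF \<gamma>] by metis
qed

end

section \<open>The convolution ring\<close>

context ample_sheaf_of_rings
begin

text \<open>The condition under which a section maps finitely supported elements of \<open>L\<close>
  to finitely supported ones.\<close>

definition column_finite :: "('g \<Rightarrow> 'e) set" where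
  "column_finite = {f \<in> sections_on (arrows G). \<forall>y. finite {\<gamma> \<in> supp (arrows G) f. dmap G \<gamma> = y}}"

lemma section_ring_carrier:
  "carrier (section_ring G E) = generate (section_product (arrows G)) (elementary_sections G E)"
proof -
  have "carrier (section_product (arrows G)) \<inter> elementary_sections G E = elementary_sections G E"
    unfolding section_product_simps(1) using elementary_iff by blast
  then show ?thesis
    by (simp add: section_ring_def section_group_def carrier_subgroup_generated del: carrier_product_group)
qed

lemma section_ring_simps:
  "ring.add (section_ring G E) = section_add (arrows G)"
  "ring.zero (section_ring G E) = section_zero (arrows G)"
  "monoid.mult (section_ring G E) = conv"
  by (simp_all add: section_ring_def section_group_def section_add_def[abs_def] section_zero_def)

lemma elementary_in_ring: "f \<in> elementary_sections G E \<Longrightarrow> f \<in> carrier (section_ring G E)"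
  unfolding section_ring_carrier by (rule generate.incl)

lemma section_ring_row_finite: "carrier (section_ring G E) \<subseteq> row_finite"
proof -
  interpret S: comm_group "section_product (arrows G)" by (rule section_product_comm_group) simp
  show ?thesis
    unfolding section_ring_carrier
    by (rule S.generate_subgroup_incl[OF _ row_finite_subgroup]) (use elementary_row_finite in blast)
qed

lemma section_ring_column_finite: "carrier (section_ring G E) \<subseteq> column_finite"
proof -
  interpret S: comm_group "section_product (arrows G)" by (rule section_product_comm_group) simp
  show ?thesis
    unfolding section_ring_carrier
  proof (rule S.generate_subgroup_incl)
    show "subgroup column_finite (section_product (arrows G))"
      unfolding column_finite_def by (rule finite_supp_subgroup) simp
    show "elementary_sections G E \<subseteq> column_finite"
      using elementary_column_finite elementary_iff by (auto simp: column_finite_def)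
  qed
qed

lemma section_ring_section: "f \<in> carrier (section_ring G E) \<Longrightarrow> f \<in> sections_on (arrows G)"
  using section_ring_row_finite row_finite_section by blast

text \<open>Convolution is biadditive, so closure on generators extends to the generated group one
  factor at a time.\<close>

lemma section_ring_conv_closed:
  assumes f: "f \<in> carrier (section_ring G E)" and g: "g \<in> carrier (section_ring G E)"
  shows "conv f g \<in> carrier (section_ring G E)"
proof -
  interpret S: comm_group "section_product (arrows G)" by (rule section_product_comm_group) simp
  have sub: "subgroup (carrier (section_ring G E)) (section_product (arrows G))"
    unfolding section_ring_carrier
    by (rule S.generate_is_subgroup) (use elementary_iff section_product_simps(1) in blast)
  note sub_simps = subgroup.one_closed[OF sub, unfolded section_product_simps]
    subgroup.m_closed[OF sub, unfolded section_product_simps] subgroup.m_inv_closed[OF sub]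
  have RF: "h \<in> row_finite" "h \<in> sections_on (arrows G)" if "h \<in> carrier (section_ring G E)" for h
    using that section_ring_row_finite section_ring_section by auto
  \<comment> \<open>First stage: the right factor is a generator and the left factor is built up
    from generators; the induction on \<open>g\<close> afterwards uses this as its base.\<close>
  have e: "conv f h \<in> carrier (section_ring G E)" if h: "h \<in> elementary_sections G E" for h
  proof -
    have hs: "h \<in> sections_on (arrows G)" using h elementary_iff by blast
    show ?thesis
      using f unfolding section_ring_carrier
    proof (induction f rule: generate.induct)
      case one
      then show ?case
        using conv_zero_left[OF hs] sub_simps(1) unfolding section_ring_carrier section_product_simps by simp
    next
      case (incl f)
      then show ?case using elementary_conv[OF _ h] by (blast intro: generate.incl)
    next
      case (inv f)
      then show ?case
        using elementary_conv[OF inv h] conv_inv_left[OF elementary_row_finite[OF inv] hs]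
        by (simp only:) (rule generate.inv)
    next
      case (eng f f')
      then show ?case
        using conv_add_left[OF RF(1) RF(1) hs, of f f'] sub_simps(2)
        unfolding section_ring_carrier section_product_simps by simp
    qed
  qed
  show ?thesis
    using g unfolding section_ring_carrier
  proof (induction g rule: generate.induct)
    case one
    then show ?case
      using conv_zero_right[OF RF(2)[OF f]] sub_simps(1) unfolding section_ring_carrier section_product_simps by simp
  next
    case (incl g)
    then show ?case using e unfolding section_ring_carrier by blast
  next
    case (inv g)
    then have "g \<in> sections_on (arrows G)" using elementary_iff by blast
    then show ?case
      using e[OF inv] sub_simps(3) conv_inv_right[OF RF(1)[OF f]] unfolding section_ring_carrier by simp
  next
    case (eng g g')
    then show ?case
      using conv_add_right[OF RF(1)[OF f] RF(2) RF(2), of g g'] sub_simps(2)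
      unfolding section_ring_carrier section_product_simps by simp
  qed
qed

lemma section_ring_nonunital_ring: "nonunital_ring (section_ring G E)"
proof (intro nonunital_ring.intro nonunital_ring_axioms.intro)
  interpret S: comm_group "section_product (arrows G)" by (rule section_product_comm_group) simp
  have "comm_group (section_group G E)"
    unfolding section_group_def by (rule S.abelian_subgroup_generated[OF S.comm_group_axioms])
  then show "abelian_group (section_ring G E)"
    by (rule abelian_group_of_comm_group) (simp_all add: section_ring_def)
  have RF: "h \<in> row_finite" "h \<in> sections_on (arrows G)" if "h \<in> carrier (section_ring G E)" for h
    using that section_ring_row_finite section_ring_section by auto
  fix f g h assume *: "f \<in> carrier (section_ring G E)" "g \<in> carrier (section_ring G E)"
  then show "f \<otimes>\<^bsub>section_ring G E\<^esub> g \<in> carrier (section_ring G E)"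
    by (simp add: section_ring_simps section_ring_conv_closed)
  assume **: "h \<in> carrier (section_ring G E)"
  show "f \<otimes>\<^bsub>section_ring G E\<^esub> g \<otimes>\<^bsub>section_ring G E\<^esub> h = f \<otimes>\<^bsub>section_ring G E\<^esub> (g \<otimes>\<^bsub>section_ring G E\<^esub> h)"
    "(f \<oplus>\<^bsub>section_ring G E\<^esub> g) \<otimes>\<^bsub>section_ring G E\<^esub> h = f \<otimes>\<^bsub>section_ring G E\<^esub> h \<oplus>\<^bsub>section_ring G E\<^esub> g \<otimes>\<^bsub>section_ring G E\<^esub> h"
    "h \<otimes>\<^bsub>section_ring G E\<^esub> (f \<oplus>\<^bsub>section_ring G E\<^esub> g) = h \<otimes>\<^bsub>section_ring G E\<^esub> f \<oplus>\<^bsub>section_ring G E\<^esub> h \<otimes>\<^bsub>section_ring G E\<^esub> g"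
    unfolding section_ring_simps using * ** RF
    by (auto intro!: conv_assoc conv_add_left conv_add_right)
qed

end

section \<open>The bimodule attached to a unit\<close>

locale ample_sheaf_at_unit = ample_sheaf_of_rings G E
  for G :: "('g, 'z) groupoid_scheme" (structure) and E :: "('g, 'e, 'y) ring_sheaf_scheme" +
  fixes x :: 'g
  assumes x: "x \<in> units G"
begin

abbreviation "S \<equiv> source_fibre G x"
abbreviation "I \<equiv> isotropy G x"
abbreviation "\<Gamma> \<equiv> section_ring G E"
abbreviation "B \<equiv> skew_group_ring G E x"
abbreviation "L \<equiv> induction_module G E x"
abbreviation "ract \<equiv> induction_right_action G E x"

lemma S_arrows: "S \<subseteq> arrows G" and I_arrows: "I \<subseteq> arrows G" and I_S: "I \<subseteq> S"
  by (auto simp: source_fibre_def isotropy_def)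

lemma L_carrier: "carrier L = {l \<in> sections_on S. finite (supp S l)}"
proof -
  have "carrier (sum_group S (\<lambda>\<gamma>. add_monoid (fibre \<gamma>))) =
      {l \<in> \<Pi>\<^sub>E \<gamma>\<in>S. carrier (add_monoid (fibre \<gamma>)). finite {\<gamma> \<in> S. l \<gamma> \<noteq> \<one>\<^bsub>add_monoid (fibre \<gamma>)\<^esub>}}"
    by (rule carrier_sum_group) (use fibre_group S_arrows in blast)
  then show ?thesis by (simp add: induction_module_def induction_group_def sections_on_def supp_def)
qed

lemma L_simps: "ring.add L = section_add S" "ring.zero L = section_zero S"
  "smult L = convolution G E (arrows G) S S"
  by (simp_all add: induction_module_def induction_group_def section_add_def[abs_def] section_zero_def)

lemma I_rmap: "\<gamma> \<in> I \<Longrightarrow> rmap G \<gamma> = x"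
  by (simp add: isotropy_def)

text \<open>All isotropy arrows have range \<open>x\<close>, so the constant family of stalks in
  \<open>skew_group\<close> is the family \<open>fibre\<close> on \<open>I\<close>, and
  \<open>B\<close> fits into the same framework as \<open>L\<close>.\<close>

lemma B_carrier: "carrier B = {b \<in> sections_on I. finite (supp I b)}"
proof -
  have "group (add_monoid (stalk E x))" using fibre_group[OF unit_in_arrows[OF x]] x by simp
  then have "carrier (sum_group I (\<lambda>_. add_monoid (stalk E x))) =
      {b \<in> \<Pi>\<^sub>E i\<in>I. carrier (add_monoid (stalk E x)). finite {i \<in> I. b i \<noteq> \<one>\<^bsub>add_monoid (stalk E x)\<^esub>}}"
    by (rule carrier_sum_group)
  moreover have "(\<Pi>\<^sub>E i\<in>I. carrier (add_monoid (stalk E x))) = sections_on I"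
    unfolding sections_on_def by (rule PiE_cong) (simp add: I_rmap)
  moreover have "{i \<in> I. b i \<noteq> \<one>\<^bsub>add_monoid (stalk E x)\<^esub>} = supp I b" for b
    by (auto simp: supp_def I_rmap)
  ultimately show ?thesis by (simp add: skew_group_ring_def skew_group_def)
qed

lemma B_simps: "ring.add B = section_add I" "monoid.mult B = convolution G E I I I"
proof -
  show "ring.add B = section_add I"
    by (intro ext) (auto simp: skew_group_ring_def skew_group_def section_add_def I_rmap restrict_def)
qed (simp add: skew_group_ring_def)

lemma L_abelian_group: "abelian_group L"
proof (rule abelian_group_of_comm_group)
  show "comm_group (induction_group G E x)"
  proof (rule group.group_comm_groupI)
    show "group (induction_group G E x)"
      unfolding induction_group_def using fibre_group S_arrows by (intro sum_group) blast
    show "l \<otimes>\<^bsub>induction_group G E x\<^esub> l' = l' \<otimes>\<^bsub>induction_group G E x\<^esub> l"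
      if "l \<in> carrier (induction_group G E x)" "l' \<in> carrier (induction_group G E x)" for l l'
    proof -
      have "l \<in> sections_on S" "l' \<in> sections_on S"
        using that L_carrier by (auto simp: induction_module_def)
      then show ?thesis
        using section_add_comm[OF S_arrows] L_simps(1) by (simp add: induction_module_def del: mult_sum_group)
    qed
  qed
qed (simp_all add: induction_module_def)

lemma zero_extend_smult:
  assumes "f \<in> sections_on (arrows G)" "l \<in> sections_on S"
  shows "zero_extend S (f \<odot>\<^bsub>L\<^esub> l) = conv f (zero_extend S l)"
  unfolding L_simps using zero_extend_convolution[OF order.refl S_arrows S_arrows assms] zero_extend_arrows[OF assms(1)]
  by (simp add: source_fibre_def)

lemma zero_extend_ract:
  assumes "l \<in> sections_on S" "b \<in> sections_on I"
  shows "zero_extend S (ract l b) = conv (zero_extend S l) (zero_extend I b)"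
  unfolding induction_right_action_def
  by (rule zero_extend_convolution[OF S_arrows I_arrows S_arrows assms])
    (simp add: source_fibre_def isotropy_def)

lemma smult_section: "\<lbrakk>f \<in> sections_on (arrows G); l \<in> sections_on S\<rbrakk> \<Longrightarrow> f \<odot>\<^bsub>L\<^esub> l \<in> sections_on S"
  unfolding L_simps by (rule convolution_closed[OF order.refl S_arrows S_arrows])

lemma ract_section: "\<lbrakk>l \<in> sections_on S; b \<in> sections_on I\<rbrakk> \<Longrightarrow> ract l b \<in> sections_on S"
  unfolding induction_right_action_def by (rule convolution_closed[OF S_arrows I_arrows S_arrows])

text \<open>The support of the product lies in the union, over the finitely many \<rho> in the
  support of \<open>l\<close>, of the translates by \<rho> of the column of \<open>f\<close> at
  \<open>rmap G \<rho>\<close>; these columns are finite.\<close>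

lemma smult_L_closed:
  assumes f: "f \<in> carrier \<Gamma>" and l: "l \<in> carrier L"
  shows "f \<odot>\<^bsub>L\<^esub> l \<in> carrier L"
proof -
  have fs: "f \<in> sections_on (arrows G)" by (rule section_ring_section[OF f])
  have ls: "l \<in> sections_on S" "finite (supp S l)" using l by (auto simp: L_carrier)
  let ?X = "\<lambda>\<rho>. (\<lambda>\<beta>. \<beta> \<star> \<rho>) ` {\<beta> \<in> supp (arrows G) f. dmap G \<beta> = rmap G \<rho>}"
  have "supp S (f \<odot>\<^bsub>L\<^esub> l) \<subseteq> (\<Union>\<rho>\<in>supp S l. ?X \<rho>)"
  proof
    fix \<gamma> assume "\<gamma> \<in> supp S (f \<odot>\<^bsub>L\<^esub> l)"
    then have "\<gamma> \<in> supp (arrows G) (conv f (zero_extend S l))"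
      using zero_extend_smult[OF fs ls(1)] supp_zero_extend[OF S_arrows] by metis
    then obtain \<beta> \<rho> where "\<beta> \<in> supp (arrows G) f" "\<rho> \<in> supp S l" "dmap G \<beta> = rmap G \<rho>" "\<beta> \<star> \<rho> = \<gamma>"
      using conv_supp[OF fs zero_extend_closed[OF ls(1)]] supp_zero_extend[OF S_arrows] by metis
    then show "\<gamma> \<in> (\<Union>\<rho>\<in>supp S l. ?X \<rho>)" by blast
  qed
  moreover have "finite (\<Union>\<rho>\<in>supp S l. ?X \<rho>)"
    using ls(2) section_ring_column_finite f by (intro finite_UN_I finite_imageI) (auto simp: column_finite_def)
  ultimately show ?thesis using smult_section[OF fs ls(1)] finite_subset by (auto simp: L_carrier)
qed

lemma ract_closed:
  assumes l: "l \<in> carrier L" and b: "b \<in> carrier B"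
  shows "ract l b \<in> carrier L"
proof -
  have ls: "l \<in> sections_on S" "finite (supp S l)" using l by (auto simp: L_carrier)
  have bs: "b \<in> sections_on I" "finite (supp I b)" using b by (auto simp: B_carrier)
  have "supp S (ract l b) \<subseteq> (\<lambda>(\<beta>, \<rho>). \<beta> \<star> \<rho>) ` (supp S l \<times> supp I b)"
  proof
    fix \<gamma> assume "\<gamma> \<in> supp S (ract l b)"
    then have "\<gamma> \<in> supp (arrows G) (conv (zero_extend S l) (zero_extend I b))"
      using zero_extend_ract[OF ls(1) bs(1)] supp_zero_extend[OF S_arrows] by metis
    then obtain \<beta> \<rho> where "\<beta> \<in> supp S l" "\<rho> \<in> supp I b" "\<beta> \<star> \<rho> = \<gamma>"
      using conv_supp[OF zero_extend_closed[OF ls(1)] zero_extend_closed[OF bs(1)]]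
        supp_zero_extend[OF S_arrows] supp_zero_extend[OF I_arrows] by metis
    then show "\<gamma> \<in> (\<lambda>(\<beta>, \<rho>). \<beta> \<star> \<rho>) ` (supp S l \<times> supp I b)" by force
  qed
  then show ?thesis
    using ract_section[OF ls(1) bs(1)] finite_subset ls(2) bs(2) by (fastforce simp: L_carrier)
qed

text \<open>Each law is compared after zero extension to all arrows, where it becomes additivity or
  associativity of \<open>conv\<close>.\<close>

lemma L_left_module: "left_module \<Gamma> L"
proof (intro left_module.intro left_module_axioms.intro section_ring_nonunital_ring L_abelian_group smult_L_closed)
  have RF: "h \<in> row_finite" "h \<in> sections_on (arrows G)" if "h \<in> carrier \<Gamma>" for h
    using that section_ring_row_finite section_ring_section by auto
  have ls: "l \<in> sections_on S" "zero_extend S l \<in> sections_on (arrows G)" if "l \<in> carrier L" for l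
    using that zero_extend_closed by (auto simp: L_carrier)
  note za = zero_extend_add[OF S_arrows]
  show "(f \<oplus>\<^bsub>\<Gamma>\<^esub> g) \<odot>\<^bsub>L\<^esub> l = f \<odot>\<^bsub>L\<^esub> l \<oplus>\<^bsub>L\<^esub> g \<odot>\<^bsub>L\<^esub> l"
    if fg: "f \<in> carrier \<Gamma>" "g \<in> carrier \<Gamma>" and l: "l \<in> carrier L" for f g l
  proof (rule zero_extend_inject[OF S_arrows])
    have s: "f \<oplus>\<^bsub>\<Gamma>\<^esub> g \<in> sections_on (arrows G)"
      unfolding section_ring_simps using section_add_closed RF fg by simp
    show "(f \<oplus>\<^bsub>\<Gamma>\<^esub> g) \<odot>\<^bsub>L\<^esub> l \<in> sections_on S" by (rule smult_section[OF s ls(1)[OF l]])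
    note fl = smult_section[OF RF(2)[OF fg(1)] ls(1)[OF l]] smult_section[OF RF(2)[OF fg(2)] ls(1)[OF l]]
    show "f \<odot>\<^bsub>L\<^esub> l \<oplus>\<^bsub>L\<^esub> g \<odot>\<^bsub>L\<^esub> l \<in> sections_on S"
      unfolding L_simps(1) by (rule section_add_closed[OF S_arrows fl])
    show "zero_extend S ((f \<oplus>\<^bsub>\<Gamma>\<^esub> g) \<odot>\<^bsub>L\<^esub> l) = zero_extend S (f \<odot>\<^bsub>L\<^esub> l \<oplus>\<^bsub>L\<^esub> g \<odot>\<^bsub>L\<^esub> l)"
      unfolding L_simps(1) za[OF fl] zero_extend_smult[OF s ls(1)[OF l]]
        zero_extend_smult[OF RF(2)[OF fg(1)] ls(1)[OF l]] zero_extend_smult[OF RF(2)[OF fg(2)] ls(1)[OF l]]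
      unfolding section_ring_simps by (rule conv_add_left[OF RF(1)[OF fg(1)] RF(1)[OF fg(2)] ls(2)[OF l]])
  qed
  show "f \<odot>\<^bsub>L\<^esub> (l \<oplus>\<^bsub>L\<^esub> l') = f \<odot>\<^bsub>L\<^esub> l \<oplus>\<^bsub>L\<^esub> f \<odot>\<^bsub>L\<^esub> l'"
    if f: "f \<in> carrier \<Gamma>" and l: "l \<in> carrier L" "l' \<in> carrier L" for f l l'
  proof (rule zero_extend_inject[OF S_arrows])
    have s: "l \<oplus>\<^bsub>L\<^esub> l' \<in> sections_on S"
      unfolding L_simps using section_add_closed[OF S_arrows] ls l by simp
    show "f \<odot>\<^bsub>L\<^esub> (l \<oplus>\<^bsub>L\<^esub> l') \<in> sections_on S" by (rule smult_section[OF RF(2)[OF f] s])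
    note fl = smult_section[OF RF(2)[OF f] ls(1)[OF l(1)]] smult_section[OF RF(2)[OF f] ls(1)[OF l(2)]]
    show "f \<odot>\<^bsub>L\<^esub> l \<oplus>\<^bsub>L\<^esub> f \<odot>\<^bsub>L\<^esub> l' \<in> sections_on S"
      unfolding L_simps(1) by (rule section_add_closed[OF S_arrows fl])
    show "zero_extend S (f \<odot>\<^bsub>L\<^esub> (l \<oplus>\<^bsub>L\<^esub> l')) = zero_extend S (f \<odot>\<^bsub>L\<^esub> l \<oplus>\<^bsub>L\<^esub> f \<odot>\<^bsub>L\<^esub> l')"
      unfolding zero_extend_smult[OF RF(2)[OF f] s] unfolding L_simps(1) za[OF fl] za[OF ls(1)[OF l(1)] ls(1)[OF l(2)]]
        zero_extend_smult[OF RF(2)[OF f] ls(1)[OF l(1)]] zero_extend_smult[OF RF(2)[OF f] ls(1)[OF l(2)]]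
      by (rule conv_add_right[OF RF(1)[OF f] ls(2)[OF l(1)] ls(2)[OF l(2)]])
  qed
  show "f \<otimes>\<^bsub>\<Gamma>\<^esub> g \<odot>\<^bsub>L\<^esub> l = f \<odot>\<^bsub>L\<^esub> (g \<odot>\<^bsub>L\<^esub> l)"
    if fg: "f \<in> carrier \<Gamma>" "g \<in> carrier \<Gamma>" and l: "l \<in> carrier L" for f g l
  proof (rule zero_extend_inject[OF S_arrows])
    have s: "f \<otimes>\<^bsub>\<Gamma>\<^esub> g \<in> sections_on (arrows G)"
      unfolding section_ring_simps by (rule conv_closed[OF RF(2)[OF fg(1)] RF(2)[OF fg(2)]])
    show "f \<otimes>\<^bsub>\<Gamma>\<^esub> g \<odot>\<^bsub>L\<^esub> l \<in> sections_on S" by (rule smult_section[OF s ls(1)[OF l]])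
    note gl = smult_section[OF RF(2)[OF fg(2)] ls(1)[OF l]]
    show "f \<odot>\<^bsub>L\<^esub> (g \<odot>\<^bsub>L\<^esub> l) \<in> sections_on S" by (rule smult_section[OF RF(2)[OF fg(1)] gl])
    show "zero_extend S (f \<otimes>\<^bsub>\<Gamma>\<^esub> g \<odot>\<^bsub>L\<^esub> l) = zero_extend S (f \<odot>\<^bsub>L\<^esub> (g \<odot>\<^bsub>L\<^esub> l))"
      unfolding zero_extend_smult[OF s ls(1)[OF l]] zero_extend_smult[OF RF(2)[OF fg(1)] gl]
        zero_extend_smult[OF RF(2)[OF fg(2)] ls(1)[OF l]]
      unfolding section_ring_simps by (rule conv_assoc[OF RF(1)[OF fg(1)] RF(1)[OF fg(2)] ls(2)[OF l]])
  qed
qed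

lemma smult_ract:
  assumes f: "f \<in> carrier \<Gamma>" and l: "l \<in> carrier L" and b: "b \<in> carrier B"
  shows "f \<odot>\<^bsub>L\<^esub> ract l b = ract (f \<odot>\<^bsub>L\<^esub> l) b"
proof (rule zero_extend_inject[OF S_arrows])
  have fs: "f \<in> row_finite" "f \<in> sections_on (arrows G)"
    using f section_ring_row_finite section_ring_section by auto
  have ls: "l \<in> sections_on S" "zero_extend S l \<in> row_finite"
    using l zero_extend_row_finite[OF S_arrows] by (auto simp: L_carrier)
  have bs: "b \<in> sections_on I" using b by (simp add: B_carrier)
  note fl = smult_section[OF fs(2) ls(1)] and lb = ract_section[OF ls(1) bs]
  show "f \<odot>\<^bsub>L\<^esub> ract l b \<in> sections_on S" by (rule smult_section[OF fs(2) lb])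
  show "ract (f \<odot>\<^bsub>L\<^esub> l) b \<in> sections_on S" by (rule ract_section[OF fl bs])
  show "zero_extend S (f \<odot>\<^bsub>L\<^esub> ract l b) = zero_extend S (ract (f \<odot>\<^bsub>L\<^esub> l) b)"
    unfolding zero_extend_smult[OF fs(2) lb] zero_extend_ract[OF fl bs] zero_extend_ract[OF ls(1) bs]
      zero_extend_smult[OF fs(2) ls(1)]
    by (rule conv_assoc[OF fs(1) ls(2) zero_extend_closed[OF bs], symmetric])
qed

abbreviation atom :: "'g \<Rightarrow> 'e \<Rightarrow> 'g \<Rightarrow> 'e" where
  "atom \<equiv> monomial G E S"

lemma atom_closed: "\<lbrakk>\<gamma> \<in> S; a \<in> carrier (fibre \<gamma>)\<rbrakk> \<Longrightarrow> atom \<gamma> a \<in> carrier L"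
  using monomial_section[OF S_arrows] finite_subset[OF supp_monomial] by (simp add: L_carrier)

lemma L_induct [consumes 1, case_names zero atom add]:
  assumes "l \<in> carrier L" "P \<zero>\<^bsub>L\<^esub>"
    "\<And>\<gamma> a. \<lbrakk>\<gamma> \<in> S; a \<in> carrier (fibre \<gamma>)\<rbrakk> \<Longrightarrow> P (atom \<gamma> a)"
    "\<And>l l'. \<lbrakk>l \<in> carrier L; l' \<in> carrier L; P l; P l'\<rbrakk> \<Longrightarrow> P (l \<oplus>\<^bsub>L\<^esub> l')"
  shows "P l"
proof -
  have "l \<in> sections_on S" "finite (supp S l)" using assms(1) by (auto simp: L_carrier)
  then show ?thesis
    by (rule finite_section_induct[OF S_arrows]) (use assms in \<open>auto simp: L_carrier L_simps\<close>)
qed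

text \<open>Among the arrows composable with \<rho>, \<open>f\<close> can be nonzero only at
  \<gamma>. So it acts like the monomial at \<gamma>, and the product rule for monomials
  applies.\<close>

lemma smult_atom:
  assumes f: "f \<in> carrier \<Gamma>" and \<gamma>: "\<gamma> \<in> arrows G" "f \<gamma> = a"
    and f0: "\<And>\<beta>. \<lbrakk>\<beta> \<in> arrows G; dmap G \<beta> = dmap G \<gamma>; \<beta> \<noteq> \<gamma>\<rbrakk> \<Longrightarrow> f \<beta> = \<zero>\<^bsub>fibre \<beta>\<^esub>"
    and \<rho>: "\<rho> \<in> S" "dmap G \<gamma> = rmap G \<rho>" "b \<in> carrier (fibre \<rho>)"
  shows "f \<odot>\<^bsub>L\<^esub> atom \<rho> b = atom (\<gamma> \<star> \<rho>) (a \<otimes>\<^bsub>fibre \<gamma>\<^esub> act E \<gamma> b)"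
proof -
  have fs: "f \<in> sections_on (arrows G)" by (rule section_ring_section[OF f])
  have a: "a \<in> carrier (fibre \<gamma>)" using section_on_mem[OF fs \<gamma>(1)] \<gamma>(2) by simp
  have \<rho>': "\<rho> \<in> arrows G" using \<rho>(1) S_arrows by blast
  have "f \<odot>\<^bsub>L\<^esub> atom \<rho> b = convolution G E (arrows G) S S (monomial G E (arrows G) \<gamma> a) (atom \<rho> b)"
    unfolding L_simps
  proof (rule convolution_cong[OF order.refl S_arrows S_arrows fs])
    show "monomial G E (arrows G) \<gamma> a \<in> sections_on (arrows G)" by (rule monomial_section[OF order.refl a])
    show "atom \<rho> b \<in> sections_on S" by (rule monomial_section[OF S_arrows \<rho>(3)])
    fix \<beta> \<rho>' assume *: "\<beta> \<in> arrows G" "\<rho>' \<in> supp S (atom \<rho> b)" "dmap G \<beta> = rmap G \<rho>'"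
    then have "dmap G \<beta> = dmap G \<gamma>" using supp_monomial \<rho>(2) by fastforce
    then show "f \<beta> = monomial G E (arrows G) \<gamma> a \<beta>" using f0 * \<gamma> by (auto simp: monomial_def)
  qed
  also have "\<dots> = atom (\<gamma> \<star> \<rho>) (a \<otimes>\<^bsub>fibre \<gamma>\<^esub> act E \<gamma> b)"
    using \<gamma>(1) \<rho> \<rho>' a S_arrows by (intro convolution_monomial groupoid_axioms) (simp_all add: composable_iff)
  finally show ?thesis .
qed

lemma smult_atom_zero:
  assumes f: "f \<in> carrier \<Gamma>" and f0: "\<And>\<beta>. \<lbrakk>\<beta> \<in> arrows G; dmap G \<beta> = rmap G \<rho>\<rbrakk> \<Longrightarrow> f \<beta> = \<zero>\<^bsub>fibre \<beta>\<^esub>"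
    and \<rho>: "b \<in> carrier (fibre \<rho>)"
  shows "f \<odot>\<^bsub>L\<^esub> atom \<rho> b = \<zero>\<^bsub>L\<^esub>"
  unfolding L_simps
proof (rule convolution_eq_zero[OF order.refl S_arrows S_arrows section_ring_section[OF f] monomial_section[OF S_arrows \<rho>]])
  fix \<beta> \<rho>' assume *: "\<beta> \<in> arrows G" "\<rho>' \<in> supp S (atom \<rho> b)" "dmap G \<beta> = rmap G \<rho>'"
  then have "\<rho>' = \<rho>" using supp_monomial by blast
  then show "f \<beta> = \<zero>\<^bsub>fibre \<beta>\<^esub>" using * f0 by simp
qed

section \<open>Restriction from the source fibre to the isotropy group\<close>

lemma restrict_in_B:
  assumes "l \<in> carrier L"
  shows "restrict l I \<in> carrier B"
proof -
  have "restrict l I \<in> sections_on I" using assms I_S section_on_mem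
    by (fastforce simp: L_carrier sections_on_def)
  moreover have "supp I (restrict l I) \<subseteq> supp S l" using I_S by (auto simp: supp_def)
  ultimately show ?thesis using assms finite_subset by (auto simp: L_carrier B_carrier)
qed

lemma restrict_add: "restrict (l \<oplus>\<^bsub>L\<^esub> l') I = restrict l I \<oplus>\<^bsub>B\<^esub> restrict l' I"
  unfolding L_simps B_simps section_add_def using I_S by (auto simp: restrict_def fun_eq_iff)

text \<open>If \<beta> \<rho> and \<rho> are isotropy arrows at \<open>x\<close>, then so is
  \<beta>; hence on \<open>I\<close> the right action sees only the values of \<open>l\<close> on
  \<open>I\<close>. This linearity makes the pairing of \<open>l\<close> and \<open>m\<close> by
  restriction and action balanced.\<close>

lemma restrict_ract:
  assumes l: "l \<in> carrier L" and b: "b \<in> carrier B"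
  shows "restrict (ract l b) I = restrict l I \<otimes>\<^bsub>B\<^esub> b"
  unfolding B_simps
proof (rule section_eqI)
  have ls: "l \<in> sections_on S" and bs: "b \<in> sections_on I" and rs: "restrict l I \<in> sections_on I"
    using l b restrict_in_B[OF l] by (auto simp: L_carrier B_carrier)
  show "restrict (ract l b) I \<in> sections_on I"
    using restrict_in_B[OF ract_closed[OF l b]] by (simp add: B_carrier)
  show "convolution G E I I I (restrict l I) b \<in> sections_on I"
    by (rule convolution_closed[OF I_arrows I_arrows I_arrows rs bs])
  fix \<gamma> assume \<gamma>: "\<gamma> \<in> I"
  then have \<gamma>S: "\<gamma> \<in> S" "\<gamma> \<in> arrows G" using I_S S_arrows by auto
  interpret R: ring "fibre \<gamma>" by (rule fibre_ring[OF \<gamma>S(2)])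
  let ?I = "{(\<beta>, \<rho>) \<in> composable G. \<beta> \<in> I \<and> \<rho> \<in> I \<and> \<beta> \<star> \<rho> = \<gamma>}"
  have aux: "\<beta> \<in> I" if "(\<beta>, \<rho>) \<in> composable G" "\<rho> \<in> I" "\<beta> \<star> \<rho> = \<gamma>" for \<beta> \<rho>
  proof -
    have "rmap G \<beta> = rmap G \<gamma>" using r_comp[OF that(1)] that(3) by simp
    then show ?thesis using that \<gamma> by (simp add: composable_iff isotropy_def)
  qed
  have eq: "{(\<beta>, \<rho>) \<in> composable G. \<beta> \<in> S \<and> \<rho> \<in> I \<and> \<beta> \<star> \<rho> = \<gamma>} = ?I"
    using aux I_S by blast
  have *: "(\<lambda>(\<beta>, \<rho>). restrict l I \<beta> \<otimes>\<^bsub>fibre \<gamma>\<^esub> act E \<beta> (b \<rho>)) q \<in> carrier (fibre \<gamma>)" if q: "q \<in> ?I" for q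
  proof -
    obtain \<beta> \<rho> where \<beta>\<rho>: "q = (\<beta>, \<rho>)" "\<beta> \<in> I" "\<rho> \<in> I" "\<beta> \<in> arrows G" "\<rho> \<in> arrows G"
      "dmap G \<beta> = rmap G \<rho>" "\<beta> \<star> \<rho> = \<gamma>"
      using q by (auto simp: composable_iff)
    then have r: "rmap G \<beta> = rmap G \<gamma>" by auto
    have "restrict l I \<beta> \<otimes>\<^bsub>fibre \<beta>\<^esub> act E \<beta> (b \<rho>) \<in> carrier (fibre \<beta>)"
      by (rule conv_summand_closed[OF \<beta>\<rho>(4,5,6) section_on_mem[OF rs \<beta>\<rho>(2)] section_on_mem[OF bs \<beta>\<rho>(3)]])
    then show ?thesis unfolding r \<beta>\<rho>(1) by simp
  qed
  have "gfinprod (add_monoid (fibre \<gamma>)) (\<lambda>(\<beta>, \<rho>). l \<beta> \<otimes>\<^bsub>fibre \<gamma>\<^esub> act E \<beta> (b \<rho>)) ?I =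
      gfinprod (add_monoid (fibre \<gamma>)) (\<lambda>(\<beta>, \<rho>). restrict l I \<beta> \<otimes>\<^bsub>fibre \<gamma>\<^esub> act E \<beta> (b \<rho>)) ?I"
  proof (rule R.add.gfinprod_mono_neutral_cong_left)
    show "(\<lambda>(\<beta>, \<rho>). restrict l I \<beta> \<otimes>\<^bsub>fibre \<gamma>\<^esub> act E \<beta> (b \<rho>)) \<in> ?I \<rightarrow> carrier (fibre \<gamma>)"
      using * by (intro funcsetI) blast
    show "(\<lambda>(\<beta>, \<rho>). l \<beta> \<otimes>\<^bsub>fibre \<gamma>\<^esub> act E \<beta> (b \<rho>)) q = (\<lambda>(\<beta>, \<rho>). restrict l I \<beta> \<otimes>\<^bsub>fibre \<gamma>\<^esub> act E \<beta> (b \<rho>)) q"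
      if "q \<in> ?I" for q
      using that by auto
  qed blast+
  then show "restrict (ract l b) I \<gamma> = convolution G E I I I (restrict l I) b \<gamma>"
    using \<gamma> \<gamma>S by (simp add: induction_right_action_def convolution_def eq)
qed

end

section \<open>Simplicity of the induced module\<close>

locale induced_simple_module = ample_sheaf_at_unit G E x + M: simple_left_module "skew_group_ring G E x" M
  for G :: "('g, 'z) groupoid_scheme" (structure) and E :: "('g, 'e, 'y) ring_sheaf_scheme" and x :: 'g
    and M :: "('g \<Rightarrow> 'e, 'm, 'w) module_scheme"
begin

sublocale TP: bimodule_tensor_product \<Gamma> B L ract M
proof (intro bimodule_tensor_product.intro bimodule_tensor_product_axioms.intro tensor_product.intro
    tensor_product_axioms.intro L_left_module L_abelian_group M.M.abelian_group_axioms)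
qed (simp_all add: ract_closed smult_ract M.smult_closed)

abbreviation "T \<equiv> TP.T"

text \<open>The chosen arrow \<sigma>(y). The orbit of \<open>x\<close> is the image of
  \<open>S\<close> under \<open>rmap G\<close>, and the value is meaningful only there.\<close>

definition base_arrow :: "'g \<Rightarrow> 'g" where
  "base_arrow = inv_into S (rmap G)"

definition base_tensor :: "'g \<Rightarrow> 'm \<Rightarrow> ((('g \<Rightarrow> 'e) \<times> 'm) \<Rightarrow>\<^sub>0 int) set" where
  "base_tensor y m = TP.tens (atom (base_arrow y) \<one>\<^bsub>fibre (base_arrow y)\<^esub>) m"

lemma base_arrow:
  assumes "y \<in> rmap G ` S"
  shows "base_arrow y \<in> S" "base_arrow y \<in> arrows G" "dmap G (base_arrow y) = x" "rmap G (base_arrow y) = y"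
proof -
  show *: "base_arrow y \<in> S" "rmap G (base_arrow y) = y"
    using inv_into_into[OF assms] f_inv_into_f[OF assms] by (simp_all add: base_arrow_def)
  then show "base_arrow y \<in> arrows G" "dmap G (base_arrow y) = x" by (simp_all add: source_fibre_def)
qed

lemma base_atom:
  assumes "y \<in> rmap G ` S"
  shows "\<one>\<^bsub>fibre (base_arrow y)\<^esub> \<in> carrier (fibre (base_arrow y))"
    and "atom (base_arrow y) \<one>\<^bsub>fibre (base_arrow y)\<^esub> \<in> carrier L"
proof -
  interpret R: ring "fibre (base_arrow y)" by (rule fibre_ring[OF base_arrow(2)[OF assms]])
  show "\<one>\<^bsub>fibre (base_arrow y)\<^esub> \<in> carrier (fibre (base_arrow y))" by simp
  then show "atom (base_arrow y) \<one>\<^bsub>fibre (base_arrow y)\<^esub> \<in> carrier L"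
    by (rule atom_closed[OF base_arrow(1)[OF assms]])
qed

lemma base_tensor_closed: "\<lbrakk>y \<in> rmap G ` S; m \<in> carrier M\<rbrakk> \<Longrightarrow> base_tensor y m \<in> carrier T"
  unfolding base_tensor_def by (rule TP.tens_closed[OF base_atom(2)])

lemma base_tensor_zero: "y \<in> rmap G ` S \<Longrightarrow> base_tensor y \<zero>\<^bsub>M\<^esub> = \<zero>\<^bsub>T\<^esub>"
  unfolding base_tensor_def by (rule TP.tens_zero_right[OF base_atom(2)])

text \<open>With \<sigma> the base arrow, \<gamma> = \<sigma> \<delta> for an isotropy arrow
  \<delta>. So the monomial at \<gamma> is the base monomial times a monomial of \<open>B\<close>,
  which the balancing relation moves to \<open>m\<close>.\<close>

lemma tens_atom:
  assumes \<gamma>: "\<gamma> \<in> S" and a: "a \<in> carrier (fibre \<gamma>)" and m: "m \<in> carrier M"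
  obtains m' where "m' \<in> carrier M" "TP.tens (atom \<gamma> a) m = base_tensor (rmap G \<gamma>) m'"
proof -
  let ?y = "rmap G \<gamma>"
  let ?\<sigma> = "base_arrow ?y"
  have y: "?y \<in> rmap G ` S" using \<gamma> by blast
  note \<sigma> = base_arrow[OF y]
  have \<gamma>': "\<gamma> \<in> arrows G" "dmap G \<gamma> = x" using \<gamma> by (simp_all add: source_fibre_def)
  let ?\<delta> = "ginv G ?\<sigma> \<star> \<gamma>"
  \<comment> \<open>Chosen so that acting by \<sigma>, as the product of monomials does, returns
    \<open>a\<close>.\<close>
  let ?c = "act E (ginv G ?\<sigma>) a"
  have \<delta>: "?\<delta> \<in> I" "rmap G ?\<delta> = x" using \<sigma> \<gamma>' by (simp_all add: isotropy_def)
  have c: "?c \<in> carrier (fibre ?\<delta>)"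
    using act_closed[of "ginv G ?\<sigma>" a] a \<sigma> \<gamma>' by simp
  let ?b = "monomial G E I ?\<delta> ?c"
  have b: "?b \<in> carrier B"
    using monomial_section[OF I_arrows c] finite_subset[OF supp_monomial] by (simp add: B_carrier)
  interpret R: ring "fibre \<gamma>" by (rule fibre_ring[OF \<gamma>'(1)])
  have "act E ?\<sigma> ?c = act E (rmap G ?\<sigma>) a"
    using act_comp[of ?\<sigma> "ginv G ?\<sigma>" a] a \<sigma> by (simp add: comp_inv)
  also have "\<dots> = a"
    using a act_unit[of a] \<gamma>'(1) \<sigma> by (simp add: fibre_mem)
  finally have act: "act E ?\<sigma> ?c = a" .
  have "ract (atom ?\<sigma> \<one>\<^bsub>fibre ?\<sigma>\<^esub>) ?b = atom (?\<sigma> \<star> ?\<delta>) (\<one>\<^bsub>fibre ?\<sigma>\<^esub> \<otimes>\<^bsub>fibre ?\<sigma>\<^esub> act E ?\<sigma> ?c)"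
    unfolding induction_right_action_def
    using \<sigma> \<delta> c base_atom(1)[OF y] \<gamma>'
    by (intro convolution_monomial groupoid_axioms S_arrows) (simp_all add: composable_iff)
  also have "\<dots> = atom \<gamma> a"
    using \<sigma> \<gamma>' a by (simp add: act)
  finally have "TP.tens (atom \<gamma> a) m = TP.tens (atom ?\<sigma> \<one>\<^bsub>fibre ?\<sigma>\<^esub>) (?b \<odot>\<^bsub>M\<^esub> m)"
    using TP.tens_balanced[OF base_atom(2)[OF y] b m] by simp
  then show ?thesis
    using that[of "?b \<odot>\<^bsub>M\<^esub> m"] M.smult_closed[OF b m] unfolding base_tensor_def by blast
qed

lemma normal_form:
  assumes "X \<in> carrier T"
  obtains F \<mu> where "finite F" "F \<subseteq> rmap G ` S" "\<forall>y. \<mu> y \<in> carrier M"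
    "X = (\<Oplus>\<^bsub>T\<^esub>y\<in>F. base_tensor y (\<mu> y))"
proof -
  \<comment> \<open>The coefficients are required to vanish off \<open>F\<close>, so that two sums
    can be extended to the union of their index sets and added termwise. The condition serves this
    induction only.\<close>
  define NF where "NF X \<longleftrightarrow> (\<exists>F \<mu>. finite F \<and> F \<subseteq> rmap G ` S \<and> (\<forall>y. \<mu> y \<in> carrier M) \<and> (\<forall>y. y \<notin> F \<longrightarrow> \<mu> y = \<zero>\<^bsub>M\<^esub>) \<and>
    X = (\<Oplus>\<^bsub>T\<^esub>y\<in>F. base_tensor y (\<mu> y)))" for X
  have NF_zero: "NF \<zero>\<^bsub>T\<^esub>"
    unfolding NF_def by (rule exI[of _ "{}"], rule exI[of _ "\<lambda>_. \<zero>\<^bsub>M\<^esub>"]) simp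
  have NF_add: "NF (X \<oplus>\<^bsub>T\<^esub> Y)" if X: "NF X" and Y: "NF Y" for X Y
  proof -
    obtain F \<mu> where F: "finite F" "F \<subseteq> rmap G ` S" "\<And>y. \<mu> y \<in> carrier M" "\<And>y. y \<notin> F \<Longrightarrow> \<mu> y = \<zero>\<^bsub>M\<^esub>"
      "X = (\<Oplus>\<^bsub>T\<^esub>y\<in>F. base_tensor y (\<mu> y))"
      using X unfolding NF_def by blast
    obtain H \<nu> where H: "finite H" "H \<subseteq> rmap G ` S" "\<And>y. \<nu> y \<in> carrier M" "\<And>y. y \<notin> H \<Longrightarrow> \<nu> y = \<zero>\<^bsub>M\<^esub>"
      "Y = (\<Oplus>\<^bsub>T\<^esub>y\<in>H. base_tensor y (\<nu> y))"
      using Y unfolding NF_def by blast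
    have sub: "F \<union> H \<subseteq> rmap G ` S" using F H by blast
    have bt: "base_tensor y (\<mu> y) \<in> carrier T" "base_tensor y (\<nu> y) \<in> carrier T" if "y \<in> F \<union> H" for y
      using that sub F(3) H(3) by (blast intro: base_tensor_closed)+
    have X': "X = (\<Oplus>\<^bsub>T\<^esub>y\<in>F \<union> H. base_tensor y (\<mu> y))"
      unfolding F(5)
    proof (rule TP.T.add.finprod_mono_neutral_cong_left)
      show "base_tensor y (\<mu> y) = \<zero>\<^bsub>T\<^esub>" if "y \<in> F \<union> H - F" for y
        using that F(4) H(2) base_tensor_zero by auto
      show "(\<lambda>y. base_tensor y (\<mu> y)) \<in> F \<union> H \<rightarrow> carrier T" using bt by blast
    qed (use F(1) H(1) in auto)
    have Y': "Y = (\<Oplus>\<^bsub>T\<^esub>y\<in>F \<union> H. base_tensor y (\<nu> y))"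
      unfolding H(5)
    proof (rule TP.T.add.finprod_mono_neutral_cong_left)
      show "base_tensor y (\<nu> y) = \<zero>\<^bsub>T\<^esub>" if "y \<in> F \<union> H - H" for y
        using that H(4) F(2) base_tensor_zero by auto
      show "(\<lambda>y. base_tensor y (\<nu> y)) \<in> F \<union> H \<rightarrow> carrier T" using bt by blast
    qed (use F(1) H(1) in auto)
    have "X \<oplus>\<^bsub>T\<^esub> Y = (\<Oplus>\<^bsub>T\<^esub>y\<in>F \<union> H. base_tensor y (\<mu> y) \<oplus>\<^bsub>T\<^esub> base_tensor y (\<nu> y))"
      unfolding X' Y' by (rule TP.T.finsum_addf[symmetric]) (use bt in blast)+
    also have "\<dots> = (\<Oplus>\<^bsub>T\<^esub>y\<in>F \<union> H. base_tensor y (\<mu> y \<oplus>\<^bsub>M\<^esub> \<nu> y))"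
    proof (rule TP.T.finsum_cong')
      show "base_tensor y (\<mu> y) \<oplus>\<^bsub>T\<^esub> base_tensor y (\<nu> y) = base_tensor y (\<mu> y \<oplus>\<^bsub>M\<^esub> \<nu> y)" if "y \<in> F \<union> H" for y
        unfolding base_tensor_def
        by (rule TP.tens_add_right[OF base_atom(2) F(3) H(3), symmetric]) (use sub that in blast)
      show "(\<lambda>y. base_tensor y (\<mu> y \<oplus>\<^bsub>M\<^esub> \<nu> y)) \<in> F \<union> H \<rightarrow> carrier T"
        using sub F(3) H(3) by (intro funcsetI base_tensor_closed) auto
    qed simp
    finally have eq: "X \<oplus>\<^bsub>T\<^esub> Y = (\<Oplus>\<^bsub>T\<^esub>y\<in>F \<union> H. base_tensor y (\<mu> y \<oplus>\<^bsub>M\<^esub> \<nu> y))" .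
    show ?thesis
      unfolding NF_def
      by (rule exI[of _ "F \<union> H"], rule exI[of _ "\<lambda>y. \<mu> y \<oplus>\<^bsub>M\<^esub> \<nu> y"]) (use F H eq in auto)
  qed
  have NF_tens: "NF (TP.tens l m)" if l: "l \<in> carrier L" and m: "m \<in> carrier M" for l m
    using l
  proof (induction l rule: L_induct)
    case zero
    then show ?case using NF_zero TP.tens_zero_left[OF m] by simp
  next
    case (atom \<gamma> a)
    obtain m' where m': "m' \<in> carrier M" "TP.tens (atom \<gamma> a) m = base_tensor (rmap G \<gamma>) m'"
      by (rule tens_atom[OF atom m])
    have y: "rmap G \<gamma> \<in> rmap G ` S" using atom by blast
    have "(\<Oplus>\<^bsub>T\<^esub>y\<in>{rmap G \<gamma>}. base_tensor y (if y = rmap G \<gamma> then m' else \<zero>\<^bsub>M\<^esub>)) = base_tensor (rmap G \<gamma>) m'"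
      using base_tensor_closed[OF y m'(1)] by (simp add: TP.T.finsum_insert)
    then show ?case
      unfolding NF_def m'(2) using y m'(1)
      by (intro exI[of _ "{rmap G \<gamma>}"] exI[of _ "\<lambda>y. if y = rmap G \<gamma> then m' else \<zero>\<^bsub>M\<^esub>"]) auto
  next
    case (add l l')
    then show ?case using NF_add TP.tens_add_left[OF _ _ m] by simp
  qed
  have "NF X"
    using assms by (induction X rule: TP.T_induct) (use NF_zero NF_tens NF_add in auto)
  then show ?thesis using that unfolding NF_def by blast
qed

lemma smult_finsum_zero:
  assumes f: "f \<in> carrier \<Gamma>" and "finite F"
    and "\<And>y. y \<in> F \<Longrightarrow> v y \<in> carrier T" "\<And>y. y \<in> F \<Longrightarrow> f \<odot>\<^bsub>T\<^esub> v y = \<zero>\<^bsub>T\<^esub>"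
  shows "f \<odot>\<^bsub>T\<^esub> (\<Oplus>\<^bsub>T\<^esub>y\<in>F. v y) = \<zero>\<^bsub>T\<^esub>"
  using assms(2-4)
proof (induction F rule: finite_induct)
  case empty
  show ?case unfolding TP.T.finsum_empty by (rule TP.smult_T_zero[OF f])
next
  case (insert y F)
  have v: "v y \<in> carrier T" "v \<in> F \<rightarrow> carrier T" using insert.prems(1) by blast+
  have "f \<odot>\<^bsub>T\<^esub> (\<Oplus>\<^bsub>T\<^esub>y\<in>F. v y) = \<zero>\<^bsub>T\<^esub>" using insert.IH insert.prems by blast
  moreover have "f \<odot>\<^bsub>T\<^esub> v y = \<zero>\<^bsub>T\<^esub>" using insert.prems(2) by blast
  ultimately show ?case
    unfolding TP.T.finsum_insert[OF insert.hyps(1,2) v(2,1)] TP.smult_T_add[OF f v(1) TP.T.finsum_closed[OF v(2)]]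
    by (simp only: TP.T.l_zero TP.T.zero_closed)
qed

text \<open>Here \<open>m\<close> is the coefficient of a summand that does not vanish. Nonvanishing
  of the base tensor is kept in the conclusion for two purposes: it shows that \<open>m\<close> is
  nonzero, and it exhibits a nonzero product in the induced module.\<close>

lemma nonzero_component:
  assumes X: "X \<in> carrier T" "X \<noteq> \<zero>\<^bsub>T\<^esub>"
  obtains y m where "y \<in> rmap G ` S" "m \<in> carrier M" "base_tensor y m \<noteq> \<zero>\<^bsub>T\<^esub>"
    "\<And>\<xi> a. \<lbrakk>\<xi> \<in> S; a \<in> carrier (fibre \<xi>)\<rbrakk> \<Longrightarrow> \<exists>f\<in>carrier \<Gamma>. f \<odot>\<^bsub>T\<^esub> X = TP.tens (atom \<xi> a) m"
proof -
  obtain F \<mu> where F: "finite F" "F \<subseteq> rmap G ` S" and \<mu>': "\<forall>y. \<mu> y \<in> carrier M"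
    and XF: "X = (\<Oplus>\<^bsub>T\<^esub>y\<in>F. base_tensor y (\<mu> y))"
    by (rule normal_form[OF X(1)])
  have \<mu>: "\<mu> y \<in> carrier M" for y using \<mu>' by blast
  have bt: "base_tensor y (\<mu> y) \<in> carrier T" if "y \<in> F" for y
    using that F(2) \<mu> by (blast intro: base_tensor_closed)
  obtain y where y: "y \<in> F" "base_tensor y (\<mu> y) \<noteq> \<zero>\<^bsub>T\<^esub>"
  proof (rule ccontr)
    assume "\<not> thesis"
    then have "\<And>y. y \<in> F \<Longrightarrow> base_tensor y (\<mu> y) = \<zero>\<^bsub>T\<^esub>" using that by blast
    then have "X = \<zero>\<^bsub>T\<^esub>" unfolding XF by (rule TP.T.add.finprod_one_eqI)
    then show False using X(2) by simp
  qed
  have yS: "y \<in> rmap G ` S" using y F by blast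
  note \<sigma> = base_arrow[OF yS]
  let ?\<sigma> = "base_arrow y"
  have "F = insert y (F - {y})" using y(1) by blast
  then have X_split: "X = base_tensor y (\<mu> y) \<oplus>\<^bsub>T\<^esub> (\<Oplus>\<^bsub>T\<^esub>y\<in>F - {y}. base_tensor y (\<mu> y))"
    unfolding XF using TP.T.finsum_insert[of "F - {y}" y "\<lambda>y. base_tensor y (\<mu> y)"] F(1) bt y(1) by auto
  have rest: "(\<Oplus>\<^bsub>T\<^esub>y\<in>F - {y}. base_tensor y (\<mu> y)) \<in> carrier T"
    using bt by (intro TP.T.finsum_closed) auto
  have "\<exists>f\<in>carrier \<Gamma>. f \<odot>\<^bsub>T\<^esub> X = TP.tens (atom \<xi> a) (\<mu> y)" if \<xi>: "\<xi> \<in> S" and a: "a \<in> carrier (fibre \<xi>)" for \<xi> a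
  proof -
    have \<xi>': "\<xi> \<in> arrows G" "dmap G \<xi> = x" using \<xi> by (simp_all add: source_fibre_def)
    \<comment> \<open>The unique arrow that carries the base arrow to \<xi> by left multiplication;
      its source is \<open>y\<close>, so the section can be kept away from the other units of
      \<open>F\<close>.\<close>
    let ?\<gamma> = "\<xi> \<star> ginv G ?\<sigma>"
    have \<gamma>: "?\<gamma> \<in> arrows G" "dmap G ?\<gamma> = y" "rmap G ?\<gamma> = rmap G \<xi>" "?\<gamma> \<star> ?\<sigma> = \<xi>"
      using \<xi>' \<sigma> by simp_all
    have a': "a \<in> carrier (fibre ?\<gamma>)" using a \<gamma> by simp
    have FU: "finite (F - {y})" "F - {y} \<subseteq> units G" "dmap G ?\<gamma> \<notin> F - {y}"
    proof -
      show "F - {y} \<subseteq> units G" using F(2) S_arrows rmap_in_units by blast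
    qed (use F(1) \<gamma>(2) in simp_all)
    obtain f where f: "f \<in> elementary_sections G E" "f ?\<gamma> = a"
      "\<And>\<beta>. \<lbrakk>\<beta> \<in> arrows G; dmap G \<beta> \<in> F - {y}\<rbrakk> \<Longrightarrow> f \<beta> = \<zero>\<^bsub>fibre \<beta>\<^esub>"
      "\<And>\<beta>. \<lbrakk>\<beta> \<in> arrows G; dmap G \<beta> = dmap G ?\<gamma>; \<beta> \<noteq> ?\<gamma>\<rbrakk> \<Longrightarrow> f \<beta> = \<zero>\<^bsub>fibre \<beta>\<^esub>"
      using elementary_section_exists[OF \<gamma>(1) a' FU] by blast
    have f\<Gamma>: "f \<in> carrier \<Gamma>" by (rule elementary_in_ring[OF f(1)])
    interpret R: ring "fibre \<xi>" by (rule fibre_ring[OF \<xi>'(1)])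
    have "f \<odot>\<^bsub>L\<^esub> atom ?\<sigma> \<one>\<^bsub>fibre ?\<sigma>\<^esub> = atom (?\<gamma> \<star> ?\<sigma>) (a \<otimes>\<^bsub>fibre ?\<gamma>\<^esub> act E ?\<gamma> \<one>\<^bsub>fibre ?\<sigma>\<^esub>)"
      using \<gamma>(2) \<sigma>(4) by (intro smult_atom[OF f\<Gamma> \<gamma>(1) f(2) f(4) \<sigma>(1) _ base_atom(1)[OF yS]]) simp_all
    \<comment> \<open>The action preserves units, so the coefficient of the product is
      \<open>a\<close> itself. This is why the base monomials carry the coefficient one.\<close>
    moreover have "act E ?\<gamma> \<one>\<^bsub>fibre ?\<sigma>\<^esub> = \<one>\<^bsub>fibre \<xi>\<^esub>"
      using ring_hom_one[OF act_ring_hom[OF \<gamma>(1)]] \<gamma>(2,3) \<sigma>(4) by simp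
    ultimately have "f \<odot>\<^bsub>L\<^esub> atom ?\<sigma> \<one>\<^bsub>fibre ?\<sigma>\<^esub> = atom \<xi> a"
      using \<gamma>(3,4) a by simp
    then have 1: "f \<odot>\<^bsub>T\<^esub> base_tensor y (\<mu> y) = TP.tens (atom \<xi> a) (\<mu> y)"
      unfolding base_tensor_def by (simp add: TP.smult_tens[OF f\<Gamma> base_atom(2)[OF yS] \<mu>])
    have 2: "f \<odot>\<^bsub>T\<^esub> (\<Oplus>\<^bsub>T\<^esub>y\<in>F - {y}. base_tensor y (\<mu> y)) = \<zero>\<^bsub>T\<^esub>"
    proof (rule smult_finsum_zero[OF f\<Gamma> FU(1)])
      fix z assume z: "z \<in> F - {y}"
      then have zS: "z \<in> rmap G ` S" using F(2) by blast
      show "base_tensor z (\<mu> z) \<in> carrier T" using z bt by blast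
      have "f \<odot>\<^bsub>L\<^esub> atom (base_arrow z) \<one>\<^bsub>fibre (base_arrow z)\<^esub> = \<zero>\<^bsub>L\<^esub>"
        using f(3) z base_arrow(4)[OF zS] by (intro smult_atom_zero[OF f\<Gamma> _ base_atom(1)[OF zS]]) simp
      then show "f \<odot>\<^bsub>T\<^esub> base_tensor z (\<mu> z) = \<zero>\<^bsub>T\<^esub>"
        unfolding base_tensor_def using TP.smult_tens[OF f\<Gamma> base_atom(2)[OF zS] \<mu>] TP.tens_zero_left[OF \<mu>] by simp
    qed
    have "TP.tens (atom \<xi> a) (\<mu> y) \<in> carrier T" by (rule TP.tens_closed[OF atom_closed[OF \<xi> a] \<mu>])
    then have "f \<odot>\<^bsub>T\<^esub> X = TP.tens (atom \<xi> a) (\<mu> y)"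
      unfolding X_split TP.smult_T_add[OF f\<Gamma> bt[OF y(1)] rest] 1 2 by simp
    then show ?thesis using f\<Gamma> by blast
  qed
  then show ?thesis using that[OF yS \<mu> y(2)] by blast
qed

lemma submodule_eq_carrier:
  assumes N: "submodule N \<Gamma> T" and nz: "N \<noteq> {\<zero>\<^bsub>T\<^esub>}"
  shows "N = carrier T"
proof -
  have Ng: "subgroup N (add_monoid T)" using N by (simp add: submodule_def)
  have Ns: "f \<odot>\<^bsub>T\<^esub> X \<in> N" if "f \<in> carrier \<Gamma>" "X \<in> N" for f X
    using submodule.smult_closed[OF N that] .
  have N0: "\<zero>\<^bsub>T\<^esub> \<in> N" and Nadd: "\<And>X Y. \<lbrakk>X \<in> N; Y \<in> N\<rbrakk> \<Longrightarrow> X \<oplus>\<^bsub>T\<^esub> Y \<in> N"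
    and Ninv: "\<And>X. X \<in> N \<Longrightarrow> \<ominus>\<^bsub>T\<^esub> X \<in> N" and NT: "N \<subseteq> carrier T"
    using subgroup.one_closed[OF Ng] subgroup.m_closed[OF Ng] subgroup.m_inv_closed[OF Ng] subgroup.subset[OF Ng]
    by (simp_all add: a_inv_def)
  obtain X where X: "X \<in> N" "X \<noteq> \<zero>\<^bsub>T\<^esub>" using nz N0 by blast
  obtain y m where ym: "y \<in> rmap G ` S" "m \<in> carrier M" "base_tensor y m \<noteq> \<zero>\<^bsub>T\<^esub>"
    and f: "\<And>\<xi> a. \<lbrakk>\<xi> \<in> S; a \<in> carrier (fibre \<xi>)\<rbrakk> \<Longrightarrow> \<exists>f\<in>carrier \<Gamma>. f \<odot>\<^bsub>T\<^esub> X = TP.tens (atom \<xi> a) m"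
    using nonzero_component[of X] X NT by blast
  define M' where "M' = {m \<in> carrier M. \<forall>\<xi>\<in>S. \<forall>a\<in>carrier (fibre \<xi>). TP.tens (atom \<xi> a) m \<in> N}"
  \<comment> \<open>Membership in \<open>M'\<close> tests monomials only. For closure of
    \<open>M'\<close> under \<open>B\<close> it must pass to all of \<open>L\<close>: moving
    \<open>b\<close> to the left factor replaces the monomial by its product with \<open>b\<close>,
    in general a sum of several monomials.\<close>
  have M'_tens: "TP.tens l m \<in> N" if l: "l \<in> carrier L" and m: "m \<in> M'" for l m
    using l
  proof (induction l rule: L_induct)
    case zero
    then show ?case using N0 TP.tens_zero_left m by (simp add: M'_def)
  next
    case (atom \<gamma> a)
    then show ?case using m by (simp add: M'_def)
  next
    case (add l l')
    then show ?case using Nadd TP.tens_add_left m by (simp add: M'_def)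
  qed
  have "submodule M' B M"
  proof (intro submodule.intro submodule_axioms.intro)
    show "subgroup M' (add_monoid M)"
    proof (rule M.M.add.subgroupI)
      show "M' \<subseteq> carrier M" by (auto simp: M'_def)
      show "M' \<noteq> {}" using N0 TP.tens_zero_right atom_closed by (auto simp: M'_def intro!: exI[of _ "\<zero>\<^bsub>M\<^esub>"])
      show "\<ominus>\<^bsub>M\<^esub> m \<in> M'" if "m \<in> M'" for m
        using that Ninv by (simp add: M'_def TP.tens_minus_right atom_closed)
      show "m \<oplus>\<^bsub>M\<^esub> n \<in> M'" if "m \<in> M'" "n \<in> M'" for m n
        using that Nadd by (simp add: M'_def TP.tens_add_right atom_closed)
    qed
    show "b \<odot>\<^bsub>M\<^esub> m \<in> M'" if b: "b \<in> carrier B" and m: "m \<in> M'" for b m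
    proof -
      have mM: "m \<in> carrier M" using m by (simp add: M'_def)
      have "TP.tens (atom \<xi> a) (b \<odot>\<^bsub>M\<^esub> m) \<in> N" if "\<xi> \<in> S" "a \<in> carrier (fibre \<xi>)" for \<xi> a
        using TP.tens_balanced[OF atom_closed[OF that] b mM] M'_tens[OF ract_closed[OF atom_closed[OF that] b] m] by simp
      then show ?thesis using M.smult_closed[OF b mM] by (simp add: M'_def)
    qed
  qed
  then have "M' = {\<zero>\<^bsub>M\<^esub>} \<or> M' = carrier M" by (rule M.submodule_trivial)
  moreover have "m \<in> M'"
    unfolding M'_def
  proof (intro CollectI conjI ballI ym(2))
    fix \<xi> a assume "\<xi> \<in> S" "a \<in> carrier (fibre \<xi>)"
    then obtain g where "g \<in> carrier \<Gamma>" "g \<odot>\<^bsub>T\<^esub> X = TP.tens (atom \<xi> a) m" using f by blast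
    then show "TP.tens (atom \<xi> a) m \<in> N" using Ns[OF _ X(1)] by metis
  qed
  \<comment> \<open>The base tensor of zero is zero, so this excludes the zero submodule as the
    value of \<open>M'\<close>.\<close>
  moreover have "m \<noteq> \<zero>\<^bsub>M\<^esub>" using ym(3) base_tensor_zero[OF ym(1)] by metis
  ultimately have M': "M' = carrier M" by blast
  have "Y \<in> N" if "Y \<in> carrier T" for Y
    using that
  proof (induction Y rule: TP.T_induct)
    case zero
    show ?case by (rule N0)
  next
    case (tens l m)
    then show ?case using M'_tens M' by blast
  next
    case (add X Y)
    then show ?case using Nadd by blast
  qed
  then show ?thesis using NT by blast
qed

lemma nonzero_tensor: "\<exists>X\<in>carrier T. X \<noteq> \<zero>\<^bsub>T\<^esub>"
proof -
  obtain b m where bm: "b \<in> carrier B" "m \<in> carrier M" "b \<odot>\<^bsub>M\<^esub> m \<noteq> \<zero>\<^bsub>M\<^esub>"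
    using M.smult_nonzero by blast
  \<comment> \<open>The extension of \<open>b\<close> by zero from \<open>I\<close> to
    \<open>S\<close>: its restriction is \<open>b\<close>, so the balanced map sends the pair of
    \<open>l\<close> and \<open>m\<close> to \<open>b\<close> acting on \<open>m\<close>, which is
    nonzero.\<close>
  define l where "l = (\<lambda>\<gamma>\<in>S. if \<gamma> \<in> I then b \<gamma> else \<zero>\<^bsub>fibre \<gamma>\<^esub>)"
  have bs: "b \<in> sections_on I" "finite (supp I b)" using bm by (simp_all add: B_carrier)
  have "l \<in> sections_on S"
    unfolding l_def sections_on_def using section_on_mem[OF bs(1)]
    by (auto intro!: ring.ring_simprules(2) fibre_ring subsetD[OF S_arrows])
  moreover have "supp S l = supp I b" using I_S by (auto simp: supp_def l_def)
  ultimately have l: "l \<in> carrier L" using bs(2) by (simp add: L_carrier)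
  have lb: "restrict l I = b"
    using bs(1) I_S restrict_in_B[OF l] by (intro section_eqI[of _ I]) (auto simp: B_carrier l_def)
  have "TP.tens l m \<noteq> \<zero>\<^bsub>T\<^esub>"
  proof (rule TP.tens_nonzero[where \<phi> = "\<lambda>l m. restrict l I \<odot>\<^bsub>M\<^esub> m", OF _ M.M.abelian_group_axioms _ _ _ l bm(2)])
    show "restrict l I \<odot>\<^bsub>M\<^esub> m \<noteq> \<zero>\<^bsub>M\<^esub>" using bm(3) lb by simp
  qed (simp_all add: restrict_in_B restrict_add restrict_ract M.smult_closed M.smult_add_left M.smult_add_right
      M.smult_smult)
  then show ?thesis using TP.tens_closed[OF l bm(2)] by blast
qed

lemma induced_simple: "simple_left_module \<Gamma> T"
proof (intro simple_left_module.intro simple_left_module_axioms.intro TP.T.left_module_axioms)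
  obtain X where X: "X \<in> carrier T" "X \<noteq> \<zero>\<^bsub>T\<^esub>" using nonzero_tensor by blast
  obtain y m where ym: "y \<in> rmap G ` S" "m \<in> carrier M" "base_tensor y m \<noteq> \<zero>\<^bsub>T\<^esub>"
    and f: "\<And>\<xi> a. \<lbrakk>\<xi> \<in> S; a \<in> carrier (fibre \<xi>)\<rbrakk> \<Longrightarrow> \<exists>f\<in>carrier \<Gamma>. f \<odot>\<^bsub>T\<^esub> X = TP.tens (atom \<xi> a) m"
    by (rule nonzero_component[OF X]) blast
  \<comment> \<open>Taking for \<xi> the base arrow of \<open>y\<close> and for \<open>a\<close> the
    unit of its stalk, the product of the section with \<open>X\<close> is the nonzero base tensor
    itself.\<close>
  show "\<exists>f\<in>carrier \<Gamma>. \<exists>X\<in>carrier T. f \<odot>\<^bsub>T\<^esub> X \<noteq> \<zero>\<^bsub>T\<^esub>"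
    using f[OF base_arrow(1)[OF ym(1)] base_atom(1)[OF ym(1)]] ym(3) X(1) unfolding base_tensor_def by metis
  show "N = {\<zero>\<^bsub>T\<^esub>} \<or> N = carrier T" if "submodule N \<Gamma> T" for N
    using submodule_eq_carrier[OF that] by blast
qed

end

theorem theorem4p2:
  fixes G :: "'g groupoid" and E :: "('g, 'e) ring_sheaf" and x :: 'g
    and M :: "('g \<Rightarrow> 'e, 'm) module"
  assumes "ample_groupoid G" and "sheaf_of_rings G E" and "x \<in> units G"
    and "simple_left_module (skew_group_ring G E x) M"
  shows "simple_left_module (section_ring G E) (Ind G E x M)"
proof -
  interpret induced_simple_module G E x M
    by (intro induced_simple_module.intro ample_sheaf_at_unit.intro ample_sheaf_at_unit_axioms.intro
        ample_sheaf_of_rings.intro assms)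
  show ?thesis
    unfolding Ind_def by (rule induced_simple)
qed

end
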